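(* For any directed graph $E$ and any field $K$, the following are equivalent: (1) each graded ideal of $L_K(E)$ is an annihilator ideal; (2) (a) each cycle in $E$ is either without exits or extreme; (b) each infinite emitter lies on a cycle; and (c) for each infinite path $\alpha$, there are only finitely many edges $e$ with $\mathbf{s}(e)\in\alpha^0$ and $\mathbf{r}(e)\notin R(\alpha^0)$.
   Context: $L_K(E)$ is the Leavitt path algebra of $E$ over $K$ (generated by vertices, edges $e$ and $e^*$ with: orthogonal idempotent vertices, $\mathbf{s}(e)e=e\mathbf{r}(e)=e$, $\mathbf{r}(e)e^*=e^*\mathbf{s}(e)=e^*$, $e^*f=\delta_{e,f}\mathbf{r}(e)$, and $v=\sum_{\mathbf{s}(e)=v}ee^*$ for each vertex emitting a nonzero finite number of edges), $\mathbb{Z}$-graded with degree $n$ spanned by $pq^*$, $|p|-|q|=n$; an ideal $I$ is graded if $I=\bigoplus_n(I\cap L_K(E)_n)$. $\operatorname{ann}(I)=\{r\mid rI=Ir=0\}$; $I$ is an annihilator ideal if $\operatorname{ann}(\operatorname{ann}(I))=I$. A cycle is a closed path of positive length whose edges have distinct sources; an exit is an edge with source on the cycle not belonging to it. A cycle $c$ is extreme if it has exits and for every path $p$ with $\mathbf{s}(p)\in c^0$ there is a path $q$ with $\mathbf{s}(q)=\mathbf{r}(p)$, $\mathbf{r}(q)\in c^0$. An infinite emitter emits infinitely many edges. An infinite path is a sequence of edges $e_1e_2\dots$ with $\mathbf{r}(e_n)=\mathbf{s}(e_{n+1})$; $\alpha^0$ is its vertex set. $u\ge v$ means there is a path (possibly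 of length 0) from $u$ to $v$; $R(V)=\{u\mid u\ge v$ for some $v\in V\}$. *)

theory Defs
  imports Main
begin

text \<open>A directed graph E = (E^0, E^1, s, r); vertices and edges are given by carrier sets
  (so graphs with no edges / arbitrary cardinality are allowed).\<close>

record ('v,'e) dgraph =
  verts :: "'v set"
  edges :: "'e set"
  src   :: "'e \<Rightarrow> 'v"
  rng   :: "'e \<Rightarrow> 'v"

definition wf_graph :: "('v,'e) dgraph \<Rightarrow> bool" where
  "wf_graph G \<longleftrightarrow> (\<forall>e\<in>edges G. src G e \<in> verts G \<and> rng G e \<in> verts G)"

definition is_path :: "('v,'e) dgraph \<Rightarrow> 'v \<Rightarrow> 'e list \<Rightarrow> bool" where
  "is_path G v es \<longleftrightarrow> v \<in> verts G \<and> set es \<subseteq> edges G \<and>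
     (es \<noteq> [] \<longrightarrow> src G (hd es) = v) \<and>
     (\<forall>i. Suc i < length es \<longrightarrow> rng G (es ! i) = src G (es ! Suc i))"

definition path_end :: "('v,'e) dgraph \<Rightarrow> 'v \<Rightarrow> 'e list \<Rightarrow> 'v" where
  "path_end G v es = (if es = [] then v else rng G (last es))"

definition reaches :: "('v,'e) dgraph \<Rightarrow> 'v \<Rightarrow> 'v \<Rightarrow> bool" where
  "reaches G u w \<longleftrightarrow> (\<exists>es. is_path G u es \<and> path_end G u es = w)"

definition tree_of :: "('v,'e) dgraph \<Rightarrow> 'v set \<Rightarrow> 'v set" where
  "tree_of G W = {u \<in> verts G. \<exists>w\<in>W. reaches G u w}"

definition is_cycle :: "('v,'e) dgraph \<Rightarrow> 'e list \<Rightarrow> bool" where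
  "is_cycle G c \<longleftrightarrow> c \<noteq> [] \<and> is_path G (src G (hd c)) c \<and>
     rng G (last c) = src G (hd c) \<and> distinct (map (src G) c)"

definition cycle_verts :: "('v,'e) dgraph \<Rightarrow> 'e list \<Rightarrow> 'v set" where
  "cycle_verts G c = src G ` set c"

definition is_exit :: "('v,'e) dgraph \<Rightarrow> 'e list \<Rightarrow> 'e \<Rightarrow> bool" where
  "is_exit G c f \<longleftrightarrow> f \<in> edges G \<and> src G f \<in> cycle_verts G c \<and> f \<notin> set c"

definition has_exit :: "('v,'e) dgraph \<Rightarrow> 'e list \<Rightarrow> bool" where
  "has_exit G c \<longleftrightarrow> (\<exists>f. is_exit G c f)"

definition is_extreme :: "('v,'e) dgraph \<Rightarrow> 'e list \<Rightarrow> bool" where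
  "is_extreme G c \<longleftrightarrow> has_exit G c \<and>
     (\<forall>v es. is_path G v es \<and> v \<in> cycle_verts G c \<longrightarrow>
        (\<exists>es'. is_path G (path_end G v es) es' \<and>
               path_end G (path_end G v es) es' \<in> cycle_verts G c))"

definition infinite_emitter :: "('v,'e) dgraph \<Rightarrow> 'v \<Rightarrow> bool" where
  "infinite_emitter G v \<longleftrightarrow> v \<in> verts G \<and> infinite {e \<in> edges G. src G e = v}"

definition inf_path :: "('v,'e) dgraph \<Rightarrow> (nat \<Rightarrow> 'e) \<Rightarrow> bool" where
  "inf_path G \<alpha> \<longleftrightarrow> (\<forall>n. \<alpha> n \<in> edges G \<and> rng G (\<alpha> n) = src G (\<alpha> (Suc n)))"

definition inf_path_verts :: "('v,'e) dgraph \<Rightarrow> (nat \<Rightarrow> 'e) \<Rightarrow> 'v set" where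
  "inf_path_verts G \<alpha> = range (\<lambda>n. src G (\<alpha> n))"

definition graph_condition :: "('v,'e) dgraph \<Rightarrow> bool" where
  "graph_condition G \<longleftrightarrow>
     (\<forall>c. is_cycle G c \<longrightarrow> \<not> has_exit G c \<or> is_extreme G c) \<and>
     (\<forall>v. infinite_emitter G v \<longrightarrow> (\<exists>c. is_cycle G c \<and> v \<in> cycle_verts G c)) \<and>
     (\<forall>\<alpha>. inf_path G \<alpha> \<longrightarrow>
        finite {e \<in> edges G. src G e \<in> inf_path_verts G \<alpha> \<and>
                             rng G e \<notin> tree_of G (inf_path_verts G \<alpha>)})"

text \<open>Generators: vertices v, edges e, ghost edges e^*.\<close>
datatype ('v,'e) gen = GV 'v | GE 'e | GG 'e

text \<open>The free (non-unital) K-algebra on the generators: finitely supported functions on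
  nonempty words; multiplication is concatenation convolution.\<close>
type_synonym ('v,'e,'k) fa = "('v,'e) gen list \<Rightarrow> 'k"

definition gens :: "('v,'e) dgraph \<Rightarrow> ('v,'e) gen set" where
  "gens G = GV ` verts G \<union> GE ` edges G \<union> GG ` edges G"

definition fa_set :: "('v,'e) dgraph \<Rightarrow> ('v,'e,'k::field) fa set" where
  "fa_set G = {f. finite {w. f w \<noteq> 0} \<and> (\<forall>w. f w \<noteq> 0 \<longrightarrow> w \<noteq> [] \<and> set w \<subseteq> gens G)}"

definition fa_zero :: "('v,'e,'k::field) fa" where "fa_zero = (\<lambda>w. 0)"
definition fa_add :: "('v,'e,'k::field) fa \<Rightarrow> ('v,'e,'k) fa \<Rightarrow> ('v,'e,'k) fa" where
  "fa_add f g = (\<lambda>w. f w + g w)"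
definition fa_diff :: "('v,'e,'k::field) fa \<Rightarrow> ('v,'e,'k) fa \<Rightarrow> ('v,'e,'k) fa" where
  "fa_diff f g = (\<lambda>w. f w - g w)"
definition fa_smult :: "'k::field \<Rightarrow> ('v,'e,'k) fa \<Rightarrow> ('v,'e,'k) fa" where
  "fa_smult c f = (\<lambda>w. c * f w)"
definition fa_mult :: "('v,'e,'k::field) fa \<Rightarrow> ('v,'e,'k) fa \<Rightarrow> ('v,'e,'k) fa" where
  "fa_mult f g = (\<lambda>w. \<Sum>i\<le>length w. f (take i w) * g (drop i w))"
definition fa_mono :: "('v,'e) gen list \<Rightarrow> ('v,'e,'k::field) fa" where
  "fa_mono w = (\<lambda>u. if u = w then 1 else 0)"

definition lpa_rels :: "('v,'e) dgraph \<Rightarrow> ('v,'e,'k::field) fa set" where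
  "lpa_rels G =
     {fa_diff (fa_mono [GV v, GV v]) (fa_mono [GV v]) | v. v \<in> verts G}
   \<union> {fa_mono [GV v, GV u] | v u. v \<in> verts G \<and> u \<in> verts G \<and> v \<noteq> u}
   \<union> {fa_diff (fa_mono [GV (src G e), GE e]) (fa_mono [GE e]) | e. e \<in> edges G}
   \<union> {fa_diff (fa_mono [GE e, GV (rng G e)]) (fa_mono [GE e]) | e. e \<in> edges G}
   \<union> {fa_diff (fa_mono [GV (rng G e), GG e]) (fa_mono [GG e]) | e. e \<in> edges G}
   \<union> {fa_diff (fa_mono [GG e, GV (src G e)]) (fa_mono [GG e]) | e. e \<in> edges G}
   \<union> {fa_diff (fa_mono [GG e, GE f]) (if e = f then fa_mono [GV (rng G e)] else fa_zero)
        | e f. e \<in> edges G \<and> f \<in> edges G}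
   \<union> {fa_diff (fa_mono [GV v])
        (\<lambda>w. \<Sum>e\<in>{e \<in> edges G. src G e = v}. fa_mono [GE e, GG e] w)
        | v. v \<in> verts G \<and> {e \<in> edges G. src G e = v} \<noteq> {} \<and>
             finite {e \<in> edges G. src G e = v}}"

inductive_set lpa_J :: "('v,'e) dgraph \<Rightarrow> ('v,'e,'k::field) fa set" for G where
  base: "x \<in> lpa_rels G \<Longrightarrow> x \<in> lpa_J G"
| zero: "fa_zero \<in> lpa_J G"
| add: "x \<in> lpa_J G \<Longrightarrow> y \<in> lpa_J G \<Longrightarrow> fa_add x y \<in> lpa_J G"
| smult: "x \<in> lpa_J G \<Longrightarrow> fa_smult c x \<in> lpa_J G"
| lmult: "a \<in> fa_set G \<Longrightarrow> x \<in> lpa_J G \<Longrightarrow> fa_mult a x \<in> lpa_J G"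
| rmult: "a \<in> fa_set G \<Longrightarrow> x \<in> lpa_J G \<Longrightarrow> fa_mult x a \<in> lpa_J G"

definition lpa_cls :: "('v,'e) dgraph \<Rightarrow> ('v,'e,'k::field) fa \<Rightarrow> ('v,'e,'k) fa set" where
  "lpa_cls G x = {y \<in> fa_set G. fa_diff y x \<in> lpa_J G}"

definition lpa_carrier :: "('v,'e) dgraph \<Rightarrow> ('v,'e,'k::field) fa set set" where
  "lpa_carrier G = lpa_cls G ` fa_set G"

definition lpa_rep :: "('v,'e,'k::field) fa set \<Rightarrow> ('v,'e,'k) fa" where
  "lpa_rep X = (SOME x. x \<in> X)"

definition lpa_zero :: "('v,'e) dgraph \<Rightarrow> ('v,'e,'k::field) fa set" where
  "lpa_zero G = lpa_cls G fa_zero"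
definition lpa_add :: "('v,'e) dgraph \<Rightarrow> ('v,'e,'k::field) fa set \<Rightarrow> ('v,'e,'k) fa set \<Rightarrow> ('v,'e,'k) fa set" where
  "lpa_add G X Y = lpa_cls G (fa_add (lpa_rep X) (lpa_rep Y))"
definition lpa_neg :: "('v,'e) dgraph \<Rightarrow> ('v,'e,'k::field) fa set \<Rightarrow> ('v,'e,'k) fa set" where
  "lpa_neg G X = lpa_cls G (fa_smult (-1) (lpa_rep X))"
definition lpa_mult :: "('v,'e) dgraph \<Rightarrow> ('v,'e,'k::field) fa set \<Rightarrow> ('v,'e,'k) fa set \<Rightarrow> ('v,'e,'k) fa set" where
  "lpa_mult G X Y = lpa_cls G (fa_mult (lpa_rep X) (lpa_rep Y))"

definition lpa_ideal :: "('v,'e) dgraph \<Rightarrow> ('v,'e,'k::field) fa set set \<Rightarrow> bool" where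
  "lpa_ideal G I \<longleftrightarrow> I \<subseteq> lpa_carrier G \<and> lpa_zero G \<in> I \<and>
     (\<forall>X\<in>I. \<forall>Y\<in>I. lpa_add G X Y \<in> I) \<and> (\<forall>X\<in>I. lpa_neg G X \<in> I) \<and>
     (\<forall>A\<in>lpa_carrier G. \<forall>X\<in>I. lpa_mult G A X \<in> I \<and> lpa_mult G X A \<in> I)"

definition lpa_ann :: "('v,'e) dgraph \<Rightarrow> ('v,'e,'k::field) fa set set \<Rightarrow> ('v,'e,'k) fa set set" where
  "lpa_ann G I = {A \<in> lpa_carrier G. \<forall>X\<in>I. lpa_mult G A X = lpa_zero G \<and> lpa_mult G X A = lpa_zero G}"

definition annihilator_ideal :: "('v,'e) dgraph \<Rightarrow> ('v,'e,'k::field) fa set set \<Rightarrow> bool" where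
  "annihilator_ideal G I \<longleftrightarrow> lpa_ann G (lpa_ann G I) = I"

definition path_word :: "'v \<Rightarrow> 'e list \<Rightarrow> ('v,'e,'k::field) fa" where
  "path_word v es = (if es = [] then fa_mono [GV v] else fa_mono (map GE es))"
definition ghost_word :: "'v \<Rightarrow> 'e list \<Rightarrow> ('v,'e,'k::field) fa" where
  "ghost_word v es = (if es = [] then fa_mono [GV v] else fa_mono (rev (map GG es)))"

definition lpa_hgens :: "('v,'e) dgraph \<Rightarrow> int \<Rightarrow> ('v,'e,'k::field) fa set" where
  "lpa_hgens G n = {fa_mult (path_word v p) (ghost_word u q) | v p u q.
      is_path G v p \<and> is_path G u q \<and> int (length p) - int (length q) = n}"

inductive_set fa_span :: "('v,'e,'k::field) fa set \<Rightarrow> ('v,'e,'k) fa set" for H where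
  zero: "fa_zero \<in> fa_span H"
| gen: "h \<in> H \<Longrightarrow> h \<in> fa_span H"
| add: "x \<in> fa_span H \<Longrightarrow> y \<in> fa_span H \<Longrightarrow> fa_add x y \<in> fa_span H"
| smult: "x \<in> fa_span H \<Longrightarrow> fa_smult c x \<in> fa_span H"

definition lpa_comp :: "('v,'e) dgraph \<Rightarrow> int \<Rightarrow> ('v,'e,'k::field) fa set set" where
  "lpa_comp G n = lpa_cls G ` fa_span (lpa_hgens G n)"

definition lpa_sum :: "('v,'e) dgraph \<Rightarrow> (int \<Rightarrow> ('v,'e,'k::field) fa set) \<Rightarrow> int set \<Rightarrow> ('v,'e,'k) fa set" where
  "lpa_sum G Y N = lpa_cls G (\<lambda>w. \<Sum>n\<in>N. lpa_rep (Y n) w)"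

definition graded_ideal :: "('v,'e) dgraph \<Rightarrow> ('v,'e,'k::field) fa set set \<Rightarrow> bool" where
  "graded_ideal G I \<longleftrightarrow> lpa_ideal G I \<and>
     (\<forall>X\<in>I. \<exists>N Y. finite N \<and> (\<forall>n\<in>N. Y n \<in> I \<inter> lpa_comp G n) \<and> X = lpa_sum G Y N)"

end

theory Submission
  imports Defs "HOL-Library.Function_Algebras"
begin

text \<open>
  All computations take place in the free algebra, modulo the ideal J of relations, where the
  graded ideals of the Leavitt path algebra become the ideals P that contain J and are closed
  under the degree projections.

  Key reduction: an element x outside P can be multiplied on the left by a ghost path so that it
  becomes, modulo J, a linear combination of ghost paths with a common end w that still lies outside
  P. At a regular vertex this uses the second Cuntz-Krieger relation; at an infinite emitter one
  uses an edge that does not occur in x, provided that emitters outside P emit no edge into P. On the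
  other hand, if P contains a nonzero combination of ghost paths ending in w, then w is in P.

  Consequently, with H the set of vertices in P, every vertex that does not reach H annihilates P,
  and P is an annihilator ideal as soon as H contains each vertex from which H cannot be escaped.
  Conversely, a vertex from which H cannot be escaped lies in the double annihilator of the ideal
  generated by H, while a representation on boundary paths avoiding H shows that this ideal contains
  no vertices outside the hereditary saturated set H. The graph condition is equivalent to the
  statement that every hereditary saturated set contains the vertices that cannot escape from it.
\<close>

section \<open>The free algebra\<close>

text \<open>The delicate point is an infinite emitter v outside P with edges into P. There v minus a
  finite sum of terms ee^* may lie outside P although every ghost edge carries it into P, and the
  reduction gets stuck. The graph condition excludes this: v lies on a cycle, paths starting on a
  cycle can return to it, so an edge into the hereditary set H would pull v into H. The ideal J
  contains no vertex at all and always admits the reduction, which is why the converse direction can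
  reduce modulo J in any graph. Ghost combinations are kept as explicit elements of the free algebra
  because left multiplication by a ghost path is injective there. Both directions end alike: a ghost
  combination g is transported along a path to a vertex u, where u and g lie in ideals that
  annihilate each other. The transported combination is then zero, hence so is g. The reduction
  multiplies on the left only, while annihilators are two-sided. A right factor u is controlled by
  the fact that only ghost paths starting at u survive it.\<close>

abbreviation fa_times (infixl "\<star>" 70) where "fa_times \<equiv> fa_mult"
abbreviation fa_scale (infixr "\<cdot>" 75) where "fa_scale \<equiv> fa_smult"

lemmas fun_apply = plus_fun_apply zero_fun_apply minus_apply uminus_apply

text \<open>Higher-order unification in induction rules eta-expands elements of the algebra; these rules
  would then push the operations below the abstraction.\<close>

declare fun_apply [simp del]

lemma fa_add_eq: "fa_add f g = f + g"
  by (simp add: fa_add_def fun_eq_iff fun_apply)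
lemma fa_diff_eq: "fa_diff f g = f - g"
  by (simp add: fa_diff_def fun_eq_iff fun_apply)
lemma fa_zero_eq: "fa_zero = 0"
  by (simp add: fa_zero_def fun_eq_iff fun_apply)
lemmas fa_eqs = fa_add_eq fa_diff_eq fa_zero_eq

lemma sum_fun_apply: "(\<Sum>a\<in>A. F a) w = (\<Sum>a\<in>A. F a w)"
  by (induction A rule: infinite_finite_induct) (auto simp: fun_apply)

lemma smult_simps:
  "c \<cdot> (f + g) = c \<cdot> f + c \<cdot> g" "(c + d) \<cdot> f = c \<cdot> f + d \<cdot> f"
  "c \<cdot> (f - g) = c \<cdot> f - c \<cdot> g" "c \<cdot> d \<cdot> f = (c * d) \<cdot> f" "(1::'k::field) \<cdot> f = f"
  "0 \<cdot> f = 0" "c \<cdot> 0 = 0" "(- 1) \<cdot> f = - f"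
  by (auto simp: fa_smult_def fun_eq_iff fun_apply algebra_simps)

lemma mult_distrib:
  "(f + g) \<star> h = f \<star> h + g \<star> h" "h \<star> (f + g) = h \<star> f + h \<star> g"
  "(f - g) \<star> h = f \<star> h - g \<star> h" "h \<star> (f - g) = h \<star> f - h \<star> g"
  "(c \<cdot> f) \<star> h = c \<cdot> (f \<star> h)" "h \<star> (c \<cdot> f) = c \<cdot> (h \<star> f)"
  "0 \<star> f = 0" "f \<star> 0 = 0"
  by (simp_all add: fa_mult_def fa_smult_def fun_eq_iff fun_apply sum.distrib sum_subtractf
      distrib_left distrib_right left_diff_distrib right_diff_distrib sum_distrib_left ac_simps)

lemma mult_sum_left: "(\<Sum>a\<in>A. F a) \<star> h = (\<Sum>a\<in>A. F a \<star> h)"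
  by (induction A rule: infinite_finite_induct) (auto simp: mult_distrib)
text \<open>Only the split after \<open>length u\<close> letters contributes to the convolution, so
  multiplying by a monomial is a shift. A shift loses no coefficient, which later yields left
  cancellation.\<close>

lemma mono_mult: "fa_mono u \<star> g = (\<lambda>w. if take (length u) w = u then g (drop (length u) w) else 0)"
proof
  fix w
  let ?t = "if take (length u) w = u then g (drop (length u) w) else 0"
  have eq: "take i w = u \<longleftrightarrow> i = length u \<and> take (length u) w = u" if "i \<le> length w" for i
    using that by (auto simp: min_absorb2)
  have "(fa_mono u \<star> g) w = (\<Sum>i\<le>length w. if i = length u then ?t else 0)"
    unfolding fa_mult_def fa_mono_def
  proof (rule sum.cong)
    fix i assume "i \<in> {..length w}"
    then show "(if take i w = u then 1 else 0) * g (drop i w) = (if i = length u then ?t else 0)"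
      using eq[of i] by simp
  qed simp
  also have "\<dots> = (if length u \<le> length w then ?t else 0)"
    by (simp add: sum.delta)
  \<comment> \<open>If \<open>w\<close> is shorter than \<open>u\<close>, the test in
    \<open>?t\<close> fails because \<open>take\<close> returns at most \<open>w\<close>.\<close>
  also have "\<dots> = ?t"
    by (cases "length u \<le> length w") auto
  finally show "(fa_mono u \<star> g) w = ?t" .
qed

lemma mono_mult_mono: "fa_mono u \<star> fa_mono v = fa_mono (u @ v)"
proof
  fix w
  have "w = u @ v \<longleftrightarrow> take (length u) w = u \<and> drop (length u) w = v"
    by (metis append_eq_conv_conj)
  then show "(fa_mono u \<star> fa_mono v) w = fa_mono (u @ v) w"
    unfolding mono_mult by (simp add: fa_mono_def)
qed

lemma mono_mult_append [simp]: "(fa_mono u \<star> g) (u @ w) = g w"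
  by (simp add: mono_mult)

lemma mono_Nil_mult [simp]: "fa_mono [] \<star> g = g"
  by (simp add: mono_mult fun_eq_iff)

text \<open>The set \<open>A\<close> records a shape of words, so that membership says "linear
  combination of words of this shape". The carrier \<open>fa_set G\<close> is the case
  \<open>A = words G\<close>.\<close>

definition supp_on :: "('v,'e) gen list set \<Rightarrow> ('v,'e,'k::field) fa set" where
  "supp_on A = {f. finite {w. f w \<noteq> 0} \<and> {w. f w \<noteq> 0} \<subseteq> A}"

lemma supp_on_0 [simp]: "0 \<in> supp_on A"
  by (simp add: supp_on_def fun_apply)

lemma supp_on_add: "f \<in> supp_on A \<Longrightarrow> g \<in> supp_on A \<Longrightarrow> f + g \<in> supp_on A"
proof -
  assume a: "f \<in> supp_on A" "g \<in> supp_on A"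
  have "{w. (f + g) w \<noteq> 0} \<subseteq> {w. f w \<noteq> 0} \<union> {w. g w \<noteq> 0}" by (auto simp: fun_apply)
  with a show ?thesis unfolding supp_on_def by (auto intro: finite_subset)
qed

lemma supp_on_smult: "f \<in> supp_on A \<Longrightarrow> c \<cdot> f \<in> supp_on A"
  unfolding supp_on_def fa_smult_def by (auto elim: rev_finite_subset)

lemma supp_on_sum: "(\<And>a. a \<in> S \<Longrightarrow> F a \<in> supp_on A) \<Longrightarrow> sum F S \<in> supp_on A"
  by (induction S rule: infinite_finite_induct) (auto intro: supp_on_add)

lemma supp_on_mono [simp]: "fa_mono w \<in> supp_on A \<longleftrightarrow> w \<in> A"
  by (auto simp: supp_on_def fa_mono_def)

lemma supp_on_subset: "f \<in> supp_on A \<Longrightarrow> A \<subseteq> B \<Longrightarrow> f \<in> supp_on B"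
  by (auto simp: supp_on_def)

text \<open>Reduces a linear statement to single words. The tail \<open>g\<close> is again supported
  in \<open>A\<close>, so support lemmas apply to it inside the step.\<close>

lemma supp_on_induct [consumes 1, case_names zero step]:
  assumes "f \<in> supp_on A" and z: "Q 0"
    and s: "\<And>c w g. w \<in> A \<Longrightarrow> g \<in> supp_on A \<Longrightarrow> Q g \<Longrightarrow> Q (c \<cdot> fa_mono w + g)"
  shows "Q f"
proof -
  \<comment> \<open>The set \<open>S\<close> may exceed the support, which covers the case that the
    coefficient of the inserted word is zero.\<close>
  have "finite S \<Longrightarrow> S \<subseteq> A \<Longrightarrow> {w. f w \<noteq> 0} \<subseteq> S \<Longrightarrow> Q f" for S f
  proof (induction S arbitrary: f rule: finite_induct)
    case empty
    then have "f = 0" by (auto simp: fun_eq_iff fun_apply)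
    then show ?case using z by simp
  next
    case (insert w S)
    let ?g = "f(w := 0)"
    have sub: "{w. ?g w \<noteq> 0} \<subseteq> S" using insert.prems by auto
    then have "Q ?g" using insert by blast
    moreover have "?g \<in> supp_on A"
      using insert sub unfolding supp_on_def by (auto intro: finite_subset)
    moreover have "f = f w \<cdot> fa_mono w + ?g"
      by (auto simp: fun_eq_iff fun_apply fa_smult_def fa_mono_def)
    ultimately show ?case using s[of w ?g "f w"] insert.prems by simp
  qed
  then show ?thesis using assms(1) by (auto simp: supp_on_def)
qed

lemma supp_on_mult:
  assumes f: "f \<in> supp_on A" and g: "g \<in> supp_on B"
    and ab: "\<And>a b. a \<in> A \<Longrightarrow> b \<in> B \<Longrightarrow> a @ b \<in> C"
  shows "f \<star> g \<in> supp_on C"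
  using f
proof (induction rule: supp_on_induct)
  case (step c w f)
  have "fa_mono w \<star> g \<in> supp_on C"
    using g by (induction rule: supp_on_induct)
      (auto simp: mult_distrib mono_mult_mono ab[OF step(1)] intro!: supp_on_add supp_on_smult)
  with step show ?case by (auto simp: mult_distrib intro: supp_on_add supp_on_smult)
qed (auto simp: mult_distrib)

lemma mult_assoc:
  assumes f: "f \<in> supp_on A" and g: "g \<in> supp_on B" and h: "h \<in> supp_on C"
  shows "(f \<star> g) \<star> h = f \<star> (g \<star> h)"
  using f
proof (induction rule: supp_on_induct)
  case (step c u f)
  have "(fa_mono u \<star> g) \<star> h = fa_mono u \<star> (g \<star> h)" using g
  proof (induction rule: supp_on_induct)
    case (step c v g)
    have "(fa_mono u \<star> fa_mono v) \<star> h = fa_mono u \<star> (fa_mono v \<star> h)" using h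
      by (induction rule: supp_on_induct) (auto simp: mult_distrib mono_mult_mono)
    with step show ?case by (auto simp: mult_distrib)
  qed (auto simp: mult_distrib)
  with step show ?case by (auto simp: mult_distrib)
qed (auto simp: mult_distrib)

section \<open>Projections onto sets of words, and degrees\<close>

definition restr :: "('v,'e) gen list set \<Rightarrow> ('v,'e,'k::field) fa \<Rightarrow> ('v,'e,'k) fa" where
  "restr D f = (\<lambda>w. if w \<in> D then f w else 0)"

lemma restr_simps:
  "restr D (f + g) = restr D f + restr D g" "restr D (f - g) = restr D f - restr D g"
  "restr D (c \<cdot> f) = c \<cdot> restr D f" "restr D 0 = 0"
  "restr D (fa_mono w) = (if w \<in> D then fa_mono w else 0)"
  by (auto simp: restr_def fun_eq_iff fun_apply fa_smult_def fa_mono_def)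

lemma restr_sum: "restr D (\<Sum>a\<in>S. F a) = (\<Sum>a\<in>S. restr D (F a))"
  by (induction S rule: infinite_finite_induct) (auto simp: restr_simps)

lemma restr_supp_on: "f \<in> supp_on A \<Longrightarrow> restr D f \<in> supp_on (A \<inter> D)"
  by (auto simp: supp_on_def restr_def elim: rev_finite_subset)

lemma restr_split: "f = restr D f + restr (- D) f"
  by (auto simp: restr_def fun_eq_iff fun_apply)

lemma restr_id: "f \<in> supp_on A \<Longrightarrow> A \<subseteq> D \<Longrightarrow> restr D f = f"
  by (auto simp: supp_on_def restr_def fun_eq_iff fun_apply)

lemma restr_null: "f \<in> supp_on A \<Longrightarrow> A \<inter> D = {} \<Longrightarrow> restr D f = 0"
  by (auto simp: supp_on_def restr_def fun_eq_iff fun_apply)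

fun gen_deg :: "('v,'e) gen \<Rightarrow> int" where
  "gen_deg (GV v) = 0" | "gen_deg (GE e) = 1" | "gen_deg (GG e) = - 1"

definition word_deg :: "('v,'e) gen list \<Rightarrow> int" where
  "word_deg w = sum_list (map gen_deg w)"

lemma word_deg_simps [simp]:
  "word_deg [] = 0" "word_deg (g # w) = gen_deg g + word_deg w"
  "word_deg (w @ w') = word_deg w + word_deg w'"
  by (auto simp: word_deg_def)

lemma word_deg_map [simp]:
  "word_deg (map GE p) = int (length p)" "word_deg (map GG p) = - int (length p)"
  "word_deg (rev w) = word_deg w"
  by (induction p) (auto simp: word_deg_def rev_map[symmetric])

abbreviation hproj :: "int \<Rightarrow> ('v,'e,'k::field) fa \<Rightarrow> ('v,'e,'k) fa" where
  "hproj n \<equiv> restr {w. word_deg w = n}"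

lemma hproj_mono_mult:
  "f \<in> supp_on A \<Longrightarrow> hproj n (fa_mono w \<star> f) = fa_mono w \<star> hproj (n - word_deg w) f"
  by (induction rule: supp_on_induct)
    (auto simp: mult_distrib restr_simps mono_mult_mono)

lemma hproj_mult_mono:
  "f \<in> supp_on A \<Longrightarrow> hproj n (f \<star> fa_mono w) = hproj (n - word_deg w) f \<star> fa_mono w"
  by (induction rule: supp_on_induct)
    (auto simp: mult_distrib restr_simps mono_mult_mono)

section \<open>Subspaces and rewriting modulo a subspace\<close>

definition subspace :: "('v,'e,'k::field) fa set \<Rightarrow> bool" where
  "subspace P \<longleftrightarrow> 0 \<in> P \<and> (\<forall>x\<in>P. \<forall>y\<in>P. x + y \<in> P) \<and> (\<forall>c. \<forall>x\<in>P. c \<cdot> x \<in> P)"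

lemma subspaceD:
  assumes "subspace P"
  shows "0 \<in> P" "x \<in> P \<Longrightarrow> y \<in> P \<Longrightarrow> x + y \<in> P" "x \<in> P \<Longrightarrow> c \<cdot> x \<in> P"
    "x \<in> P \<Longrightarrow> y \<in> P \<Longrightarrow> x - y \<in> P"
proof -
  show a: "0 \<in> P" "x \<in> P \<Longrightarrow> y \<in> P \<Longrightarrow> x + y \<in> P" "x \<in> P \<Longrightarrow> c \<cdot> x \<in> P" for x y c
    using assms by (auto simp: subspace_def)
  show "x \<in> P \<Longrightarrow> y \<in> P \<Longrightarrow> x - y \<in> P"
    using a(2)[of x "(-1) \<cdot> y"] a(3)[of y "-1"] by (simp add: smult_simps)
qed

lemma subspace_sum: "subspace P \<Longrightarrow> (\<And>a. a \<in> S \<Longrightarrow> F a \<in> P) \<Longrightarrow> sum F S \<in> P"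
  by (induction S rule: infinite_finite_induct) (auto intro: subspaceD)

lemma subspace_diff_trans:
  "subspace P \<Longrightarrow> x - y \<in> P \<Longrightarrow> y - z \<in> P \<Longrightarrow> x - z \<in> P"
  using subspaceD(2)[of P "x - y" "y - z"] by simp

lemma subspace_diff_sym:
  "subspace P \<Longrightarrow> x - y \<in> P \<Longrightarrow> y - x \<in> P"
  using subspaceD(3)[of P "x - y" "- 1"] by (simp add: smult_simps)

lemma subspace_mem_cong: "subspace P \<Longrightarrow> x - y \<in> P \<Longrightarrow> x \<in> P \<longleftrightarrow> y \<in> P"
  using subspaceD(2)[of P "x - y" y] subspaceD(4)[of P x "x - y"] by auto

text \<open>Extends a rewriting of words modulo \<open>P\<close> to linear combinations. Taking an
  arbitrary linear \<open>T\<close> covers multiplication by a fixed element.\<close>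

lemma supp_on_rewrite:
  assumes P: "subspace P" and f: "f \<in> supp_on A"
    and r: "\<And>w. w \<in> A \<Longrightarrow> \<exists>g\<in>supp_on B. T (fa_mono w) - g \<in> P"
    and T: "\<And>f g. T (f + g) = T f + T g" "\<And>c f. T (c \<cdot> f) = c \<cdot> T f"
  shows "\<exists>g\<in>supp_on B. T f - g \<in> P"
  using f
proof (induction rule: supp_on_induct)
  case zero
  have "T 0 = 0" using T(2)[of 0 0] by (simp add: smult_simps)
  then show ?case using subspaceD(1)[OF P] by (intro bexI[of _ 0]) auto
next
  case (step c w f)
  then obtain g h where gh: "g \<in> supp_on B" "T (fa_mono w) - g \<in> P" "h \<in> supp_on B" "T f - h \<in> P"
    using r by blast
  have "T (c \<cdot> fa_mono w + f) - (c \<cdot> g + h) = c \<cdot> (T (fa_mono w) - g) + (T f - h)"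
    unfolding T smult_simps by simp
  also have "\<dots> \<in> P" using gh subspaceD(2,3)[OF P] by blast
  finally show ?case using gh by (auto intro!: bexI[of _ "c \<cdot> g + h"] supp_on_add supp_on_smult)
qed

lemma supp_on_linear_mem:
  assumes P: "subspace P" and f: "f \<in> supp_on A"
    and r: "\<And>w. w \<in> A \<Longrightarrow> T (fa_mono w) \<in> P"
    and T: "\<And>f g. T (f + g) = T f + T g" "\<And>c f. T (c \<cdot> f) = c \<cdot> T f"
  shows "T f \<in> P"
  using f
proof (induction rule: supp_on_induct)
  case zero
  have "T 0 = 0" using T(2)[of 0 0] by (simp add: smult_simps)
  then show ?case using subspaceD(1)[OF P] by simp
next
  case (step c w f)
  then show ?case using r subspaceD(2,3)[OF P] by (simp add: T)
qed

section \<open>Ideals and the defining relations\<close>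

notation fa_mono ("\<langle>_\<rangle>")

text \<open>Unlike \<open>mult_assoc\<close> this puts no condition on the last factor, since both
  sides are shifts of \<open>f\<close>; it can be used as an unconditional rewrite rule.\<close>

lemma mono_mono_mult: "\<langle>u\<rangle> \<star> (\<langle>v\<rangle> \<star> f) = \<langle>u @ v\<rangle> \<star> f"
proof
  fix w
  have "take (length u) w = u \<and> take (length v) (drop (length u) w) = v
      \<longleftrightarrow> take (length u + length v) w = u @ v"
  proof
    assume "take (length u + length v) w = u @ v"
    then have "take (length u) (take (length u + length v) w) = u"
      "drop (length u) (take (length u + length v) w) = v" by simp_all
    then show "take (length u) w = u \<and> take (length v) (drop (length u) w) = v"
      by (simp add: drop_take)
  qed (simp add: take_add)
  then show "(\<langle>u\<rangle> \<star> (\<langle>v\<rangle> \<star> f)) w = (\<langle>u @ v\<rangle> \<star> f) w"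
    unfolding mono_mult by (auto simp: add.commute)
qed

lemma mult_mono_Nil: "f \<in> supp_on A \<Longrightarrow> f \<star> \<langle>[]\<rangle> = f"
  by (induction rule: supp_on_induct) (auto simp: mult_distrib mono_mult_mono)

lemma mult_mono_mono: "f \<in> supp_on A \<Longrightarrow> (f \<star> \<langle>u\<rangle>) \<star> \<langle>v\<rangle> = f \<star> \<langle>u @ v\<rangle>"
  by (induction rule: supp_on_induct) (auto simp: mult_distrib mono_mult_mono)

definition words :: "('v,'e) dgraph \<Rightarrow> ('v,'e) gen list set" where
  "words G = {w. w \<noteq> [] \<and> set w \<subseteq> gens G}"

lemma fa_set_eq: "fa_set G = supp_on (words G)"
  by (auto simp: fa_set_def supp_on_def words_def)

lemma subspace_supp_on: "subspace (supp_on A)"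
  by (auto simp: subspace_def supp_on_add supp_on_smult)

lemma fa_set_mult: "f \<in> fa_set G \<Longrightarrow> g \<in> fa_set G \<Longrightarrow> f \<star> g \<in> fa_set G"
  unfolding fa_set_eq by (erule supp_on_mult) (auto simp: words_def)

text \<open>One closure for two purposes: \<open>J\<close> itself, and the ideals generated by the
  relations together with a set of vertices.\<close>

inductive_set gen_ideal :: "('v,'e) dgraph \<Rightarrow> ('v,'e,'k::field) fa set \<Rightarrow> ('v,'e,'k) fa set"
  for G R where
  base: "x \<in> R \<Longrightarrow> x \<in> gen_ideal G R"
| zero: "0 \<in> gen_ideal G R"
| add: "x \<in> gen_ideal G R \<Longrightarrow> y \<in> gen_ideal G R \<Longrightarrow> x + y \<in> gen_ideal G R"
| smult: "x \<in> gen_ideal G R \<Longrightarrow> c \<cdot> x \<in> gen_ideal G R"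
| lmult: "a \<in> fa_set G \<Longrightarrow> x \<in> gen_ideal G R \<Longrightarrow> a \<star> x \<in> gen_ideal G R"
| rmult: "a \<in> fa_set G \<Longrightarrow> x \<in> gen_ideal G R \<Longrightarrow> x \<star> a \<in> gen_ideal G R"

lemma subspace_gen_ideal: "subspace (gen_ideal G R)"
  by (simp add: subspace_def gen_ideal.zero gen_ideal.add gen_ideal.smult)

lemma lpa_J_eq: "lpa_J G = gen_ideal G (lpa_rels G)"
proof (intro equalityI subsetI)
  show "x \<in> gen_ideal G (lpa_rels G)" if "x \<in> lpa_J G" for x
    using that by induction (auto simp: fa_eqs intro: gen_ideal.intros)
  show "x \<in> lpa_J G" if "x \<in> gen_ideal G (lpa_rels G)" for x
    using that by induction (auto simp: fa_eqs[symmetric] intro: lpa_J.intros)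
qed

lemma gen_ideal_subset:
  assumes "R \<subseteq> fa_set G"
  shows "gen_ideal G R \<subseteq> fa_set G"
proof
  fix x assume "x \<in> gen_ideal G R"
  then show "x \<in> fa_set G"
  proof induction
    case (base x) then show ?case using assms by auto
  next
    case zero show ?case by (simp add: fa_set_eq)
  next
    case (add x y) then show ?case by (auto simp: fa_set_eq intro: supp_on_add)
  next
    case (smult x c) then show ?case by (auto simp: fa_set_eq intro: supp_on_smult)
  qed (auto intro: fa_set_mult)
qed

text \<open>Homogeneous generators give a graded ideal. A multiplier is split into monomials; each
  one only shifts the degree, so the induction hypothesis is used at a shifted
  \<open>n\<close>.\<close>

lemma gen_ideal_hproj:
  assumes R: "R \<subseteq> fa_set G" and hom: "\<And>x n. x \<in> R \<Longrightarrow> hproj n x \<in> gen_ideal G R"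
    and x: "x \<in> gen_ideal G R"
  shows "hproj n x \<in> gen_ideal G R"
  using x
proof (induction arbitrary: n)
  case (lmult a x)
  have x: "x \<in> supp_on (words G)" using lmult gen_ideal_subset[OF R] by (auto simp: fa_set_eq)
  from lmult(1)[unfolded fa_set_eq] show ?case
  proof (induction rule: supp_on_induct)
    case (step c w f)
    then have "\<langle>w\<rangle> \<in> fa_set G" by (simp add: fa_set_eq)
    then have "hproj n (\<langle>w\<rangle> \<star> x) \<in> gen_ideal G R"
      using lmult.IH by (subst hproj_mono_mult[OF x]) (rule gen_ideal.lmult)
    then show ?case using step by (simp add: mult_distrib restr_simps gen_ideal.add gen_ideal.smult)
  qed (simp add: mult_distrib restr_simps gen_ideal.zero)
next
  case (rmult a x)
  have x: "x \<in> supp_on (words G)" using rmult gen_ideal_subset[OF R] by (auto simp: fa_set_eq)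
  from rmult(1)[unfolded fa_set_eq] show ?case
  proof (induction rule: supp_on_induct)
    case (step c w f)
    then have "\<langle>w\<rangle> \<in> fa_set G" by (simp add: fa_set_eq)
    then have "hproj n (x \<star> \<langle>w\<rangle>) \<in> gen_ideal G R"
      using rmult.IH by (subst hproj_mult_mono[OF x]) (rule gen_ideal.rmult)
    then show ?case using step by (simp add: mult_distrib restr_simps gen_ideal.add gen_ideal.smult)
  qed (simp add: mult_distrib restr_simps gen_ideal.zero)
qed (auto simp: restr_simps hom intro: gen_ideal.intros)

text \<open>The parameter \<open>K\<close> carries no data; it fixes the coefficient field as a type
  throughout the locale.\<close>

locale lpa_graph =
  fixes G :: "('v,'e) dgraph" and K :: "'k::field itself"
  assumes wf: "wf_graph G"
begin

abbreviation "V \<equiv> verts G"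
abbreviation "E \<equiv> edges G"
abbreviation emits :: "'v \<Rightarrow> 'e set" where "emits v \<equiv> {e \<in> E. src G e = v}"
abbreviation J :: "('v,'e,'k) fa set" where "J \<equiv> lpa_J G"
abbreviation F :: "('v,'e,'k) fa set" where "F \<equiv> fa_set G"

lemma edge_verts [simp]: "e \<in> E \<Longrightarrow> src G e \<in> V" "e \<in> E \<Longrightarrow> rng G e \<in> V"
  using wf by (auto simp: wf_graph_def)

lemma gens_iff [simp]:
  "GV v \<in> gens G \<longleftrightarrow> v \<in> V" "GE e \<in> gens G \<longleftrightarrow> e \<in> E" "GG e \<in> gens G \<longleftrightarrow> e \<in> E"
  by (auto simp: gens_def)

lemma F_simps [simp]: "0 \<in> F" "\<langle>w\<rangle> \<in> F \<longleftrightarrow> w \<in> words G"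
  by (auto simp: fa_set_eq)

lemma words_iff: "w \<in> words G \<longleftrightarrow> w \<noteq> [] \<and> set w \<subseteq> gens G"
  by (simp add: words_def)

lemma subspace_F: "subspace F"
  by (simp add: fa_set_eq subspace_supp_on)

lemma CK2_eq: "fa_diff \<langle>[GV v]\<rangle> (\<lambda>w. \<Sum>e\<in>emits v. \<langle>[GE e, GG e]\<rangle> w)
   = \<langle>[GV v]\<rangle> - (\<Sum>e\<in>emits v. \<langle>[GE e, GG e]\<rangle>)"
  unfolding fa_diff_eq by (simp add: fun_eq_iff sum_fun_apply fun_apply)

lemma lpa_rels_cases:
  assumes "x \<in> lpa_rels G"
  obtains v where "v \<in> V" "x = \<langle>[GV v, GV v]\<rangle> - \<langle>[GV v]\<rangle>"
  | v u where "v \<in> V" "u \<in> V" "v \<noteq> u" "x = \<langle>[GV v, GV u]\<rangle>"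
  | e where "e \<in> E" "x = \<langle>[GV (src G e), GE e]\<rangle> - \<langle>[GE e]\<rangle>"
  | e where "e \<in> E" "x = \<langle>[GE e, GV (rng G e)]\<rangle> - \<langle>[GE e]\<rangle>"
  | e where "e \<in> E" "x = \<langle>[GV (rng G e), GG e]\<rangle> - \<langle>[GG e]\<rangle>"
  | e where "e \<in> E" "x = \<langle>[GG e, GV (src G e)]\<rangle> - \<langle>[GG e]\<rangle>"
  | e where "e \<in> E" "x = \<langle>[GG e, GE e]\<rangle> - \<langle>[GV (rng G e)]\<rangle>"
  | e f where "e \<in> E" "f \<in> E" "e \<noteq> f" "x = \<langle>[GG e, GE f]\<rangle>"
  | v where "v \<in> V" "emits v \<noteq> {}" "finite (emits v)"
      "x = \<langle>[GV v]\<rangle> - (\<Sum>e\<in>emits v. \<langle>[GE e, GG e]\<rangle>)"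
  using assms unfolding lpa_rels_def CK2_eq unfolding fa_eqs
  by (elim UnE CollectE exE conjE) (auto split: if_splits)

lemma lpa_rels_subset: "lpa_rels G \<subseteq> F"
proof
  fix x :: "('v,'e,'k) fa" assume "x \<in> lpa_rels G"
  then show "x \<in> F"
    by (cases rule: lpa_rels_cases)
      (auto simp: words_iff intro!: subspaceD(4)[OF subspace_F] subspace_sum[OF subspace_F])
qed

text \<open>Every defining relation is homogeneous, of degree 0, 1 or -1, so a projection keeps it
  or kills it.\<close>

lemma hproj_lpa_rels:
  fixes x :: "('v,'e,'k) fa"
  assumes x: "x \<in> lpa_rels G"
  shows "hproj n x \<in> {0, x}"
proof -
  have "x \<in> supp_on {w. word_deg w = 0} \<or> x \<in> supp_on {w. word_deg w = 1} \<or> x \<in> supp_on {w. word_deg w = - 1}"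
    using x by (cases rule: lpa_rels_cases)
      (auto simp: subspaceD(4)[OF subspace_supp_on] subspace_sum[OF subspace_supp_on])
  then obtain d where d: "x \<in> supp_on {w. word_deg w = d}" by blast
  show ?thesis
  proof (cases "d = n")
    case False
    then have "{w. word_deg w = d} \<inter> {w. word_deg w = n} = {}" by auto
    then show ?thesis using restr_null[OF d] by blast
  qed (use restr_id[OF d] in blast)
qed

section \<open>Ideals of the free algebra that contain the relations\<close>

definition is_ideal :: "('v,'e,'k) fa set \<Rightarrow> bool" where
  "is_ideal P \<longleftrightarrow> J \<subseteq> P \<and> P \<subseteq> F \<and> subspace P \<and> (\<forall>a\<in>F. \<forall>x\<in>P. a \<star> x \<in> P \<and> x \<star> a \<in> P)"

definition is_gideal :: "('v,'e,'k) fa set \<Rightarrow> bool" where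
  "is_gideal P \<longleftrightarrow> is_ideal P \<and> (\<forall>x\<in>P. \<forall>n. hproj n x \<in> P)"

lemma is_idealD:
  assumes "is_ideal P"
  shows "J \<subseteq> P" "P \<subseteq> F" "subspace P" "a \<in> F \<Longrightarrow> x \<in> P \<Longrightarrow> a \<star> x \<in> P"
    "a \<in> F \<Longrightarrow> x \<in> P \<Longrightarrow> x \<star> a \<in> P"
  using assms by (auto simp: is_ideal_def)

text \<open>The empty word is not in \<open>F\<close> but acts as an identity. Admitting it allows
  contexts with one empty side.\<close>

lemma ideal_mono_mult:
  assumes P: "is_ideal P" and x: "x \<in> P" and u: "set u \<subseteq> gens G"
  shows "\<langle>u\<rangle> \<star> x \<in> P" "x \<star> \<langle>u\<rangle> \<in> P"
proof -
  have "x \<in> supp_on (words G)" using is_idealD(2)[OF P] x by (auto simp: fa_set_eq)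
  then show "\<langle>u\<rangle> \<star> x \<in> P" "x \<star> \<langle>u\<rangle> \<in> P"
    using x u is_idealD(4,5)[OF P, of "\<langle>u\<rangle>" x]
    by (cases "u = []"; simp add: mult_mono_Nil words_iff)+
qed

lemma is_gideal_gen_ideal:
  assumes R: "R \<subseteq> F" "\<And>x n. x \<in> R \<Longrightarrow> hproj n x \<in> {0, x}"
  shows "is_gideal (gen_ideal G (lpa_rels G \<union> R))"
proof -
  let ?R = "lpa_rels G \<union> R" and ?P = "gen_ideal G (lpa_rels G \<union> R)"
  have sub: "?R \<subseteq> F" using R lpa_rels_subset by auto
  have "J \<subseteq> ?P"
  proof
    fix x assume "x \<in> J" then show "x \<in> ?P" unfolding lpa_J_eq
      by induction (auto intro: gen_ideal.intros)
  qed
  moreover have "hproj n x \<in> ?P" if "x \<in> ?P" for n x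
  proof (rule gen_ideal_hproj[OF sub _ that])
    fix x n assume "x \<in> ?R"
    then have "hproj n x \<in> {0, x}" using R(2) hproj_lpa_rels by blast
    then show "hproj n x \<in> ?P" using \<open>x \<in> ?R\<close> by (auto intro: gen_ideal.intros)
  qed
  ultimately show ?thesis
    using gen_ideal_subset[OF sub]
    by (auto simp: is_gideal_def is_ideal_def subspace_gen_ideal intro: gen_ideal.intros)
qed

lemma is_gideal_J: "is_gideal J"
  using is_gideal_gen_ideal[of "{}"] by (simp add: lpa_J_eq)

lemma is_ideal_J: "is_ideal J"
  using is_gideal_J by (simp add: is_gideal_def)

lemmas subspace_J = is_idealD(3)[OF is_ideal_J]
lemmas J_F = is_idealD(2)[OF is_ideal_J]
lemmas J_mono_mult = ideal_mono_mult[OF is_ideal_J]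

text \<open>Most products of words reduce to a single word or to zero. This relation and
  \<open>wnull\<close> keep such computations on words instead of linear combinations.\<close>

definition wcong :: "('v,'e) gen list \<Rightarrow> ('v,'e) gen list \<Rightarrow> bool" where
  "wcong u v \<longleftrightarrow> \<langle>u\<rangle> - \<langle>v\<rangle> \<in> J"

definition wnull :: "('v,'e) gen list \<Rightarrow> bool" where
  "wnull u \<longleftrightarrow> \<langle>u\<rangle> \<in> J"

lemma wcong_refl [simp]: "wcong u u"
  by (simp add: wcong_def subspaceD(1)[OF subspace_J])

lemma wcong_trans [trans]: "wcong u v \<Longrightarrow> wcong v w \<Longrightarrow> wcong u w"
  unfolding wcong_def by (rule subspace_diff_trans[OF subspace_J])

lemma wcong_sym: "wcong u v \<Longrightarrow> wcong v u"
  unfolding wcong_def by (rule subspace_diff_sym[OF subspace_J])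

lemma wcong_wnull: "wcong u v \<Longrightarrow> wnull u \<longleftrightarrow> wnull v"
  unfolding wcong_def wnull_def by (rule subspace_mem_cong[OF subspace_J])

lemma wcong_ctxt: "wcong u v \<Longrightarrow> set a \<subseteq> gens G \<Longrightarrow> set b \<subseteq> gens G \<Longrightarrow> wcong (a @ u @ b) (a @ v @ b)"
  using J_mono_mult(1)[OF J_mono_mult(2)[of "\<langle>u\<rangle> - \<langle>v\<rangle>" b], of a]
  by (simp add: wcong_def mult_distrib mono_mult_mono)

lemma wnull_ctxt: "wnull u \<Longrightarrow> set a \<subseteq> gens G \<Longrightarrow> set b \<subseteq> gens G \<Longrightarrow> wnull (a @ u @ b)"
  using J_mono_mult(1)[OF J_mono_mult(2)[of "\<langle>u\<rangle>" b], of a]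
  by (simp add: wnull_def mult_distrib mono_mult_mono)

lemmas wcong_pre = wcong_ctxt[where b="[]", simplified]
lemmas wcong_post = wcong_ctxt[where a="[]", simplified]
lemmas wnull_pre = wnull_ctxt[where b="[]", simplified]
lemmas wnull_post = wnull_ctxt[where a="[]", simplified]

lemma J_rel: "x \<in> lpa_rels G \<Longrightarrow> x \<in> J"
  by (rule lpa_J.base)

lemma rel_VV: "v \<in> V \<Longrightarrow> wcong [GV v, GV v] [GV v]"
  unfolding wcong_def fa_diff_eq[symmetric] by (rule J_rel) (unfold lpa_rels_def, blast)
lemma rel_VV0: "v \<in> V \<Longrightarrow> u \<in> V \<Longrightarrow> v \<noteq> u \<Longrightarrow> wnull [GV v, GV u]"
  unfolding wnull_def by (rule J_rel) (unfold lpa_rels_def, blast)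
lemma rel_VE: "e \<in> E \<Longrightarrow> wcong [GV (src G e), GE e] [GE e]"
  unfolding wcong_def fa_diff_eq[symmetric] by (rule J_rel) (unfold lpa_rels_def, blast)
lemma rel_EV: "e \<in> E \<Longrightarrow> wcong [GE e, GV (rng G e)] [GE e]"
  unfolding wcong_def fa_diff_eq[symmetric] by (rule J_rel) (unfold lpa_rels_def, blast)
lemma rel_VG: "e \<in> E \<Longrightarrow> wcong [GV (rng G e), GG e] [GG e]"
  unfolding wcong_def fa_diff_eq[symmetric] by (rule J_rel) (unfold lpa_rels_def, blast)
lemma rel_GV: "e \<in> E \<Longrightarrow> wcong [GG e, GV (src G e)] [GG e]"
  unfolding wcong_def fa_diff_eq[symmetric] by (rule J_rel) (unfold lpa_rels_def, blast)
lemma rel_GE_if: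
  assumes "e \<in> E" "f \<in> E"
  shows "\<langle>[GG e, GE f]\<rangle> - (if e = f then \<langle>[GV (rng G e)]\<rangle> else 0) \<in> J"
  unfolding fa_eqs[symmetric] by (rule J_rel) (use assms in \<open>unfold lpa_rels_def, blast\<close>)
lemma rel_GE: "e \<in> E \<Longrightarrow> wcong [GG e, GE e] [GV (rng G e)]"
  using rel_GE_if[of e e] by (simp add: wcong_def)
lemma rel_GE0: "e \<in> E \<Longrightarrow> f \<in> E \<Longrightarrow> e \<noteq> f \<Longrightarrow> wnull [GG e, GE f]"
  using rel_GE_if[of e f] by (simp add: wnull_def)
lemma rel_CK2: "v \<in> V \<Longrightarrow> emits v \<noteq> {} \<Longrightarrow> finite (emits v) \<Longrightarrow>
    \<langle>[GV v]\<rangle> - (\<Sum>e\<in>emits v. \<langle>[GE e, GG e]\<rangle>) \<in> J"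
  unfolding CK2_eq[symmetric] by (rule J_rel) (unfold lpa_rels_def, blast)

text \<open>Inserting the source of \<open>e\<close> in front of it puts two distinct vertices next
  to each other. The three lemmas that follow work in the same way.\<close>

lemma null_VE: "e \<in> E \<Longrightarrow> v \<in> V \<Longrightarrow> v \<noteq> src G e \<Longrightarrow> wnull [GV v, GE e]"
  using wcong_wnull[OF wcong_pre[OF rel_VE, of e "[GV v]"]]
    wnull_post[OF rel_VV0[of v "src G e"], of "[GE e]"] by simp
lemma null_EV: "e \<in> E \<Longrightarrow> v \<in> V \<Longrightarrow> v \<noteq> rng G e \<Longrightarrow> wnull [GE e, GV v]"
  using wcong_wnull[OF wcong_post[OF rel_EV, of e "[GV v]"]]
    wnull_pre[OF rel_VV0[of "rng G e" v], of "[GE e]"] by simp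
lemma null_VG: "e \<in> E \<Longrightarrow> v \<in> V \<Longrightarrow> v \<noteq> rng G e \<Longrightarrow> wnull [GV v, GG e]"
  using wcong_wnull[OF wcong_pre[OF rel_VG, of e "[GV v]"]]
    wnull_post[OF rel_VV0[of v "rng G e"], of "[GG e]"] by simp
lemma null_GV: "e \<in> E \<Longrightarrow> v \<in> V \<Longrightarrow> v \<noteq> src G e \<Longrightarrow> wnull [GG e, GV v]"
  using wcong_wnull[OF wcong_post[OF rel_GV, of e "[GV v]"]]
    wnull_pre[OF rel_VV0[of "src G e" v], of "[GG e]"] by simp

section \<open>Paths\<close>

lemma is_path_Nil [simp]: "is_path G v [] \<longleftrightarrow> v \<in> V"
  by (simp add: is_path_def)

lemma is_path_Cons [simp]: "is_path G v (e # es) \<longleftrightarrow> e \<in> E \<and> src G e = v \<and> is_path G (rng G e) es"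
proof (cases es)
  case (Cons f fs)
  then show ?thesis by (auto simp: is_path_def All_less_Suc2)
qed (auto simp: is_path_def)

lemma path_end_simps [simp]:
  "path_end G v [] = v" "path_end G v (e # es) = path_end G (rng G e) es"
  "path_end G v (p @ q) = path_end G (path_end G v p) q"
  by (auto simp: path_end_def)

lemma is_path_append [simp]:
  "is_path G v (p @ q) \<longleftrightarrow> is_path G v p \<and> is_path G (path_end G v p) q"
  by (induction p arbitrary: v) (auto, auto simp: is_path_def)

lemma is_path_verts: "is_path G v p \<Longrightarrow> v \<in> V" "is_path G v p \<Longrightarrow> path_end G v p \<in> V"
  by (induction p arbitrary: v) auto

lemma is_path_edges: "is_path G v p \<Longrightarrow> set p \<subseteq> E"
  by (simp add: is_path_def)

end

section \<open>Normal forms of words\<close>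

context lpa_graph
begin

declare is_path_verts(2) [simp]

text \<open>The final vertex gives paths of length 0 a nonempty word and makes the encoding
  injective in \<open>u\<close> and \<open>q\<close>.\<close>

definition ghost_path :: "'v \<Rightarrow> 'e list \<Rightarrow> ('v,'e) gen list" where
  "ghost_path u q = rev (map GG q) @ [GV u]"

text \<open>Encodes p q^* with both start vertices written out, so that empty \<open>p\<close> or
  \<open>q\<close> need no separate form.\<close>

definition basis_word :: "'v \<Rightarrow> 'e list \<Rightarrow> 'v \<Rightarrow> 'e list \<Rightarrow> ('v,'e) gen list" where
  "basis_word v p u q = GV v # map GE p @ ghost_path u q"

abbreviation path_pair :: "'v \<Rightarrow> 'e list \<Rightarrow> 'v \<Rightarrow> 'e list \<Rightarrow> bool" where
  "path_pair v p u q \<equiv> is_path G v p \<and> is_path G u q \<and> path_end G v p = path_end G u q"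

text \<open>The bound \<open>n\<close> on the real part is the quantity on which
  \<open>ghost_reduction_start\<close> inducts.\<close>

definition basis_words :: "nat \<Rightarrow> 'v \<Rightarrow> ('v,'e) gen list set" where
  "basis_words n v = {basis_word v p u q | p u q. path_pair v p u q \<and> length p \<le> n}"

definition ghost_words :: "'v \<Rightarrow> ('v,'e) gen list set" where
  "ghost_words w = {ghost_path u q | u q. is_path G u q \<and> path_end G u q = w}"

lemma ghost_path_inject [simp]: "ghost_path u q = ghost_path u' q' \<longleftrightarrow> u = u' \<and> q = q'"
proof -
  have "inj (GG :: 'e \<Rightarrow> ('v,'e) gen)" by (simp add: inj_def)
  then show ?thesis by (auto simp: ghost_path_def inj_map_eq_map)
qed

lemma set_ghost_path [simp]: "is_path G u q \<Longrightarrow> set (ghost_path u q) \<subseteq> gens G"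
  using is_path_edges[of u q] is_path_verts[of u q] by (auto simp: ghost_path_def)

lemma set_map_GE [simp]: "is_path G u q \<Longrightarrow> set (map GE q) \<subseteq> gens G"
  "is_path G u q \<Longrightarrow> set (rev (map GG q)) \<subseteq> gens G"
  using is_path_edges[of u q] by auto

lemma set_basis_word [simp]: "path_pair v p u q \<Longrightarrow> set (basis_word v p u q) \<subseteq> gens G"
  using set_map_GE(1)[of v p] is_path_verts[of v p] by (simp add: basis_word_def)

lemma ghost_path_ne [simp]: "ghost_path u q \<noteq> []" "basis_word v p u q \<noteq> []"
  by (auto simp: ghost_path_def basis_word_def)

lemma GG_ghost_path: "GG e # ghost_path u q = ghost_path u (q @ [e])"
  by (simp add: ghost_path_def)

lemma rev_GG_ghost_path: "rev (map GG p) @ ghost_path u q = ghost_path u (q @ p)"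
  by (simp add: ghost_path_def)

lemma word_deg_ghost_path [simp]: "word_deg (ghost_path u q) = - int (length q)"
  by (simp add: ghost_path_def)

lemma ghost_path_start: "is_path G u q \<Longrightarrow> wcong (GV (path_end G u q) # ghost_path u q) (ghost_path u q)"
proof (cases q rule: rev_cases)
  case Nil
  assume "is_path G u q"
  then show ?thesis using Nil rel_VV[of u] by (simp add: ghost_path_def)
next
  case (snoc p e)
  assume "is_path G u q"
  then show ?thesis using snoc wcong_post[OF rel_VG[of e], of "ghost_path u p"]
    by (auto simp: GG_ghost_path[symmetric])
qed

lemma basis_word_start: "path_pair v p u q \<Longrightarrow> wcong (GV v # basis_word v p u q) (basis_word v p u q)"
  using wcong_post[OF rel_VV[of v], of "map GE p @ ghost_path u q"] set_basis_word[of v p u q]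
    is_path_verts[of v p] by (simp add: basis_word_def)

lemma basis_word_start_null:
  "path_pair v p u q \<Longrightarrow> v' \<in> V \<Longrightarrow> v' \<noteq> v \<Longrightarrow> wnull (GV v' # basis_word v p u q)"
  using wnull_post[OF rel_VV0[of v' v], of "map GE p @ ghost_path u q"] set_basis_word[of v p u q]
    is_path_verts[of v p] by (simp add: basis_word_def)

lemma basis_word_Nil: "path_pair v [] u q \<Longrightarrow> wcong (basis_word v [] u q) (ghost_path u q)"
  using ghost_path_start[of u q] by (simp add: basis_word_def)

lemma GE_basis_word:
  assumes "path_pair (rng G e) p u q" "e \<in> E"
  shows "wcong (GE e # basis_word (rng G e) p u q) (basis_word (src G e) (e # p) u q)"
proof -
  have s: "set (map GE p @ ghost_path u q) \<subseteq> gens G"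
    using set_basis_word[of "rng G e" p u q] assms by (simp add: basis_word_def)
  have "wcong (GE e # basis_word (rng G e) p u q) (GE e # map GE p @ ghost_path u q)"
    using wcong_post[OF rel_EV[OF assms(2)] s] by (simp add: basis_word_def)
  also have "wcong \<dots> (GV (src G e) # GE e # map GE p @ ghost_path u q)"
    using wcong_sym[OF wcong_post[OF rel_VE[OF assms(2)] s]] by simp
  finally show ?thesis by (simp add: basis_word_def)
qed

lemma GG_basis_word_Nil:
  assumes "path_pair (src G e) [] u q" "e \<in> E"
  shows "wcong (GG e # basis_word (src G e) [] u q) (basis_word (rng G e) [] u (q @ [e]))"
proof -
  have s: "set (ghost_path u q) \<subseteq> gens G" using assms by simp
  have "wcong (GG e # basis_word (src G e) [] u q) (GG e # ghost_path u q)"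
    using wcong_post[OF rel_GV[OF assms(2)] s] by (simp add: basis_word_def)
  also have "wcong \<dots> (GV (rng G e) # GG e # ghost_path u q)"
    using wcong_sym[OF wcong_post[OF rel_VG[OF assms(2)] s]] by simp
  finally show ?thesis by (simp add: basis_word_def GG_ghost_path)
qed

lemma GG_basis_word_Cons:
  assumes "path_pair (src G f) (f # p) u q" "e \<in> E"
  shows "if e = f then wcong (GG e # basis_word (src G f) (f # p) u q) (basis_word (rng G e) p u q)
    else wnull (GG e # basis_word (src G f) (f # p) u q)"
proof -
  have s: "set (map GE p @ ghost_path u q) \<subseteq> gens G" and f: "f \<in> E"
    using set_basis_word[of "src G f" "f # p" u q] assms by (auto simp: basis_word_def)
  have 1: "wcong (GG e # basis_word (src G f) (f # p) u q) (GG e # GE f # map GE p @ ghost_path u q)"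
    using wcong_ctxt[OF rel_VE[OF f] _ s, of "[GG e]"] assms(2) by (simp add: basis_word_def)
  show ?thesis
  proof (cases "e = f")
    case True
    have "wcong (GG e # GE f # map GE p @ ghost_path u q) (basis_word (rng G e) p u q)"
      using wcong_post[OF rel_GE[OF f] s] True by (simp add: basis_word_def)
    with 1 True show ?thesis using wcong_trans by auto
  next
    case False
    have "wnull (GG e # GE f # map GE p @ ghost_path u q)"
      using wnull_post[OF rel_GE0[OF assms(2) f False] s] by simp
    with 1 False show ?thesis using wcong_wnull by auto
  qed
qed

lemma GG_basis_word_null:
  assumes "path_pair v p u q" "e \<in> E" "v \<noteq> src G e"
  shows "wnull (GG e # basis_word v p u q)"
  using wnull_post[OF null_GV[of e v], of "map GE p @ ghost_path u q"] set_basis_word[of v p u q]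
    is_path_verts[of v p] assms by (simp add: basis_word_def)

lemma GE_basis_word_null:
  assumes "path_pair v p u q" "e \<in> E" "v \<noteq> rng G e"
  shows "wnull (GE e # basis_word v p u q)"
  using wnull_post[OF null_EV[of e v], of "map GE p @ ghost_path u q"] set_basis_word[of v p u q]
    is_path_verts[of v p] assms by (simp add: basis_word_def)

text \<open>A ghost edge cancels the first real edge or kills the word. If there is no real edge it
  is absorbed into the ghost part and the real part stays empty. In each case the bound
  drops.\<close>

lemma GG_basis_words:
  assumes w: "w \<in> basis_words (Suc n) (src G e)" and e: "e \<in> E"
  shows "wnull (GG e # w) \<or> (\<exists>w'\<in>basis_words n (rng G e). wcong (GG e # w) w')"
proof -
  obtain p u q where pq: "w = basis_word (src G e) p u q" "path_pair (src G e) p u q" "length p \<le> Suc n"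
    using w by (auto simp: basis_words_def)
  show ?thesis
  proof (cases p)
    case Nil
    have "wcong (GG e # w) (basis_word (rng G e) [] u (q @ [e]))"
      using pq e Nil GG_basis_word_Nil[of e u q] by simp
    moreover have "basis_word (rng G e) [] u (q @ [e]) \<in> basis_words n (rng G e)"
      unfolding basis_words_def using pq e Nil
      by (intro CollectI exI[of _ "[]"] exI[of _ u] exI[of _ "q @ [e]"]) auto
    ultimately show ?thesis by blast
  next
    case (Cons f p')
    have f: "src G f = src G e" and 1: "path_pair (src G f) (f # p') u q" using pq Cons by auto
    note 2 = GG_basis_word_Cons[OF 1 e]
    show ?thesis
    proof (cases "e = f")
      case True
      have "basis_word (rng G e) p' u q \<in> basis_words n (rng G e)"
        unfolding basis_words_def using pq Cons True by auto
      then show ?thesis using 2 True pq Cons by auto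
    next
      case False
      then show ?thesis using 2 pq Cons f by simp
    qed
  qed
qed

text \<open>Letters are multiplied onto a basis word from the left, one at a time. The degree is
  tracked because the homogeneous components are spanned by the words of fixed degree.\<close>

lemma word_normal_form:
  assumes "w \<in> words G"
  shows "wnull w \<or> (\<exists>v p u q. path_pair v p u q \<and> int (length p) - int (length q) = word_deg w \<and>
    wcong w (basis_word v p u q))"
  using assms
proof (induction w)
  case (Cons g w)
  have g: "g \<in> gens G" using Cons(2) by (simp add: words_iff)
  have I: "wnull w \<or> (\<exists>v p u q. path_pair v p u q \<and> int (length p) - int (length q) = word_deg w \<and>
      wcong w (basis_word v p u q))"
    if "wcong w (basis_word v p u q)" "path_pair v p u q" "int (length p) - int (length q) = word_deg w"
    for w v p u q using that by blast
  show ?case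
  proof (cases "w = []")
    case w: True
    show ?thesis
    proof (cases g)
      case (GV v)
      then have "v \<in> V" using g by simp
      then show ?thesis using wcong_sym[OF rel_VV[of v]]
        by (intro I[of _ v "[]" v "[]"]) (simp_all add: w GV basis_word_def ghost_path_def)
    next
      case (GE e)
      then have e: "e \<in> E" using g by simp
      have "wcong [GE e] [GV (src G e), GE e]" by (rule wcong_sym[OF rel_VE[OF e]])
      also have "wcong \<dots> [GV (src G e), GE e, GV (rng G e)]"
        using wcong_pre[OF wcong_sym[OF rel_EV[OF e]], of "[GV (src G e)]"] e by simp
      finally show ?thesis using e
        by (intro I[of _ "src G e" "[e]" "rng G e" "[]"]) (simp_all add: w GE basis_word_def ghost_path_def)
    next
      case (GG e)
      then have e: "e \<in> E" using g by simp
      have "wcong [GG e] [GV (rng G e), GG e]" by (rule wcong_sym[OF rel_VG[OF e]])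
      also have "wcong \<dots> [GV (rng G e), GG e, GV (src G e)]"
        using wcong_pre[OF wcong_sym[OF rel_GV[OF e]], of "[GV (rng G e)]"] e by simp
      finally show ?thesis using e
        by (intro I[of _ "rng G e" "[]" "src G e" "[e]"]) (simp_all add: w GG basis_word_def ghost_path_def)
    qed
  next
    case False
    then have w: "w \<in> words G" using Cons(2) by (simp add: words_iff)
    from Cons(1)[OF w] show ?thesis
    proof (elim disjE exE)
      assume "wnull w"
      then show ?thesis using wnull_pre[of w "[g]"] g by simp
    next
      fix v p u q
      let ?b = "basis_word v p u q"
      assume "path_pair v p u q \<and> int (length p) - int (length q) = word_deg w \<and> wcong w ?b"
      then have pq: "path_pair v p u q"
        and d: "int (length p) - int (length q) = word_deg w" and b: "wcong w ?b" by auto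
      have gw: "wcong (g # w) (g # ?b)" using wcong_pre[OF b, of "[g]"] g by simp
      have null: ?thesis if "wnull (g # ?b)"
        using that wcong_wnull[OF gw] by blast
      note cong = I[OF wcong_trans[OF gw]]
      show ?thesis
      proof (cases g)
        case (GV v')
        show ?thesis
        proof (cases "v' = v")
          case True
          show ?thesis
            by (rule cong[of v p u q]) (use True GV basis_word_start[OF pq] pq d in simp_all)
        next
          case False
          show ?thesis
            by (rule null) (use False GV basis_word_start_null[OF pq] g in simp)
        qed
      next
        case (GE e)
        then have e: "e \<in> E" using g by simp
        show ?thesis
        proof (cases "v = rng G e")
          case True
          show ?thesis
            by (rule cong[of "src G e" "e # p" u q])
              (use True GE GE_basis_word[of e p u q] pq d e in simp_all)
        next
          case False
          show ?thesis
            by (rule null) (use False GE GE_basis_word_null[OF pq] e in simp)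
        qed
      next
        case (GG e)
        then have e: "e \<in> E" using g by simp
        show ?thesis
        proof (cases "v = src G e")
          case False
          show ?thesis
            by (rule null) (use False GG GG_basis_word_null[OF pq] e in simp)
        next
          case v: True
          show ?thesis
          proof (cases p)
            case Nil
            show ?thesis
              by (rule cong[of "rng G e" "[]" u "q @ [e]"])
                (use GG v Nil GG_basis_word_Nil[of e u q] pq d e in simp_all)
          next
            case (Cons f p')
            have f: "v = src G f" and 1: "path_pair (src G f) (f # p') u q" using pq Cons by auto
            note 2 = GG_basis_word_Cons[OF 1 e]
            show ?thesis
            proof (cases "e = f")
              case True
              show ?thesis
                by (rule cong[of "rng G e" p' u q]) (use 2 1 True Cons GG f d in simp_all)
            next
              case False
              show ?thesis
                by (rule null) (use 2 False Cons GG f in simp)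
            qed
          qed
        qed
      qed
    qed
  qed
qed (simp add: words_iff)

text \<open>The product collapses from the middle: the inner pair e^* e becomes the range of
  \<open>e\<close>, which restarts the same situation with a shorter path.\<close>

lemma ghost_cancel:
  assumes "is_path G v p"
  shows "wcong (ghost_path v p @ GV v # map GE p) [GV (path_end G v p)]"
  using assms
proof (induction p arbitrary: v)
  case Nil
  then show ?case using rel_VV[of v] by (simp add: ghost_path_def)
next
  case (Cons e p)
  then have e: "e \<in> E" "src G e = v" and p: "is_path G (rng G e) p" by auto
  let ?a = "rev (map GG p) :: ('v,'e) gen list" and ?b = "map GE p :: ('v,'e) gen list"
  have s: "set ?a \<subseteq> gens G" "set ?b \<subseteq> gens G" using p is_path_edges[OF p] by auto
  have "wcong (ghost_path v (e # p) @ GV v # map GE (e # p)) (?a @ GG e # GV v # GE e # ?b)"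
    using wcong_ctxt[OF rel_VV[of v], of "?a @ [GG e]" "GE e # ?b"] s e
    by (auto simp: ghost_path_def)
  also have "wcong \<dots> (?a @ GG e # GE e # ?b)"
    using wcong_ctxt[OF rel_VE[of e], of "?a @ [GG e]" "?b"] s e by auto
  also have "wcong \<dots> (?a @ GV (rng G e) # ?b)"
    using wcong_ctxt[OF rel_GE[of e], of "?a" "?b"] s e by auto
  also have "wcong \<dots> (ghost_path (rng G e) p @ GV (rng G e) # map GE p)"
    using wcong_sym[OF wcong_ctxt[OF rel_VV[of "rng G e"], of "?a" "?b"]] s e
    by (auto simp: ghost_path_def)
  also have "wcong \<dots> [GV (path_end G (rng G e) p)]" by (rule Cons.IH[OF p])
  finally show ?case by simp
qed

text \<open>Of two distinct paths of equal length neither extends the other, so the collapse from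
  the middle meets two different vertices or two different edges.\<close>

lemma ghost_cancel_null:
  assumes "is_path G v p" "is_path G u q" "length p = length q" "(u, q) \<noteq> (v, p)"
  shows "wnull (ghost_path u q @ GV v # map GE p)"
  using assms
proof (induction p arbitrary: v u q)
  case Nil
  then show ?case using rel_VV0[of u v] by (simp add: ghost_path_def)
next
  case (Cons e p)
  then obtain f q' where q: "q = f # q'" by (cases q) auto
  have e: "e \<in> E" "src G e = v" and p: "is_path G (rng G e) p" using Cons by auto
  have f: "f \<in> E" "src G f = u" and q': "is_path G (rng G f) q'" using Cons q by auto
  let ?a = "rev (map GG q') :: ('v,'e) gen list" and ?b = "map GE p :: ('v,'e) gen list"
  have s: "set ?a \<subseteq> gens G" "set ?b \<subseteq> gens G" using is_path_edges[OF p] is_path_edges[OF q'] by auto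
  show ?case
  proof (cases "u = v")
    case False
    then show ?thesis using wnull_ctxt[OF rel_VV0[of u v], of "?a @ [GG f]" "GE e # ?b"] s e f q
      by (auto simp: ghost_path_def)
  next
    case True
    have "wcong (ghost_path u q @ GV v # map GE (e # p)) (?a @ GG f # GV v # GE e # ?b)"
      using wcong_ctxt[OF rel_VV[of v], of "?a @ [GG f]" "GE e # ?b"] s e f q True
      by (auto simp: ghost_path_def)
    also have "wcong \<dots> (?a @ GG f # GE e # ?b)"
      using wcong_ctxt[OF rel_VE[of e], of "?a @ [GG f]" "?b"] s e f by auto
    finally have 1: "wcong (ghost_path u q @ GV v # map GE (e # p)) (?a @ GG f # GE e # ?b)" .
    show ?thesis
    proof (cases "f = e")
      case False
      then show ?thesis using wcong_wnull[OF 1] wnull_ctxt[OF rel_GE0[of f e], of ?a ?b] e f s by auto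
    next
      case fe: True
      note 1
      also have "wcong (?a @ GG f # GE e # ?b) (?a @ GV (rng G e) # ?b)"
        using wcong_ctxt[OF rel_GE[of e], of "?a" "?b"] s e fe by auto
      also have "wcong \<dots> (ghost_path (rng G f) q' @ GV (rng G e) # map GE p)"
        using wcong_sym[OF wcong_ctxt[OF rel_VV[of "rng G e"], of "?a" "?b"]] s e fe
        by (auto simp: ghost_path_def)
      finally have 2: "wcong (ghost_path u q @ GV v # map GE (e # p)) (ghost_path (rng G f) q' @ GV (rng G e) # map GE p)" .
      have "wnull (ghost_path (rng G f) q' @ GV (rng G e) # map GE p)"
        using Cons.IH[OF p q'] Cons.prems(3,4) q True fe by auto
      then show ?thesis using wcong_wnull[OF 2] by simp
    qed
  qed
qed

end

section \<open>Linear combinations of ghost paths\<close>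

lemma supp_on_UN_mono:
  fixes A :: "nat \<Rightarrow> ('v,'e) gen list set"
  assumes f: "f \<in> supp_on (\<Union>n. A n)" and A: "\<And>m n. m \<le> n \<Longrightarrow> A m \<subseteq> A n"
  shows "\<exists>n. f \<in> supp_on (A n)"
  using f
proof (induction rule: supp_on_induct)
  case (step c w g)
  then obtain m n where "w \<in> A m" "g \<in> supp_on (A n)" by blast
  then have "\<langle>w\<rangle> \<in> supp_on (A (max m n))" "g \<in> supp_on (A (max m n))"
    using A[of m "max m n"] A[of n "max m n"] by (auto intro: supp_on_subset)
  then show ?case by (intro exI[of _ "max m n"] supp_on_add supp_on_smult)
qed simp

context lpa_graph
begin

lemma left_mult_rewrite:
  fixes f :: "('v,'e,'k) fa"
  assumes f: "f \<in> supp_on A"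
    and r: "\<And>w. w \<in> A \<Longrightarrow> wnull (u @ w) \<or> (\<exists>w'\<in>B. wcong (u @ w) w')"
  shows "\<exists>g\<in>supp_on B. \<langle>u\<rangle> \<star> f - g \<in> J"
proof (rule supp_on_rewrite[OF subspace_J f])
  fix w assume "w \<in> A"
  from r[OF this] show "\<exists>g\<in>supp_on B. \<langle>u\<rangle> \<star> \<langle>w\<rangle> - g \<in> J"
  proof (elim disjE bexE)
    assume "wnull (u @ w)"
    then show ?thesis by (intro bexI[of _ 0]) (auto simp: mono_mult_mono wnull_def)
  next
    fix w' assume "w' \<in> B" "wcong (u @ w) w'"
    then show ?thesis by (intro bexI[of _ "\<langle>w'\<rangle>"]) (auto simp: mono_mult_mono wcong_def)
  qed
qed (auto simp: mult_distrib)

lemma normal_form: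
  fixes f :: "('v,'e,'k) fa"
  assumes f: "f \<in> F"
  shows "\<exists>n. \<exists>g\<in>supp_on (\<Union>v. basis_words n v). f - g \<in> J"
proof -
  \<comment> \<open>The empty word acts as an identity, so the rewriting of left multiples with
    \<open>u = []\<close> rewrites \<open>f\<close> itself.\<close>
  have "\<exists>g\<in>supp_on (\<Union>n. \<Union>v. basis_words n v). \<langle>[]\<rangle> \<star> f - g \<in> J"
  proof (rule left_mult_rewrite)
    show "f \<in> supp_on (words G)" using f by (simp add: fa_set_eq)
    fix w assume "w \<in> words G"
    from word_normal_form[OF this]
    show "wnull ([] @ w) \<or> (\<exists>w'\<in>\<Union>n. \<Union>v. basis_words n v. wcong ([] @ w) w')"
      unfolding basis_words_def by fastforce
  qed
  then obtain g where g: "g \<in> supp_on (\<Union>n. \<Union>v. basis_words n v)" "f - g \<in> J" by auto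
  have "\<exists>n. g \<in> supp_on (\<Union>v. basis_words n v)"
    by (rule supp_on_UN_mono[OF g(1)]) (fastforce simp: basis_words_def)
  with g(2) show ?thesis by blast
qed

section \<open>Start vertices of words and local units\<close>

fun gen_start :: "('v,'e) gen \<Rightarrow> 'v" where
  "gen_start (GV v) = v" | "gen_start (GE e) = src G e" | "gen_start (GG e) = rng G e"

lemma gen_start_V: "g \<in> gens G \<Longrightarrow> gen_start g \<in> V"
  by (cases g) auto

lemma word_start:
  assumes "w \<in> words G"
  shows "wcong (GV (gen_start (hd w)) # w) w"
    and "v \<in> V \<Longrightarrow> v \<noteq> gen_start (hd w) \<Longrightarrow> wnull (GV v # w)"
proof -
  obtain g w' where w: "w = g # w'" "g \<in> gens G" "set w' \<subseteq> gens G"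
    using assms by (cases w) (auto simp: words_iff)
  have 1: "wcong [GV (gen_start g), g] [g]"
    using w(2) by (cases g) (auto simp: rel_VV rel_VE rel_VG)
  have 2: "wnull [GV v, g]" if "v \<in> V" "v \<noteq> gen_start g"
    using w(2) that by (cases g) (auto simp: rel_VV0 null_VE null_VG)
  show "wcong (GV (gen_start (hd w)) # w) w"
    using wcong_post[OF 1 w(3)] w(1) by simp
  show "wnull (GV v # w)" if "v \<in> V" "v \<noteq> gen_start (hd w)"
    using wnull_post[OF 2 w(3)] w(1) that by simp
qed

text \<open>There is no identity element if the vertices are infinite in number, but the start
  vertices of the finitely many words in \<open>f\<close> sum to a left unit for it modulo
  \<open>J\<close>.\<close>

lemma local_unit:
  fixes f :: "('v,'e,'k) fa"
  assumes f: "f \<in> F"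
  shows "\<exists>S. finite S \<and> S \<subseteq> V \<and> (\<Sum>v\<in>S. \<langle>[GV v]\<rangle>) \<star> f - f \<in> J"
proof -
  \<comment> \<open>Claimed for every finite set above \<open>S0\<close>, so that adding the start
    vertex of one more word preserves the claim for the earlier words.\<close>
  have "\<exists>S0. finite S0 \<and> S0 \<subseteq> V \<and>
      (\<forall>S. finite S \<and> S0 \<subseteq> S \<and> S \<subseteq> V \<longrightarrow> (\<Sum>v\<in>S. \<langle>[GV v]\<rangle>) \<star> f - f \<in> J)"
    using f[unfolded fa_set_eq]
  proof (induction rule: supp_on_induct)
    case zero
    show ?case using subspaceD(1)[OF subspace_J]
      by (intro exI[of _ "{}"]) (auto simp: mult_distrib)
  next
    case (step c w g)
    from step.IH obtain S0 where S0: "finite S0" "S0 \<subseteq> V"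
      "\<forall>S. finite S \<and> S0 \<subseteq> S \<and> S \<subseteq> V \<longrightarrow> (\<Sum>v\<in>S. \<langle>[GV v]\<rangle>) \<star> g - g \<in> J"
      by (elim exE conjE)
    let ?s = "gen_start (hd w)"
    have s: "?s \<in> V"
    proof (rule gen_start_V)
      show "hd w \<in> gens G" using step(1) by (cases w) (auto simp: words_iff)
    qed
    show ?case
    proof (intro exI[of _ "insert ?s S0"] conjI allI impI)
      fix S assume S: "finite S \<and> insert ?s S0 \<subseteq> S \<and> S \<subseteq> V"
      have "(\<Sum>v\<in>S. \<langle>[GV v]\<rangle>) \<star> \<langle>w\<rangle> - \<langle>w\<rangle> = (\<langle>GV ?s # w\<rangle> - \<langle>w\<rangle>) + (\<Sum>v\<in>S - {?s}. \<langle>GV v # w\<rangle>)"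
      proof -
        have "finite S" "?s \<in> S" using S by auto
        then show ?thesis by (simp add: mult_sum_left mono_mult_mono mult_distrib sum.remove[of S ?s])
      qed
      also have "\<dots> \<in> J"
      proof (intro subspaceD(2)[OF subspace_J] subspace_sum[OF subspace_J])
        show "\<langle>GV ?s # w\<rangle> - \<langle>w\<rangle> \<in> J" using word_start(1)[OF step(1)] by (simp add: wcong_def)
        show "\<langle>GV v # w\<rangle> \<in> J" if "v \<in> S - {?s}" for v
          using word_start(2)[OF step(1), of v] S that by (auto simp: wnull_def)
      qed
      finally have 1: "(\<Sum>v\<in>S. \<langle>[GV v]\<rangle>) \<star> \<langle>w\<rangle> - \<langle>w\<rangle> \<in> J" .
      have 2: "(\<Sum>v\<in>S. \<langle>[GV v]\<rangle>) \<star> g - g \<in> J" using S0(3) S by auto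
      have "(\<Sum>v\<in>S. \<langle>[GV v]\<rangle>) \<star> (c \<cdot> \<langle>w\<rangle> + g) - (c \<cdot> \<langle>w\<rangle> + g) =
         c \<cdot> ((\<Sum>v\<in>S. \<langle>[GV v]\<rangle>) \<star> \<langle>w\<rangle> - \<langle>w\<rangle>) + ((\<Sum>v\<in>S. \<langle>[GV v]\<rangle>) \<star> g - g)"
        unfolding mult_distrib smult_simps by simp
      also have "\<dots> \<in> J" by (intro subspaceD(2,3)[OF subspace_J] 1 2)
      finally show "(\<Sum>v\<in>S. \<langle>[GV v]\<rangle>) \<star> (c \<cdot> \<langle>w\<rangle> + g) - (c \<cdot> \<langle>w\<rangle> + g) \<in> J" .
    qed (use S0 s in auto)
  qed
  then show ?thesis by blast
qed

lemma ideal_cong: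
  assumes P: "is_ideal P" and "x - y \<in> J"
  shows "x \<in> P \<longleftrightarrow> y \<in> P"
  using subspace_mem_cong[OF is_idealD(3)[OF P]] is_idealD(1)[OF P] assms(2) by blast

lemma ideal_memI_vertices:
  assumes P: "is_ideal P" and f: "f \<in> F" and v: "\<And>v. v \<in> V \<Longrightarrow> \<langle>[GV v]\<rangle> \<star> f \<in> P"
  shows "f \<in> P"
proof -
  obtain S where S: "S \<subseteq> V" "(\<Sum>v\<in>S. \<langle>[GV v]\<rangle>) \<star> f - f \<in> J" using local_unit[OF f] by blast
  have "(\<Sum>v\<in>S. \<langle>[GV v]\<rangle>) \<star> f \<in> P"
    using S(1) v unfolding mult_sum_left by (intro subspace_sum[OF is_idealD(3)[OF P]]) auto
  then show ?thesis using ideal_cong[OF P S(2)] by simp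
qed

text \<open>After projection to one degree, multiplying on the right by the real path of one of the
  terms isolates its coefficient.\<close>

lemma ghost_comb_in_ideal:
  assumes P: "is_gideal P" and f: "f \<in> P" "f \<in> supp_on (ghost_words w)" "f \<noteq> 0"
  shows "\<langle>[GV w]\<rangle> \<in> P"
proof -
  have Pi: "is_ideal P" using P by (simp add: is_gideal_def)
  obtain x where x: "f x \<noteq> 0" using f(3) by (auto simp: fun_eq_iff fun_apply)
  then have "x \<in> ghost_words w" using f(2) by (auto simp: supp_on_def)
  then obtain u q where q: "x = ghost_path u q" "is_path G u q" "path_end G u q = w"
    by (auto simp: ghost_words_def)
  \<comment> \<open>In the degree of \<open>x\<close> every ghost path has the same length as
    \<open>q\<close>, which is what \<open>ghost_cancel_null\<close> requires.\<close>
  define n where "n = - int (length q)"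
  define A where "A = ghost_words w \<inter> {w. word_deg w = n}"
  define h where "h = hproj n f"
  have h: "h \<in> P" "h \<in> supp_on A" "h x = f x"
    using P f restr_supp_on[OF f(2), of "{w. word_deg w = n}"] q(1)
    by (auto simp: is_gideal_def h_def A_def restr_def n_def)
  let ?w = "GV u # map GE q"
  have "h \<star> \<langle>?w\<rangle> - h x \<cdot> \<langle>[GV w]\<rangle> \<in> J"
  proof (rule supp_on_linear_mem[OF subspace_J h(2), where T="\<lambda>h. h \<star> \<langle>?w\<rangle> - h x \<cdot> \<langle>[GV w]\<rangle>"])
    fix y assume "y \<in> A"
    then obtain u' q' where y: "y = ghost_path u' q'" "is_path G u' q'" "length q' = length q"
      by (auto simp: A_def ghost_words_def n_def)
    show "\<langle>y\<rangle> \<star> \<langle>?w\<rangle> - \<langle>y\<rangle> x \<cdot> \<langle>[GV w]\<rangle> \<in> J"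
    proof (cases "y = x")
      case True
      then have "\<langle>y\<rangle> x = (1 :: 'k)" by (simp add: fa_mono_def)
      then show ?thesis using ghost_cancel[OF q(2)] q True
        by (simp add: mono_mult_mono wcong_def smult_simps)
    next
      case False
      then have "\<langle>y\<rangle> x = (0 :: 'k)" by (simp add: fa_mono_def)
      then show ?thesis using ghost_cancel_null[OF q(2) y(2)] q y False
        by (auto simp: mono_mult_mono wnull_def smult_simps)
    qed
  next
    fix f g show "(f + g) \<star> \<langle>?w\<rangle> - (f + g) x \<cdot> \<langle>[GV w]\<rangle>
      = f \<star> \<langle>?w\<rangle> - f x \<cdot> \<langle>[GV w]\<rangle> + (g \<star> \<langle>?w\<rangle> - g x \<cdot> \<langle>[GV w]\<rangle>)"
      by (simp add: mult_distrib smult_simps fun_apply)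
  next
    fix c f show "(c \<cdot> f) \<star> \<langle>?w\<rangle> - (c \<cdot> f) x \<cdot> \<langle>[GV w]\<rangle> = c \<cdot> (f \<star> \<langle>?w\<rangle> - f x \<cdot> \<langle>[GV w]\<rangle>)"
      unfolding mult_distrib smult_simps by (simp add: fa_smult_def)
  qed
  moreover have "h \<star> \<langle>?w\<rangle> \<in> P"
    using ideal_mono_mult(2)[OF Pi h(1), of ?w] q is_path_verts(1)[OF q(2)] set_map_GE(1)[OF q(2)] by simp
  ultimately have "h x \<cdot> \<langle>[GV w]\<rangle> \<in> P" using ideal_cong[OF Pi] by blast
  then have "inverse (h x) \<cdot> h x \<cdot> \<langle>[GV w]\<rangle> \<in> P" using subspaceD(3)[OF is_idealD(3)[OF Pi]] by blast
  then show ?thesis using x h(3) by (simp add: smult_simps)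
qed

text \<open>At an infinite emitter the second Cuntz-Krieger relation is missing. This condition
  replaces it: whichever edge is chosen there, its range is outside \<open>P\<close>.\<close>

definition leak_free :: "('v,'e,'k) fa set \<Rightarrow> bool" where
  "leak_free P \<longleftrightarrow> (\<forall>v\<in>V. infinite (emits v) \<longrightarrow> \<langle>[GV v]\<rangle> \<notin> P \<longrightarrow> (\<forall>e\<in>emits v. \<langle>[GV (rng G e)]\<rangle> \<notin> P))"

lemma basis_words_in_words: "basis_words n v \<subseteq> words G"
  by (auto simp: basis_words_def words_iff dest: set_basis_word[OF conjI, THEN subsetD])

lemma GG_ghost_comb:
  assumes f: "f \<in> supp_on (ghost_words w)" and p: "is_path G w p"
  shows "\<langle>rev (map GG p)\<rangle> \<star> f \<in> supp_on (ghost_words (path_end G w p))"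
proof (rule supp_on_linear_mem[OF subspace_supp_on f])
  fix x assume "x \<in> ghost_words w"
  then show "\<langle>rev (map GG p)\<rangle> \<star> \<langle>x\<rangle> \<in> supp_on (ghost_words (path_end G w p))"
    using p by (auto simp: mono_mult_mono ghost_words_def rev_GG_ghost_path)
qed (auto simp: mult_distrib)

text \<open>Cancellation in the free algebra itself, not modulo \<open>J\<close>: prefixing a fixed
  word is injective on words.\<close>

lemma GG_ghost_comb_0: "\<langle>u\<rangle> \<star> f = 0 \<Longrightarrow> f = 0"
  by (metis ext fun_apply(2) mono_mult_append)

lemma vertex_mult_start:
  assumes f: "f \<in> supp_on {w\<in>words G. gen_start (hd w) = v}"
  shows "\<langle>[GV v]\<rangle> \<star> f - f \<in> J"
proof (rule supp_on_linear_mem[OF subspace_J f, where T="\<lambda>f. \<langle>[GV v]\<rangle> \<star> f - f"])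
  fix w assume "w \<in> {w\<in>words G. gen_start (hd w) = v}"
  then show "\<langle>[GV v]\<rangle> \<star> \<langle>w\<rangle> - \<langle>w\<rangle> \<in> J"
    using word_start(1)[of w] by (auto simp: mono_mult_mono wcong_def)
next
  fix c f show "\<langle>[GV v]\<rangle> \<star> c \<cdot> f - c \<cdot> f = c \<cdot> (\<langle>[GV v]\<rangle> \<star> f - f)"
    unfolding mult_distrib smult_simps ..
qed (simp add: mult_distrib)

lemma basis_words_start: "basis_words n v \<subseteq> {w \<in> words G. gen_start (hd w) = v}"
proof
  fix w assume w: "w \<in> basis_words n v"
  then have "gen_start (hd w) = v" by (auto simp: basis_words_def basis_word_def)
  with w basis_words_in_words show "w \<in> {w \<in> words G. gen_start (hd w) = v}" by auto
qed

lemma basis_words_0_ghost: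
  fixes y :: "('v,'e,'k) fa"
  assumes "y \<in> supp_on (basis_words 0 v)"
  shows "\<exists>g\<in>supp_on (ghost_words v). y - g \<in> J"
proof -
  have "\<exists>g\<in>supp_on (ghost_words v). \<langle>[]\<rangle> \<star> y - g \<in> J"
  proof (rule left_mult_rewrite[OF assms])
    fix w assume "w \<in> basis_words 0 v"
    then obtain u q where w: "w = basis_word v [] u q" "path_pair v [] u q"
      by (auto simp: basis_words_def)
    have "ghost_path u q \<in> ghost_words v" using w unfolding ghost_words_def by auto
    then show "wnull ([] @ w) \<or> (\<exists>w'\<in>ghost_words v. wcong ([] @ w) w')"
      using basis_word_Nil[OF w(2)] w(1) by auto
  qed
  then show ?thesis by simp
qed

definition edge_words :: "'v \<Rightarrow> ('v,'e) gen list set" where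
  "edge_words v = {basis_word v (e # p) u q | e p u q. path_pair v (e # p) u q}"

lemma basis_words_Suc_diff: "basis_words n v \<inter> - basis_words 0 v \<subseteq> edge_words v"
proof
  fix w assume "w \<in> basis_words n v \<inter> - basis_words 0 v"
  then obtain p u q where w: "w = basis_word v p u q" "path_pair v p u q" "w \<notin> basis_words 0 v"
    by (auto simp: basis_words_def)
  then have "p \<noteq> []" unfolding basis_words_def by auto
  then obtain e p' where "p = e # p'" by (cases p) auto
  with w show "w \<in> edge_words v" unfolding edge_words_def by blast
qed

text \<open>The edge \<open>f\<close> is the first edge of the real path: f f^* restores the word,
  and every other ghost edge kills it.\<close>

lemma edge_word_expand:
  assumes "w \<in> edge_words v"
  obtains f where "f \<in> emits v" "wcong (GE f # GG f # w) w"
    "\<forall>e\<in>emits v - {f}. wnull (GG e # w)"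
proof -
  obtain f p u q where w: "w = basis_word v (f # p) u q" "path_pair v (f # p) u q"
    using assms by (auto simp: edge_words_def)
  then have f: "f \<in> E" "src G f = v" by auto
  have w': "path_pair (src G f) (f # p) u q" using w f by simp
  note 1 = GG_basis_word_Cons[OF w']
  have "wcong (GE f # GG f # w) (GE f # basis_word (rng G f) p u q)"
    using wcong_pre[of "GG f # w" "basis_word (rng G f) p u q" "[GE f]"] 1[OF f(1)] w f by simp
  also have "wcong \<dots> w"
    using GE_basis_word[of f p u q] w f by simp
  finally show ?thesis
  proof (rule that[rotated])
    show "f \<in> emits v" using f by simp
    show "\<forall>e\<in>emits v - {f}. wnull (GG e # w)"
    proof
      fix e assume "e \<in> emits v - {f}"
      then show "wnull (GG e # w)" using 1[of e] w f by auto
    qed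
  qed
qed

text \<open>A finite substitute for the second Cuntz-Krieger relation, valid at infinite emitters
  too: the first edges of the words in \<open>y\<close> suffice.\<close>

lemma edge_comb_expand:
  fixes y :: "('v,'e,'k) fa"
  assumes y: "y \<in> supp_on (edge_words v)"
  shows "\<exists>D. finite D \<and> D \<subseteq> emits v \<and> (\<forall>e\<in>emits v - D. \<langle>[GG e]\<rangle> \<star> y \<in> J) \<and>
    (\<Sum>e\<in>D. \<langle>[GE e, GG e]\<rangle>) \<star> y - y \<in> J"
proof -
  \<comment> \<open>Again claimed for all finite supersets, so that the edge sets of different words
    can be merged.\<close>
  have "\<exists>D0. finite D0 \<and> D0 \<subseteq> emits v \<and> (\<forall>D. finite D \<and> D0 \<subseteq> D \<and> D \<subseteq> emits v \<longrightarrow>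
      (\<forall>e\<in>emits v - D. \<langle>[GG e]\<rangle> \<star> y \<in> J) \<and> (\<Sum>e\<in>D. \<langle>[GE e, GG e]\<rangle>) \<star> y - y \<in> J)"
    using y
  proof (induction rule: supp_on_induct)
    case zero
    show ?case using subspaceD(1)[OF subspace_J]
      by (intro exI[of _ "{}"]) (auto simp: mult_distrib)
  next
    case (step c w g)
    from step.IH obtain D0 where D0: "finite D0" "D0 \<subseteq> emits v"
      "\<forall>D. finite D \<and> D0 \<subseteq> D \<and> D \<subseteq> emits v \<longrightarrow>
        (\<forall>e\<in>emits v - D. \<langle>[GG e]\<rangle> \<star> g \<in> J) \<and> (\<Sum>e\<in>D. \<langle>[GE e, GG e]\<rangle>) \<star> g - g \<in> J"
      by (elim exE conjE)
    obtain f where f: "f \<in> emits v" "wcong (GE f # GG f # w) w"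
      "\<forall>e\<in>emits v - {f}. wnull (GG e # w)"
      by (rule edge_word_expand[OF step(1)])
    show ?case
    proof (intro exI[of _ "insert f D0"] conjI allI impI ballI)
      fix D e assume D: "finite D \<and> insert f D0 \<subseteq> D \<and> D \<subseteq> emits v" and e: "e \<in> emits v - D"
      have "e \<in> emits v - {f}" using D e by blast
      then have "wnull (GG e # w)" using f(3) by blast
      then have 1: "\<langle>[GG e]\<rangle> \<star> \<langle>w\<rangle> \<in> J" by (simp add: wnull_def mono_mult_mono)
      have DD: "finite D \<and> D0 \<subseteq> D \<and> D \<subseteq> emits v" using D by blast
      have 2: "\<langle>[GG e]\<rangle> \<star> g \<in> J" by (rule D0(3)[THEN spec, THEN mp, OF DD, THEN conjunct1, THEN bspec, OF e])
      show "\<langle>[GG e]\<rangle> \<star> (c \<cdot> \<langle>w\<rangle> + g) \<in> J"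
        unfolding mult_distrib by (intro subspaceD(2,3)[OF subspace_J] 1 2)
    next
      fix D assume D: "finite D \<and> insert f D0 \<subseteq> D \<and> D \<subseteq> emits v"
      have "(\<Sum>e\<in>D. \<langle>[GE e, GG e]\<rangle>) \<star> \<langle>w\<rangle> - \<langle>w\<rangle>
        = (\<langle>GE f # GG f # w\<rangle> - \<langle>w\<rangle>) + (\<Sum>e\<in>D - {f}. \<langle>GE e # GG e # w\<rangle>)"
      proof -
        have "finite D" "f \<in> D" using D by auto
        then show ?thesis by (simp add: mult_sum_left mono_mult_mono mult_distrib sum.remove[of D f])
      qed
      also have "\<dots> \<in> J"
      proof (intro subspaceD(2)[OF subspace_J] subspace_sum[OF subspace_J])
        show "\<langle>GE f # GG f # w\<rangle> - \<langle>w\<rangle> \<in> J" using f(2) by (simp add: wcong_def)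
        show "\<langle>GE e # GG e # w\<rangle> \<in> J" if "e \<in> D - {f}" for e
        proof -
          have e: "e \<in> emits v - {f}" using D that by blast
          then have "wnull (GG e # w)" "e \<in> E" using f(3) by blast+
          then show ?thesis using wnull_pre[of "GG e # w" "[GE e]"] by (simp add: wnull_def)
        qed
      qed
      finally have 1: "(\<Sum>e\<in>D. \<langle>[GE e, GG e]\<rangle>) \<star> \<langle>w\<rangle> - \<langle>w\<rangle> \<in> J" .
      have 2: "(\<Sum>e\<in>D. \<langle>[GE e, GG e]\<rangle>) \<star> g - g \<in> J"
        by (rule D0(3)[THEN spec, THEN mp, THEN conjunct2]) (use D in blast)
      have "(\<Sum>e\<in>D. \<langle>[GE e, GG e]\<rangle>) \<star> (c \<cdot> \<langle>w\<rangle> + g) - (c \<cdot> \<langle>w\<rangle> + g) =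
         c \<cdot> ((\<Sum>e\<in>D. \<langle>[GE e, GG e]\<rangle>) \<star> \<langle>w\<rangle> - \<langle>w\<rangle>) + ((\<Sum>e\<in>D. \<langle>[GE e, GG e]\<rangle>) \<star> g - g)"
        unfolding mult_distrib smult_simps by simp
      also have "\<dots> \<in> J" by (intro subspaceD(2,3)[OF subspace_J] 1 2)
      finally show "(\<Sum>e\<in>D. \<langle>[GE e, GG e]\<rangle>) \<star> (c \<cdot> \<langle>w\<rangle> + g) - (c \<cdot> \<langle>w\<rangle> + g) \<in> J" .
    qed (use D0(1,2) f(1) in auto)
  qed
  then obtain D where D: "finite D" "D \<subseteq> emits v" "\<forall>D'. finite D' \<and> D \<subseteq> D' \<and> D' \<subseteq> emits v \<longrightarrow>
      (\<forall>e\<in>emits v - D'. \<langle>[GG e]\<rangle> \<star> y \<in> J) \<and> (\<Sum>e\<in>D'. \<langle>[GE e, GG e]\<rangle>) \<star> y - y \<in> J"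
    by (elim exE conjE)
  from D(3)[THEN spec, of D] D(1,2) show ?thesis by (intro exI[of _ D]) simp
qed

text \<open>Only at a sink can all products e^* y lie in \<open>P\<close> while \<open>y\<close>
  does not. Here \<open>y0\<close> collects the words without real edges and \<open>y1\<close> the
  others; the cases of a regular vertex and of an infinite emitter both force \<open>y\<close> into
  \<open>P\<close>.\<close>

lemma ghost_reduction_step:
  assumes P: "is_gideal P" "leak_free P"
    and y: "y \<in> supp_on (basis_words n v)" "y \<notin> P" "v \<in> V"
    and e: "\<And>e. e \<in> emits v \<Longrightarrow> \<langle>[GG e]\<rangle> \<star> y \<in> P"
  shows "\<exists>g\<in>supp_on (ghost_words v). y - g \<in> J"
proof -
  have Pi: "is_ideal P" using P by (simp add: is_gideal_def)
  note sub = is_idealD(3)[OF Pi]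
  define y0 where "y0 = restr (basis_words 0 v) y"
  define y1 where "y1 = restr (- basis_words 0 v) y"
  have yy: "y = y0 + y1" unfolding y0_def y1_def by (rule restr_split)
  have "y0 \<in> supp_on (basis_words 0 v)"
    unfolding y0_def by (rule supp_on_subset[OF restr_supp_on[OF y(1)]]) auto
  from basis_words_0_ghost[OF this] obtain g
    where g: "g \<in> supp_on (ghost_words v)" "y0 - g \<in> J" by blast
  have y1: "y1 \<in> supp_on (edge_words v)"
    unfolding y1_def by (rule supp_on_subset[OF restr_supp_on[OF y(1)] basis_words_Suc_diff])
  obtain D where D: "finite D" "D \<subseteq> emits v" "\<And>e. e \<in> emits v - D \<Longrightarrow> \<langle>[GG e]\<rangle> \<star> y1 \<in> J"
    "(\<Sum>e\<in>D. \<langle>[GE e, GG e]\<rangle>) \<star> y1 - y1 \<in> J"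
    using edge_comb_expand[OF y1] by blast
  have vy: "\<langle>[GV v]\<rangle> \<star> y - y \<in> J"
    by (rule vertex_mult_start[OF supp_on_subset[OF y(1) basis_words_start]])
  have yF: "y \<in> F" unfolding fa_set_eq by (rule supp_on_subset[OF y(1) basis_words_in_words])
  have GEGG: "(\<Sum>e\<in>A. \<langle>[GE e, GG e]\<rangle>) \<star> z \<in> P" if "\<And>e. e \<in> A \<Longrightarrow> \<langle>[GG e]\<rangle> \<star> z \<in> P" "A \<subseteq> E" for A z
    unfolding mult_sum_left
  proof (rule subspace_sum[OF sub])
    fix e assume "e \<in> A"
    then show "\<langle>[GE e, GG e]\<rangle> \<star> z \<in> P"
      using ideal_mono_mult(1)[OF Pi that(1), of e "[GE e]"] that(2) by (auto simp: mono_mono_mult)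
  qed
  show ?thesis
  proof (cases "finite (emits v)")
    case fin: True
    show ?thesis
    proof (cases "emits v = {}")
      case True
      \<comment> \<open>Without edges the expansion of \<open>y1\<close> is an empty sum, so
        \<open>y1\<close> lies in \<open>J\<close> and only the ghost part remains.\<close>
      then have "D = {}" using D by auto
      then have "- y1 \<in> J" using D(4) by (simp add: mult_distrib)
      then have "y1 \<in> J" using subspaceD(3)[OF subspace_J, of "- y1" "-1"] by (simp add: smult_simps)
      then have "(y0 - g) + y1 \<in> J" by (rule subspaceD(2)[OF subspace_J g(2)])
      moreover have "(y0 - g) + y1 = y - g" by (simp add: yy)
      ultimately have "y - g \<in> J" by simp
      then show ?thesis using g by blast
    next
      case False
      \<comment> \<open>The second Cuntz-Krieger relation turns \<open>y\<close> into a sum of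
        elements e e^* y, all of them in \<open>P\<close>.\<close>
      have "(\<langle>[GV v]\<rangle> - (\<Sum>e\<in>emits v. \<langle>[GE e, GG e]\<rangle>)) \<star> y \<in> J"
        using is_idealD(5)[OF is_ideal_J yF rel_CK2[OF y(3) False fin]] .
      then have 1: "\<langle>[GV v]\<rangle> \<star> y - (\<Sum>e\<in>emits v. \<langle>[GE e, GG e]\<rangle>) \<star> y \<in> J"
        by (simp add: mult_distrib)
      have "(\<Sum>e\<in>emits v. \<langle>[GE e, GG e]\<rangle>) \<star> y \<in> P"
        by (rule GEGG[OF e]) auto
      then show ?thesis using ideal_cong[OF Pi 1] ideal_cong[OF Pi vy] y(2) by simp
    qed
  next
    case inf: False
    have vP: "\<langle>[GV v]\<rangle> \<notin> P"
      using is_idealD(5)[OF Pi yF, of "\<langle>[GV v]\<rangle>"] ideal_cong[OF Pi vy] y(2) by blast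
    have "emits v - D \<noteq> {}" using inf D(1) finite_subset[of "emits v" D] by blast
    \<comment> \<open>The ghost edge of \<open>f\<close> kills \<open>y1\<close> modulo
      \<open>J\<close>, so it carries \<open>y\<close> to a pure ghost combination that ends in the
      range of \<open>f\<close>.\<close>
    then obtain f where f: "f \<in> emits v - D" by blast
    then have fP: "\<langle>[GV (rng G f)]\<rangle> \<notin> P"
      using P(2) inf vP y(3) unfolding leak_free_def by blast
    have gf: "\<langle>[GG f]\<rangle> \<star> g \<in> supp_on (ghost_words (rng G f))"
      using GG_ghost_comb[OF g(1), of "[f]"] f by auto
    have "\<langle>[GG f]\<rangle> \<star> y - \<langle>[GG f]\<rangle> \<star> g = \<langle>[GG f]\<rangle> \<star> (y0 - g) + \<langle>[GG f]\<rangle> \<star> y1"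
      by (simp add: yy mult_distrib)
    also have "\<dots> \<in> J"
      using J_mono_mult(1)[OF g(2), of "[GG f]"] D(3)[OF f] f subspaceD(2)[OF subspace_J] by auto
    finally have "\<langle>[GG f]\<rangle> \<star> g \<in> P" using ideal_cong[OF Pi] e[of f] f by blast
    \<comment> \<open>A nonzero ghost combination in \<open>P\<close> would put the range of
      \<open>f\<close> into \<open>P\<close>, against \<open>leak_free\<close>.\<close>
    then have "\<langle>[GG f]\<rangle> \<star> g = 0"
      using ghost_comb_in_ideal[OF P(1) _ gf] fP by blast
    then have "g = 0" by (rule GG_ghost_comb_0)
    then have y0: "y0 \<in> P" using g(2) is_idealD(1)[OF Pi] by auto
    have "(\<Sum>e\<in>D. \<langle>[GE e, GG e]\<rangle>) \<star> y1 \<in> P"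
    proof (rule GEGG)
      fix d assume d: "d \<in> D"
      have "\<langle>[GG d]\<rangle> \<star> y - \<langle>[GG d]\<rangle> \<star> y0 \<in> P"
        by (rule subspaceD(4)[OF sub]) (use e D(2) d ideal_mono_mult(1)[OF Pi y0, of "[GG d]"] in auto)
      then show "\<langle>[GG d]\<rangle> \<star> y1 \<in> P" by (simp add: yy mult_distrib)
    qed (use D in auto)
    then have "y1 \<in> P" using ideal_cong[OF Pi D(4)] by blast
    then show ?thesis using y(2) yy y0 subspaceD(2)[OF sub] by blast
  qed
qed

text \<open>While some e^* y stays outside \<open>P\<close>, multiply by that ghost edge; this
  shortens the real parts, so it happens at most \<open>n\<close> times. Once there is no such edge,
  \<open>ghost_reduction_step\<close> applies.\<close>

lemma ghost_reduction_start:
  assumes P: "is_gideal P" "leak_free P"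
  shows "y \<in> supp_on (basis_words n v) \<Longrightarrow> y \<notin> P \<Longrightarrow> v \<in> V \<Longrightarrow>
    \<exists>p g. is_path G v p \<and> g \<in> supp_on (ghost_words (path_end G v p)) \<and> g \<notin> P \<and>
      \<langle>rev (map GG p)\<rangle> \<star> y - g \<in> J"
proof (induction n arbitrary: v y)
  case 0
  from basis_words_0_ghost[OF 0(1)] obtain g where g: "g \<in> supp_on (ghost_words v)" "y - g \<in> J"
    by blast
  have "is_ideal P" using P by (simp add: is_gideal_def)
  then show ?case using g 0 ideal_cong[of P y g] by (intro exI[of _ "[]"] exI[of _ g]) simp
next
  case (Suc n)
  have Pi: "is_ideal P" using P by (simp add: is_gideal_def)
  show ?case
  proof (cases "\<forall>e\<in>emits v. \<langle>[GG e]\<rangle> \<star> y \<in> P")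
    case True
    then obtain g where g: "g \<in> supp_on (ghost_words v)" "y - g \<in> J"
      using ghost_reduction_step[OF P Suc.prems] by blast
    then show ?thesis using Suc.prems ideal_cong[OF Pi, of y g]
      by (intro exI[of _ "[]"] exI[of _ g]) simp
  next
    case False
    then obtain e where e: "e \<in> E" "src G e = v" "\<langle>[GG e]\<rangle> \<star> y \<notin> P" by blast
    have "\<exists>z\<in>supp_on (basis_words n (rng G e)). \<langle>[GG e]\<rangle> \<star> y - z \<in> J"
      by (rule left_mult_rewrite[OF Suc.prems(1)]) (use GG_basis_words[of _ n e] e in auto)
    then obtain z where z: "z \<in> supp_on (basis_words n (rng G e))" "\<langle>[GG e]\<rangle> \<star> y - z \<in> J" by blast
    have "z \<notin> P" using ideal_cong[OF Pi z(2)] e(3) by simp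
    from Suc.IH[OF z(1) this] e obtain p g where p: "is_path G (rng G e) p"
      "g \<in> supp_on (ghost_words (path_end G (rng G e) p))" "g \<notin> P" "\<langle>rev (map GG p)\<rangle> \<star> z - g \<in> J"
      by auto
    have "\<langle>rev (map GG p)\<rangle> \<star> (\<langle>[GG e]\<rangle> \<star> y - z) \<in> J"
      by (rule J_mono_mult(1)[OF z(2)]) (use set_map_GE(2)[OF p(1)] in simp)
    then have "\<langle>rev (map GG (e # p))\<rangle> \<star> y - \<langle>rev (map GG p)\<rangle> \<star> z \<in> J"
      by (simp add: mult_distrib mono_mono_mult)
    from subspace_diff_trans[OF subspace_J this p(4)] show ?thesis
      using p e by (intro exI[of _ "e # p"] exI[of _ g]) auto
  qed
qed

text \<open>Some vertex \<open>v\<close> keeps the product with \<open>x\<close> outside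
  \<open>P\<close>. Modulo \<open>J\<close> that product is the part of a normal form of
  \<open>x\<close> whose words start at \<open>v\<close>.\<close>

theorem ghost_reduction:
  assumes P: "is_gideal P" "leak_free P" and x: "x \<in> F" "x \<notin> P"
  obtains v p g where "is_path G v p" "g \<in> supp_on (ghost_words (path_end G v p))" "g \<notin> P"
    "\<langle>ghost_path v p\<rangle> \<star> x - g \<in> J"
proof -
  have Pi: "is_ideal P" using P by (simp add: is_gideal_def)
  obtain v where v: "v \<in> V" "\<langle>[GV v]\<rangle> \<star> x \<notin> P" using ideal_memI_vertices[OF Pi x(1)] x(2) by blast
  obtain n g where g: "g \<in> supp_on (\<Union>v. basis_words n v)" "x - g \<in> J" using normal_form[OF x(1)] by blast
  let ?D = "{w. gen_start (hd w) = v}"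
  define y where "y = restr ?D g"
  have y1: "y \<in> supp_on (basis_words n v)"
    unfolding y_def by (rule supp_on_subset[OF restr_supp_on[OF g(1)]]) (use basis_words_start in blast)
  have "\<langle>[GV v]\<rangle> \<star> g - y \<in> J" unfolding y_def
  proof (rule supp_on_linear_mem[OF subspace_J g(1), where T="\<lambda>g. \<langle>[GV v]\<rangle> \<star> g - restr ?D g"])
    fix w assume "w \<in> (\<Union>v. basis_words n v)"
    then have "w \<in> words G" using basis_words_in_words by blast
    then show "\<langle>[GV v]\<rangle> \<star> \<langle>w\<rangle> - restr ?D \<langle>w\<rangle> \<in> J"
      using word_start(1)[of w] word_start(2)[of w v] v(1) by (auto simp: restr_simps mono_mult_mono wcong_def wnull_def)
  next
    fix c f show "\<langle>[GV v]\<rangle> \<star> c \<cdot> f - restr ?D (c \<cdot> f) = c \<cdot> (\<langle>[GV v]\<rangle> \<star> f - restr ?D f)"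
      unfolding mult_distrib smult_simps restr_simps ..
  qed (simp add: mult_distrib restr_simps)
  moreover have "\<langle>[GV v]\<rangle> \<star> x - \<langle>[GV v]\<rangle> \<star> g \<in> J"
    using J_mono_mult(1)[OF g(2), of "[GV v]"] v(1) by (simp add: mult_distrib)
  ultimately have xy: "\<langle>[GV v]\<rangle> \<star> x - y \<in> J" by (rule subspace_diff_trans[OF subspace_J, rotated])
  then have "y \<notin> P" using ideal_cong[OF Pi] v(2) by blast
  from ghost_reduction_start[OF P y1 this v(1)] obtain p h where p: "is_path G v p"
    "h \<in> supp_on (ghost_words (path_end G v p))" "h \<notin> P" "\<langle>rev (map GG p)\<rangle> \<star> y - h \<in> J" by blast
  have "\<langle>rev (map GG p)\<rangle> \<star> (\<langle>[GV v]\<rangle> \<star> x - y) \<in> J"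
    by (rule J_mono_mult(1)[OF xy set_map_GE(2)[OF p(1)]])
  then have "\<langle>ghost_path v p\<rangle> \<star> x - \<langle>rev (map GG p)\<rangle> \<star> y \<in> J"
    by (simp add: mult_distrib mono_mono_mult ghost_path_def)
  from subspace_diff_trans[OF subspace_J this p(4)] show thesis using that p by blast
qed

end

section \<open>A representation on boundary paths\<close>

text \<open>Finite and infinite edge sequences in one type. They are always paired with a start
  vertex, because \<open>Stop\<close> does not show where it sits.\<close>

codatatype 'e bpath = Stop | Step 'e "'e bpath"

primcorec greedy :: "'v set \<Rightarrow> ('v \<Rightarrow> 'e) \<Rightarrow> ('e \<Rightarrow> 'v) \<Rightarrow> 'v \<Rightarrow> 'e bpath" where
  "greedy S n r v = (if v \<in> S then Stop else Step (n v) (greedy S n r (r (n v))))"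

section \<open>Linear functionals on the free algebra\<close>

definition eval_lin :: "(('v,'e) gen list \<Rightarrow> 'k) \<Rightarrow> ('v,'e,'k::field) fa \<Rightarrow> 'k" where
  "eval_lin c f = (\<Sum>w | f w \<noteq> 0. f w * c w)"

lemma eval_lin_finite:
  assumes "finite S" "{w. f w \<noteq> 0} \<subseteq> S"
  shows "eval_lin c f = (\<Sum>w\<in>S. f w * c w)"
  unfolding eval_lin_def by (rule sum.mono_neutral_left) (use assms in auto)

lemma eval_lin_add:
  assumes "f \<in> supp_on A" "g \<in> supp_on A"
  shows "eval_lin c (f + g) = eval_lin c f + eval_lin c g"
proof -
  define S where "S = {w. f w \<noteq> 0} \<union> {w. g w \<noteq> 0}"
  have S: "finite S" using assms by (simp add: S_def supp_on_def)
  have "eval_lin c h = (\<Sum>w\<in>S. h w * c w)" if "h \<in> {f, g, f + g}" for h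
    by (rule eval_lin_finite[OF S]) (use that in \<open>auto simp: S_def fun_apply\<close>)
  then show ?thesis by (simp add: fun_apply distrib_right sum.distrib)
qed

lemma eval_lin_smult: "eval_lin c (a \<cdot> f) = a * eval_lin c f"
  by (cases "a = 0") (simp_all add: eval_lin_def fa_smult_def sum_distrib_left mult.assoc)

lemma eval_lin_0: "eval_lin c 0 = 0"
  by (simp add: eval_lin_def fun_apply)

lemma eval_lin_mono: "eval_lin c \<langle>w\<rangle> = c w"
  by (simp add: eval_lin_def fa_mono_def)

lemma eval_lin_diff:
  assumes "f \<in> supp_on A" "g \<in> supp_on A"
  shows "eval_lin c (f - g) = eval_lin c f - eval_lin c g"
  using eval_lin_add[OF assms(1) supp_on_smult[OF assms(2), of "- 1"], of c]
  by (simp only: eval_lin_smult) (simp add: smult_simps)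

lemma eval_lin_sum:
  assumes "finite S" "\<And>a. a \<in> S \<Longrightarrow> f a \<in> supp_on A"
  shows "eval_lin c (\<Sum>a\<in>S. f a) = (\<Sum>a\<in>S. eval_lin c (f a))"
  using assms
proof (induction S rule: finite_induct)
  case (insert a S)
  then show ?case using eval_lin_add[of "f a" A "\<Sum>a\<in>S. f a" c] supp_on_sum[of S f A] by auto
qed (simp add: eval_lin_0)

lemma eval_lin_mult_mono:
  assumes "f \<in> supp_on A"
  shows "eval_lin c (\<langle>u\<rangle> \<star> f) = eval_lin (\<lambda>w. c (u @ w)) f"
    and "eval_lin c (f \<star> \<langle>u\<rangle>) = eval_lin (\<lambda>w. c (w @ u)) f"
proof -
  have U: "g \<in> supp_on UNIV" if "g \<in> supp_on B" for g :: "('a,'b,'c) fa" and B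
    using supp_on_subset[OF that] by simp
  note M = supp_on_mult[where C=UNIV, OF _ _ UNIV_I]
  show "eval_lin c (\<langle>u\<rangle> \<star> f) = eval_lin (\<lambda>w. c (u @ w)) f" using assms
  proof (induction rule: supp_on_induct)
    case (step a w g)
    have "eval_lin c (\<langle>u\<rangle> \<star> (a \<cdot> \<langle>w\<rangle> + g)) = eval_lin c (a \<cdot> \<langle>u @ w\<rangle>) + eval_lin c (\<langle>u\<rangle> \<star> g)"
      unfolding mult_distrib mono_mult_mono
      by (rule eval_lin_add[where A=UNIV]) (auto intro!: supp_on_smult M[of _ "{u}" _ A] step)
    also have "\<dots> = eval_lin (\<lambda>w. c (u @ w)) (a \<cdot> \<langle>w\<rangle>) + eval_lin (\<lambda>w. c (u @ w)) g"
      by (simp add: eval_lin_smult eval_lin_mono step)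
    also have "\<dots> = eval_lin (\<lambda>w. c (u @ w)) (a \<cdot> \<langle>w\<rangle> + g)"
      by (rule eval_lin_add[symmetric, where A=A]) (auto intro!: supp_on_smult step)
    finally show ?case .
  qed (simp add: mult_distrib eval_lin_0)
  show "eval_lin c (f \<star> \<langle>u\<rangle>) = eval_lin (\<lambda>w. c (w @ u)) f" using assms
  proof (induction rule: supp_on_induct)
    case (step a w g)
    have "eval_lin c ((a \<cdot> \<langle>w\<rangle> + g) \<star> \<langle>u\<rangle>) = eval_lin c (a \<cdot> \<langle>w @ u\<rangle>) + eval_lin c (g \<star> \<langle>u\<rangle>)"
      unfolding mult_distrib mono_mult_mono
      by (rule eval_lin_add[where A=UNIV]) (auto intro!: supp_on_smult M[of _ A _ "{u}"] step)
    also have "\<dots> = eval_lin (\<lambda>w. c (w @ u)) (a \<cdot> \<langle>w\<rangle>) + eval_lin (\<lambda>w. c (w @ u)) g"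
      by (simp add: eval_lin_smult eval_lin_mono step)
    also have "\<dots> = eval_lin (\<lambda>w. c (w @ u)) (a \<cdot> \<langle>w\<rangle> + g)"
      by (rule eval_lin_add[symmetric, where A=A]) (auto intro!: supp_on_smult step)
    finally show ?case .
  qed (simp add: mult_distrib eval_lin_0)
qed

context lpa_graph
begin

section \<open>Hereditary and saturated sets, and the action on boundary paths\<close>

definition hereditary :: "'v set \<Rightarrow> bool" where
  "hereditary H \<longleftrightarrow> H \<subseteq> V \<and> (\<forall>e\<in>E. src G e \<in> H \<longrightarrow> rng G e \<in> H)"

definition regular :: "'v \<Rightarrow> bool" where
  "regular v \<longleftrightarrow> v \<in> V \<and> emits v \<noteq> {} \<and> finite (emits v)"

definition saturated :: "'v set \<Rightarrow> bool" where
  "saturated H \<longleftrightarrow> (\<forall>v. regular v \<longrightarrow> (\<forall>e\<in>emits v. rng G e \<in> H) \<longrightarrow> v \<in> H)"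

text \<open>Boundary paths that avoid H: infinite paths, or finite ones ending in a sink or
  an infinite emitter.\<close>

coinductive boundary :: "'v set \<Rightarrow> 'v \<Rightarrow> 'e bpath \<Rightarrow> bool" for H where
  Stop: "v \<in> V \<Longrightarrow> v \<notin> H \<Longrightarrow> \<not> regular v \<Longrightarrow> boundary H v Stop"
| Step: "e \<in> E \<Longrightarrow> src G e \<notin> H \<Longrightarrow> boundary H (rng G e) l \<Longrightarrow> boundary H (src G e) (Step e l)"

lemma boundary_notin: "boundary H v l \<Longrightarrow> v \<notin> H"
  by (cases rule: boundary.cases) auto

text \<open>Saturation gives every regular vertex outside \<open>H\<close> an edge whose range is
  outside \<open>H\<close>. Following such edges either continues forever or stops at a vertex that
  is not regular.\<close>

lemma boundary_exists:
  assumes H: "saturated H" and v: "v \<in> V" "v \<notin> H"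
  shows "\<exists>l. boundary H v l"
proof -
  define n where "n = (\<lambda>u. SOME e. e \<in> emits u \<and> rng G e \<notin> H)"
  have n: "n u \<in> emits u \<and> rng G (n u) \<notin> H" if "u \<notin> H" "regular u" for u
  proof -
    have "\<exists>e. e \<in> emits u \<and> rng G e \<notin> H" using H that unfolding saturated_def by blast
    then show ?thesis unfolding n_def by (rule someI_ex)
  qed
  let ?S = "{u. \<not> regular u}"
  have "boundary H v (greedy ?S n (rng G) v)"
  proof (rule boundary.coinduct[where X="\<lambda>u l. u \<in> V \<and> u \<notin> H \<and> l = greedy ?S n (rng G) u"])
    fix u l assume u: "u \<in> V \<and> u \<notin> H \<and> l = greedy ?S n (rng G) u"
    show "(\<exists>v. u = v \<and> l = Stop \<and> v \<in> V \<and> v \<notin> H \<and> \<not> regular v) \<or>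
       (\<exists>e l'. u = src G e \<and> l = Step e l' \<and> e \<in> E \<and> src G e \<notin> H \<and>
         ((rng G e \<in> V \<and> rng G e \<notin> H \<and> l' = greedy ?S n (rng G) (rng G e)) \<or> boundary H (rng G e) l'))"
    proof (cases "regular u")
      case False
      then show ?thesis using u greedy.code[of ?S n "rng G" u] by simp
    next
      case True
      then have "l = Step (n u) (greedy ?S n (rng G) (rng G (n u)))"
        using u greedy.code[of ?S n "rng G" u] by simp
      moreover have "n u \<in> E" "src G (n u) = u" "rng G (n u) \<notin> H" using n[OF _ True] u by auto
      ultimately show ?thesis using u by (intro disjI2 exI[of _ "n u"]) auto
    qed
  qed (use v in auto)
  then show ?thesis by blast
qed

text \<open>A right action: a real edge strips the first edge of the path, a ghost edge prepends
  one, and \<open>None\<close> is zero. Each generator sends a path to one path or to zero, so paths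
  suffice to describe it.\<close>

fun act :: "('v,'e) gen \<Rightarrow> 'v \<times> 'e bpath \<Rightarrow> ('v \<times> 'e bpath) option" where
  "act (GV v) (u, l) = (if u = v then Some (u, l) else None)"
| "act (GE e) (u, Stop) = None"
| "act (GE e) (u, Step f l) = (if f = e \<and> u = src G e then Some (rng G e, l) else None)"
| "act (GG e) (u, l) = (if u = rng G e then Some (src G e, Step e l) else None)"

fun act_word :: "('v,'e) gen list \<Rightarrow> 'v \<times> 'e bpath \<Rightarrow> ('v \<times> 'e bpath) option" where
  "act_word [] x = Some x"
| "act_word (g # w) x = Option.bind (act g x) (act_word w)"

lemma act_word_append: "act_word (u @ w) x = Option.bind (act_word u x) (act_word w)"
  by (induction u arbitrary: x) (auto split: Option.bind_splits)

abbreviation bounds :: "'v set \<Rightarrow> ('v \<times> 'e bpath) set" where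
  "bounds H \<equiv> {(v, l). boundary H v l}"

text \<open>Heredity matters for ghost edges: prepending \<open>e\<close> to a path that avoids
  \<open>H\<close> requires the source of \<open>e\<close> to be outside \<open>H\<close>.\<close>

lemma act_bounds:
  assumes H: "hereditary H" and x: "x \<in> bounds H" and g: "g \<in> gens G" and y: "act g x = Some y"
  shows "y \<in> bounds H"
proof -
  obtain u l where x': "x = (u, l)" "boundary H u l" using x by auto
  show ?thesis
  proof (cases g)
    case (GV v)
    then show ?thesis using y x' by (auto split: if_splits)
  next
    case (GE e)
    from x'(2) show ?thesis using y x' GE by cases (auto split: if_splits)
  next
    case (GG e)
    then have e: "e \<in> E" and u: "u = rng G e" and y': "y = (src G e, Step e l)"
      using g y x' by (auto split: if_splits)
    have "src G e \<notin> H" using H e boundary_notin[OF x'(2)] u by (auto simp: hereditary_def)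
    then show ?thesis using boundary.Step[OF e _ x'(2)[unfolded u]] y' by simp
  qed
qed

lemma act_word_bounds:
  assumes H: "hereditary H"
  shows "x \<in> bounds H \<Longrightarrow> set w \<subseteq> gens G \<Longrightarrow> act_word w x = Some y \<Longrightarrow> y \<in> bounds H"
proof (induction w arbitrary: x)
  case (Cons g w)
  then obtain z where z: "act g x = Some z" "act_word w z = Some y"
    by (auto simp: bind_eq_Some_conv)
  have "z \<in> bounds H" by (rule act_bounds[OF H Cons.prems(1) _ z(1)]) (use Cons.prems in auto)
  then show ?case using Cons.IH z(2) Cons.prems by auto
qed auto

definition coef :: "('v \<times> 'e bpath \<Rightarrow> 'k) \<Rightarrow> 'v \<times> 'e bpath \<Rightarrow> ('v,'e) gen list \<Rightarrow> 'k" where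
  "coef \<phi> x w = (case act_word w x of None \<Rightarrow> 0 | Some y \<Rightarrow> \<phi> y)"

text \<open>A prefix moves the starting path, a suffix changes the functional; the two forms serve
  left and right multiplication.\<close>

lemma coef_append:
  "coef \<phi> x (u @ w) = (case act_word u x of None \<Rightarrow> 0 | Some y \<Rightarrow> coef \<phi> y w)"
  "coef \<phi> x (u @ w) = coef (\<lambda>y. coef \<phi> y w) x u"
  by (auto simp: coef_def act_word_append split: option.splits Option.bind_splits)

text \<open>The annihilator of the right module with basis the boundary paths that avoid
  \<open>H\<close>. Quantifying over all functions on paths expresses that a formal sum of paths is
  zero.\<close>

definition vanishing :: "'v set \<Rightarrow> ('v,'e,'k) fa set" where
  "vanishing H = {f \<in> F. \<forall>\<phi>. \<forall>x\<in>bounds H. eval_lin (coef \<phi> x) f = 0}"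

lemma vanishingD: "f \<in> vanishing H \<Longrightarrow> x \<in> bounds H \<Longrightarrow> eval_lin (coef \<phi> x) f = 0"
  unfolding vanishing_def by blast

lemma subspace_vanishing: "subspace (vanishing H)"
  unfolding subspace_def vanishing_def
  by (auto simp: eval_lin_0 eval_lin_smult fa_set_eq eval_lin_add[where A="words G"]
      intro: supp_on_add supp_on_smult)

lemma vanishing_mono_mult:
  assumes H: "hereditary H" and f: "f \<in> vanishing H" and w: "w \<in> words G"
  shows "\<langle>w\<rangle> \<star> f \<in> vanishing H" "f \<star> \<langle>w\<rangle> \<in> vanishing H"
proof -
  have fF: "f \<in> F" "f \<in> supp_on (words G)" using f by (auto simp: vanishing_def fa_set_eq)
  have wF: "\<langle>w\<rangle> \<in> F" using w by simp
  have "eval_lin (coef \<phi> x) (\<langle>w\<rangle> \<star> f) = 0" if x: "x \<in> bounds H" for \<phi> x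
  proof (cases "act_word w x")
    case None
    then show ?thesis unfolding eval_lin_mult_mono[OF fF(2)] coef_append(1) by (simp add: eval_lin_def)
  next
    case (Some y)
    then have "y \<in> bounds H" using act_word_bounds[OF H x] w by (auto simp: words_iff)
    then show ?thesis unfolding eval_lin_mult_mono[OF fF(2)] coef_append(1)
      using vanishingD[OF f] Some by simp
  qed
  then show "\<langle>w\<rangle> \<star> f \<in> vanishing H"
    using fa_set_mult[OF wF fF(1)] by (simp add: vanishing_def)
  have "eval_lin (coef \<phi> x) (f \<star> \<langle>w\<rangle>) = 0" if x: "x \<in> bounds H" for \<phi> x
    unfolding eval_lin_mult_mono[OF fF(2)] coef_append(2) by (rule vanishingD[OF f x])
  then show "f \<star> \<langle>w\<rangle> \<in> vanishing H"
    using fa_set_mult[OF fF(1) wF] by (simp add: vanishing_def)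
qed

text \<open>The definition of boundary paths enters only through the second Cuntz-Krieger relation:
  at a regular vertex the path has a first edge, which selects exactly one summand.\<close>

lemma lpa_rels_vanishing:
  assumes f: "f \<in> lpa_rels G"
  shows "f \<in> vanishing H"
proof -
  have "eval_lin (coef \<phi> x) f = 0" if xH: "x \<in> bounds H" for \<phi> x
  proof -
    obtain u l where x: "x = (u, l)" "boundary H u l" using xH by auto
    note diff = eval_lin_diff[where A=UNIV]
    have K: "coef \<phi> x = coef \<phi> (u, l)" using x by simp
    have act_GE: "act (GE e) (u, l) = (case l of Stop \<Rightarrow> None
      | Step f l' \<Rightarrow> if f = e \<and> u = src G e then Some (rng G e, l') else None)" for e
      by (cases l) auto
    from f show ?thesis
    proof (cases rule: lpa_rels_cases)
      case (9 v)
      have "eval_lin (coef \<phi> x) f = coef \<phi> x [GV v] - (\<Sum>e\<in>emits v. coef \<phi> x [GE e, GG e])"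
        unfolding 9(4) by (subst diff) (auto simp: eval_lin_mono eval_lin_sum[where A=UNIV] 9 intro: supp_on_sum)
      also have "\<dots> = 0"
      proof (cases "u = v")
        case False
        then have "coef \<phi> x [GE e, GG e] = 0" if "e \<in> emits v" for e
          using that by (auto simp: K coef_def act_GE split: bpath.splits)
        then show ?thesis using False by (simp add: K coef_def)
      next
        case True
        \<comment> \<open>A boundary path cannot stop here because \<open>v\<close> is
          regular.\<close>
        from x(2) obtain g l' where g: "l = Step g l'" "g \<in> emits v"
        proof cases
          case Stop
          then show ?thesis using 9 True by (auto simp: regular_def)
        qed (use True that in auto)
        have "(\<Sum>e\<in>emits v. coef \<phi> x [GE e, GG e]) = (\<Sum>e\<in>emits v. if e = g then \<phi> x else 0)"
          by (rule sum.cong) (use g True x in \<open>auto simp: coef_def act_GE\<close>)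
        then show ?thesis using g 9 True by (simp add: K x coef_def)
      qed
      finally show ?thesis .
    qed (simp_all add: diff eval_lin_mono K coef_def act_GE split: bpath.split)
  qed
  then show ?thesis using lpa_rels_subset f by (auto simp: vanishing_def)
qed

section \<open>Ideals generated by vertices\<close>

definition vertex_ideal :: "'v set \<Rightarrow> ('v,'e,'k) fa set" where
  "vertex_ideal H = gen_ideal G (lpa_rels G \<union> {\<langle>[GV h]\<rangle> | h. h \<in> H})"

lemma is_gideal_vertex_ideal:
  assumes "H \<subseteq> V"
  shows "is_gideal (vertex_ideal H)"
  unfolding vertex_ideal_def
  by (rule is_gideal_gen_ideal) (use assms in \<open>auto simp: words_iff restr_simps\<close>)

lemma vertex_ideal_vertex: "h \<in> H \<Longrightarrow> \<langle>[GV h]\<rangle> \<in> vertex_ideal H"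
  unfolding vertex_ideal_def by (rule gen_ideal.base) auto

lemma vertex_ideal_vanishing:
  assumes H: "hereditary H"
  shows "vertex_ideal H \<subseteq> vanishing H"
proof
  fix f assume "f \<in> vertex_ideal H"
  then show "f \<in> vanishing H" unfolding vertex_ideal_def
  proof (induction rule: gen_ideal.induct)
    case (base x)
    then show ?case
    proof
      assume "x \<in> lpa_rels G" then show ?thesis by (rule lpa_rels_vanishing)
    next
      assume "x \<in> {\<langle>[GV h]\<rangle> | h. h \<in> H}"
      then obtain h where h: "x = \<langle>[GV h]\<rangle>" "h \<in> H" by blast
      have "coef \<phi> y [GV h] = 0" if "y \<in> bounds H" for \<phi> y
        using that h(2) boundary_notin by (auto simp: coef_def)
      then show ?thesis using h H by (auto simp: vanishing_def eval_lin_mono words_iff hereditary_def)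
    qed
  next
    case (lmult a x)
    show ?case
      by (rule supp_on_linear_mem[OF subspace_vanishing, where T="\<lambda>a. a \<star> x", OF lmult(1)[unfolded fa_set_eq]])
        (use vanishing_mono_mult[OF H lmult.IH] in \<open>auto simp: mult_distrib\<close>)
  next
    case (rmult a x)
    show ?case
      by (rule supp_on_linear_mem[OF subspace_vanishing, where T="\<lambda>a. x \<star> a", OF rmult(1)[unfolded fa_set_eq]])
        (use vanishing_mono_mult[OF H rmult.IH] in \<open>auto simp: mult_distrib\<close>)
  qed (use subspaceD[OF subspace_vanishing] in auto)
qed

text \<open>If \<open>v\<close> is outside \<open>H\<close>, some boundary path that avoids
  \<open>H\<close> starts at \<open>v\<close>. The vertex fixes this path and so does not act as
  zero.\<close>

lemma vertex_ideal_iff: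
  assumes H: "hereditary H" "saturated H" and v: "v \<in> V"
  shows "\<langle>[GV v]\<rangle> \<in> vertex_ideal H \<longleftrightarrow> v \<in> H"
proof
  assume "\<langle>[GV v]\<rangle> \<in> vertex_ideal H"
  then have z: "\<langle>[GV v]\<rangle> \<in> vanishing H" using vertex_ideal_vanishing[OF H(1)] by blast
  show "v \<in> H"
  proof (rule ccontr)
    assume "v \<notin> H"
    from boundary_exists[OF H(2) v this] obtain l where "boundary H v l" by blast
    then have "eval_lin (coef (\<lambda>_. 1) (v, l)) \<langle>[GV v]\<rangle> = (0::'k)"
      using z unfolding vanishing_def by blast
    then show False by (simp add: eval_lin_mono coef_def)
  qed
qed (rule vertex_ideal_vertex)

lemma vertex_notin_J: "v \<in> V \<Longrightarrow> \<langle>[GV v]\<rangle> \<notin> J"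
proof -
  have "hereditary {}" "saturated {}" by (auto simp: hereditary_def saturated_def regular_def)
  moreover assume "v \<in> V"
  moreover have "J \<subseteq> vertex_ideal {}"
    using is_gideal_vertex_ideal[of "{}"] by (simp add: is_gideal_def is_ideal_def)
  ultimately show ?thesis using vertex_ideal_iff[of "{}" v] by auto
qed

lemma leak_free_J: "leak_free J"
  using vertex_notin_J edge_verts by (auto simp: leak_free_def)

end

section \<open>Graphs\<close>

context lpa_graph
begin

lemma reaches_refl: "v \<in> V \<Longrightarrow> reaches G v v"
  unfolding reaches_def by (rule exI[of _ "[]"]) simp

lemma reaches_verts: "reaches G u w \<Longrightarrow> u \<in> V" "reaches G u w \<Longrightarrow> w \<in> V"
  unfolding reaches_def using is_path_verts by blast+

lemma reaches_trans: "reaches G u v \<Longrightarrow> reaches G v w \<Longrightarrow> reaches G u w"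
  unfolding reaches_def by (metis is_path_append path_end_simps(3))

lemma reaches_edge: "e \<in> E \<Longrightarrow> reaches G (src G e) (rng G e)"
  unfolding reaches_def by (rule exI[of _ "[e]"]) simp

lemma reaches_cases:
  assumes "reaches G u w"
  obtains "u = w" | e where "e \<in> emits u" "reaches G (rng G e) w"
proof -
  obtain p where p: "is_path G u p" "path_end G u p = w" using assms by (auto simp: reaches_def)
  then show thesis
  proof (cases p)
    case (Cons e p')
    then show thesis using p that(2)[of e] by (auto simp: reaches_def)
  qed (use p that in simp)
qed

lemma reaches_induct [consumes 1, case_names refl step]:
  assumes "reaches G u w" "u \<in> V \<Longrightarrow> Q u"
    and "\<And>e. e \<in> E \<Longrightarrow> Q (src G e) \<Longrightarrow> Q (rng G e)"
  shows "Q w"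
proof -
  have "is_path G u p \<Longrightarrow> Q u \<Longrightarrow> Q (path_end G u p)" for p
    using assms(3) by (induction p arbitrary: u) auto
  then show ?thesis using assms(1,2) reaches_verts(1)[OF assms(1)] by (auto simp: reaches_def)
qed

lemma hereditary_reaches: "hereditary H \<Longrightarrow> reaches G u w \<Longrightarrow> u \<in> H \<Longrightarrow> w \<in> H"
  by (erule reaches_induct) (auto simp: hereditary_def)

text \<open>A shortest closed path through the source of \<open>e\<close> is a cycle.\<close>

lemma closed_path_cycle:
  assumes "e \<in> E" "reaches G (rng G e) (src G e)"
  shows "\<exists>c. is_cycle G c \<and> src G e \<in> cycle_verts G c"
proof -
  let ?u = "src G e"
  define Q where "Q = (\<lambda>n. \<exists>p. p \<noteq> [] \<and> is_path G ?u p \<and> path_end G ?u p = ?u \<and> length p = n)"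
  obtain p where "is_path G (rng G e) p" "path_end G (rng G e) p = ?u"
    using assms(2) by (auto simp: reaches_def)
  then have "Q (length (e # p))" unfolding Q_def using assms(1) by (intro exI[of _ "e # p"]) auto
  then have "Q (LEAST n. Q n)" by (rule LeastI)
  then obtain c where c: "c \<noteq> []" "is_path G ?u c" "path_end G ?u c = ?u" "length c = (LEAST n. Q n)"
    unfolding Q_def by blast
  have "distinct (map (src G) c)"
  proof (rule ccontr)
    assume "\<not> distinct (map (src G) c)"
    then obtain xs ys zs y where "map (src G) c = xs @ [y] @ ys @ [y] @ zs"
      using not_distinct_decomp by blast
    then obtain a f b g d where d: "c = a @ f # b @ g # d" "src G f = src G g"
      by (auto simp: map_eq_append_conv append_eq_map_conv Cons_eq_map_conv)
    \<comment> \<open>Cutting out the segment between two edges with the same source leaves a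
      shorter closed path at the same vertex.\<close>
    have "Q (length (a @ g # d))"
      unfolding Q_def using c(2,3) d by (intro exI[of _ "a @ g # d"]) auto
    then have "(LEAST n. Q n) \<le> length (a @ g # d)" by (rule Least_le)
    then show False using c(4) d(1) by simp
  qed
  moreover have hd: "src G (hd c) = ?u" using c by (cases c) auto
  moreover have "rng G (last c) = ?u" using c by (auto simp: path_end_def)
  ultimately have "is_cycle G c" using c by (simp add: is_cycle_def)
  moreover have "?u \<in> cycle_verts G c" unfolding cycle_verts_def hd[symmetric] using c(1) by simp
  ultimately show ?thesis by blast
qed

lemma cycle_split:
  assumes "is_cycle G c" "v \<in> cycle_verts G c"
  obtains a e b where "c = a @ e # b" "src G e = v" "e \<in> E" "is_path G (src G (hd c)) a"
    "path_end G (src G (hd c)) a = v" "is_path G (rng G e) b" "path_end G (rng G e) b = src G (hd c)"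
proof -
  obtain e where e: "e \<in> set c" "src G e = v" using assms(2) by (auto simp: cycle_verts_def)
  obtain a b where c: "c = a @ e # b" using e(1) by (auto simp: in_set_conv_decomp)
  define h where "h = src G (hd c)"
  have "is_path G h c" "path_end G h c = h"
    using assms(1) by (auto simp: is_cycle_def path_end_def h_def)
  then have p: "is_path G h (a @ e # b)" "path_end G h (a @ e # b) = h"
    unfolding c[symmetric] by auto
  show thesis
    by (rule that[OF c e(2)]) (use p e in \<open>auto simp: h_def[symmetric]\<close>)
qed

lemma cycle_reaches:
  assumes c: "is_cycle G c" and u: "u \<in> cycle_verts G c" and v: "v \<in> cycle_verts G c"
  shows "reaches G u v"
proof -
  let ?h = "src G (hd c)"
  have "reaches G ?h w" "reaches G w ?h" if w: "w \<in> cycle_verts G c" for w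
  proof -
    from cycle_split[OF c w] obtain a e b where
      "c = a @ e # b" "src G e = w" "e \<in> E" "is_path G ?h a" "path_end G ?h a = w"
      "is_path G (rng G e) b" "path_end G (rng G e) b = ?h" .
    note p = this
    show "reaches G ?h w" using p by (auto simp: reaches_def)
    have "is_path G w (e # b)" "path_end G w (e # b) = ?h" using p by auto
    then show "reaches G w ?h" unfolding reaches_def by blast
  qed
  then show ?thesis using u v reaches_trans by blast
qed

lemma cycle_next:
  assumes c: "is_cycle G c" and e: "e \<in> set c"
  shows "rng G e \<in> cycle_verts G c"
proof -
  obtain a b where ab: "c = a @ e # b" using e by (auto simp: in_set_conv_decomp)
  show ?thesis
  proof (cases b)
    case Nil
    then have "rng G e = src G (hd c)" using c ab by (simp add: is_cycle_def)
    moreover have "hd c \<in> set c" using e by (intro hd_in_set) auto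
    ultimately show ?thesis by (simp add: cycle_verts_def)
  next
    case (Cons f b')
    have "is_path G (src G (hd c)) c" using c by (simp add: is_cycle_def)
    then have "rng G e = src G f" unfolding ab Cons by auto
    then show ?thesis using ab Cons by (auto simp: cycle_verts_def)
  qed
qed

lemma cycle_edges: "is_cycle G c \<Longrightarrow> set c \<subseteq> E"
  using is_path_edges by (auto simp: is_cycle_def)

section \<open>Return to cycles and inescapable vertices\<close>

definition cycle_condition :: bool where
  "cycle_condition \<longleftrightarrow> (\<forall>c. is_cycle G c \<longrightarrow> \<not> has_exit G c \<or> is_extreme G c)"

text \<open>The form in which the cycle condition is used. Without exits a path never leaves the
  cycle, and from an extreme cycle it can always come back.\<close>

lemma cycle_condition_return:
  assumes cc: "cycle_condition" and c: "is_cycle G c" and v: "v \<in> cycle_verts G c" and r: "reaches G v w"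
  shows "reaches G w v"
proof (cases "has_exit G c")
  case False
  from r have "w \<in> cycle_verts G c"
  proof (induction rule: reaches_induct)
    case (step e)
    then have "e \<in> set c" using False by (auto simp: has_exit_def is_exit_def)
    then show ?case using cycle_next[OF c] by blast
  qed (rule v)
  then show ?thesis using cycle_reaches[OF c] v by blast
next
  case True
  then have "is_extreme G c" using cc c by (auto simp: cycle_condition_def)
  moreover obtain p where "is_path G v p" "path_end G v p = w" using r by (auto simp: reaches_def)
  ultimately obtain q where "is_path G w q" "path_end G w q \<in> cycle_verts G c"
    using v by (auto simp: is_extreme_def)
  then have "reaches G w (path_end G w q)" "reaches G (path_end G w q) v"
    using cycle_reaches[OF c _ v] by (auto simp: reaches_def)
  then show ?thesis by (rule reaches_trans)
qed

definition inescapable :: "'v set \<Rightarrow> 'v \<Rightarrow> bool" where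
  "inescapable H v \<longleftrightarrow> v \<in> V \<and> (\<forall>w. reaches G v w \<longrightarrow> (\<exists>h\<in>H. reaches G w h))"

definition dense_closed :: bool where
  "dense_closed \<longleftrightarrow> (\<forall>H. hereditary H \<longrightarrow> saturated H \<longrightarrow> (\<forall>v. inescapable H v \<longrightarrow> v \<in> H))"

lemma inescapable_reaches: "inescapable H v \<Longrightarrow> reaches G v w \<Longrightarrow> inescapable H w"
  unfolding inescapable_def using reaches_trans reaches_verts by blast

text \<open>The emitter lies on a cycle, so the range of each of its edges leads back to it. If that
  range were in \<open>H\<close>, heredity would put the emitter there as well.\<close>

lemma graph_condition_no_leak:
  assumes gc: "graph_condition G" and H: "hereditary H" and v: "infinite (emits v)" "v \<in> V" "v \<notin> H"
    and e: "e \<in> emits v"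
  shows "rng G e \<notin> H"
proof
  assume eH: "rng G e \<in> H"
  have cc: cycle_condition using gc by (auto simp: cycle_condition_def graph_condition_def)
  obtain c where c: "is_cycle G c" "v \<in> cycle_verts G c"
    using gc v by (auto simp: graph_condition_def infinite_emitter_def)
  have "reaches G v (rng G e)" using reaches_edge[of e] e by auto
  then have "reaches G (rng G e) v" by (rule cycle_condition_return[OF cc c])
  then show False using hereditary_reaches[OF H] eH v by blast
qed

text \<open>If v were outside H, following edges that avoid H and approach H whenever they can
  gives an infinite path that emits infinitely many edges into H.\<close>

lemma graph_condition_dense_closed:
  assumes gc: "graph_condition G"
  shows "dense_closed"
  unfolding dense_closed_def
proof (intro allI impI)
  fix H v0 assume H: "hereditary H" "saturated H" and v0: "inescapable H v0"
  have cc: cycle_condition using gc by (auto simp: cycle_condition_def graph_condition_def)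
  show "v0 \<in> H"
  proof (rule ccontr)
    assume v0H: "v0 \<notin> H"
    define B where "B = {u. inescapable H u \<and> u \<notin> H}"
    have Bedge: "rng G e \<in> B" if "u \<in> B" "e \<in> emits u" "rng G e \<notin> H" for u e
      using that inescapable_reaches[of H u "rng G e"] reaches_edge[of e] by (auto simp: B_def)
    have BH: "\<exists>h\<in>H. reaches G u h" if "u \<in> B" for u
      using that reaches_refl[of u] by (auto simp: B_def inescapable_def)
    \<comment> \<open>From a vertex on a cycle one reaches \<open>H\<close> and can return, so
      heredity would put the vertex into \<open>H\<close>.\<close>
    have Bcyc: False if u: "u \<in> B" and c: "is_cycle G c" "u \<in> cycle_verts G c" for u c
    proof -
      obtain h where "h \<in> H" "reaches G u h" using BH[OF u] by blast
      then have "reaches G h u" using cycle_condition_return[OF cc c] by blast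
      then have "u \<in> H" using hereditary_reaches[OF H(1)] \<open>h \<in> H\<close> by blast
      then show False using u by (simp add: B_def)
    qed
    \<comment> \<open>Vertices of \<open>B\<close> are regular: infinite emitters lie on cycles, and
      a sink outside \<open>H\<close> cannot reach \<open>H\<close>. Saturation then provides the
      edge.\<close>
    have Breg: "\<exists>e\<in>emits u. rng G e \<in> B" if u: "u \<in> B" for u
    proof -
      have uV: "u \<in> V" "u \<notin> H" using u by (auto simp: B_def inescapable_def)
      have "finite (emits u)"
      proof (rule ccontr)
        assume "infinite (emits u)"
        then obtain c where "is_cycle G c" "u \<in> cycle_verts G c"
          using gc uV by (auto simp: graph_condition_def infinite_emitter_def)
        then show False using Bcyc[OF u] by blast
      qed
      moreover have "emits u \<noteq> {}"
      proof -
        obtain h where h: "h \<in> H" "reaches G u h" using BH[OF u] by blast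
        from h(2) show ?thesis by (cases rule: reaches_cases) (use uV h in auto)
      qed
      ultimately have "regular u" using uV by (simp add: regular_def)
      then obtain e where "e \<in> emits u" "rng G e \<notin> H" using H(2) uV by (auto simp: saturated_def)
      then show ?thesis using Bedge[OF u] by blast
    qed
    \<comment> \<open>The number \<open>d u\<close> is the distance from \<open>u\<close> to
      \<open>H\<close>; it controls how long the path can go without an edge into
      \<open>H\<close>.\<close>
    define dst where "dst = (\<lambda>u n. \<exists>p. is_path G u p \<and> path_end G u p \<in> H \<and> length p = n)"
    define d where "d = (\<lambda>u. LEAST n. dst u n)"
    \<comment> \<open>If \<open>u\<close> emits an edge into \<open>H\<close>, any edge that stays
      in \<open>B\<close> will do. Otherwise take the first edge of a shortest path to
      \<open>H\<close>, which stays in \<open>B\<close> and lowers the distance.\<close>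
    have "\<exists>e\<in>emits u. rng G e \<in> B \<and> ((\<exists>f\<in>emits u. rng G f \<in> H) \<or> d (rng G e) < d u)" if u: "u \<in> B" for u
    proof (cases "\<exists>f\<in>emits u. rng G f \<in> H")
      case True
      then show ?thesis using Breg[OF u] by blast
    next
      case False
      obtain h where h: "h \<in> H" "reaches G u h" using BH[OF u] by blast
      then obtain p0 where "is_path G u p0" "path_end G u p0 = h" by (auto simp: reaches_def)
      then have "dst u (length p0)" unfolding dst_def using h by blast
      then have "dst u (d u)" unfolding d_def by (rule LeastI)
      then obtain p where p: "is_path G u p" "path_end G u p \<in> H" "length p = d u"
        unfolding dst_def by blast
      have "p \<noteq> []" using p(2) u by (auto simp: B_def)
      then obtain e p' where e: "p = e # p'" by (cases p) auto
      have "dst (rng G e) (length p')" unfolding dst_def using p e by auto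
      then have "d (rng G e) \<le> length p'" unfolding d_def by (rule Least_le)
      then have "d (rng G e) < d u" using p(3) e by simp
      moreover have "e \<in> emits u" using p e by auto
      ultimately show ?thesis using False Bedge[OF u] by blast
    qed
    then have "\<forall>u\<in>B. \<exists>e. e \<in> emits u \<and> rng G e \<in> B \<and>
        ((\<exists>f\<in>emits u. rng G f \<in> H) \<or> d (rng G e) < d u)"
      unfolding Bex_def by (intro ballI)
    from bchoice[OF this] obtain nxt where "\<forall>u\<in>B. nxt u \<in> emits u \<and> rng G (nxt u) \<in> B \<and>
        ((\<exists>f\<in>emits u. rng G f \<in> H) \<or> d (rng G (nxt u)) < d u)"
      by (elim exE)
    note nxt = bspec[OF this]
    define x where "x = rec_nat v0 (\<lambda>_ u. rng G (nxt u))"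
    have x0: "x 0 = v0" and xS: "x (Suc n) = rng G (nxt (x n))" for n by (simp_all add: x_def)
    have xB: "x n \<in> B" for n
    proof (induction n)
      case 0 show ?case using v0 v0H by (simp add: x0 B_def)
    next
      case (Suc n) then show ?case using nxt by (simp add: xS)
    qed
    define \<alpha> where "\<alpha> = (\<lambda>n. nxt (x n))"
    have \<alpha>: "\<alpha> n \<in> E" "src G (\<alpha> n) = x n" "rng G (\<alpha> n) = x (Suc n)" for n
      using nxt[OF xB[of n]] by (auto simp: \<alpha>_def xS)
    have "inf_path G \<alpha>" using \<alpha> by (simp add: inf_path_def)
    moreover have "inf_path_verts G \<alpha> = range x" using \<alpha> by (simp add: inf_path_verts_def)
    ultimately have fin: "finite {e \<in> E. src G e \<in> range x \<and> rng G e \<notin> tree_of G (range x)}"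
      using gc unfolding graph_condition_def by metis
    have xreach: "reaches G (x i) (x (i + k))" for i k
    proof (induction k)
      case 0
      have "x i \<in> V" using edge_verts(1)[OF \<alpha>(1), of i] \<alpha>(2)[of i] by simp
      then show ?case by (simp add: reaches_refl)
    next
      case (Suc k)
      have "reaches G (x (i + k)) (x (i + Suc k))" using reaches_edge[OF \<alpha>(1)[of "i + k"]] \<alpha> by simp
      with Suc show ?case by (rule reaches_trans)
    qed
    \<comment> \<open>A repeated vertex would lie on a cycle, which \<open>Bcyc\<close> forbids.
      Distinct vertices make the edges chosen below distinct.\<close>
    have xinj: "x i \<noteq> x j" if "i < j" for i j
    proof
      assume eq: "x i = x j"
      obtain k where "j = Suc i + k" using \<open>i < j\<close> less_iff_Suc_add by auto
      then have "reaches G (rng G (\<alpha> i)) (src G (\<alpha> i))"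
        using xreach[of "Suc i" k] eq \<alpha> by simp
      from closed_path_cycle[OF \<alpha>(1) this] show False using Bcyc[OF xB] \<alpha>(2) by auto
    qed
    then have inj: "inj x" unfolding inj_def by (metis linorder_neqE_nat)
    define N where "N = {n. \<exists>f\<in>emits (x n). rng G f \<in> H}"
    \<comment> \<open>Otherwise the distance to \<open>H\<close> would drop at every step from
      \<open>n\<close> on.\<close>
    have "\<exists>m\<ge>n. m \<in> N" for n
    proof (rule ccontr)
      assume "\<not> (\<exists>m\<ge>n. m \<in> N)"
      then have dec: "d (x (Suc m)) < d (x m)" if "m \<ge> n" for m
        using nxt[OF xB[of m]] that by (auto simp: N_def xS)
      have "d (x (n + k)) + k \<le> d (x n)" for k
      proof (induction k)
        case (Suc k)
        then show ?case using dec[of "n + k"] by simp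
      qed simp
      from this[of "Suc (d (x n))"] show False by simp
    qed
    then have Ninf: "infinite N" unfolding finite_nat_set_iff_bounded by (meson not_le)
    have "\<forall>n\<in>N. \<exists>f. f \<in> emits (x n) \<and> rng G f \<in> H" by (auto simp: N_def)
    from bchoice[OF this] obtain g where "\<forall>n\<in>N. g n \<in> emits (x n) \<and> rng G (g n) \<in> H"
      by (elim exE)
    note g = bspec[OF this]
    have "inj_on g N"
    proof (rule inj_onI)
      fix a b assume "a \<in> N" "b \<in> N" "g a = g b"
      then have "x a = x b" using g[of a] g[of b] by auto
      then show "a = b" using inj by (simp add: inj_eq)
    qed
    then have "infinite (g ` N)" using Ninf finite_image_iff by blast
    moreover have "g ` N \<subseteq> {e \<in> E. src G e \<in> range x \<and> rng G e \<notin> tree_of G (range x)}"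
    proof
      fix e assume "e \<in> g ` N"
      then obtain n where n: "e \<in> E" "src G e = x n" "rng G e \<in> H" using g by auto
      have "rng G e \<notin> tree_of G (range x)"
      proof
        assume "rng G e \<in> tree_of G (range x)"
        then obtain m where "reaches G (rng G e) (x m)" by (auto simp: tree_of_def)
        then have "x m \<in> H" using hereditary_reaches[OF H(1)] n by blast
        then show False using xB[of m] by (simp add: B_def)
      qed
      then show "e \<in> {e \<in> E. src G e \<in> range x \<and> rng G e \<notin> tree_of G (range x)}" using n by auto
    qed
    ultimately show False using fin finite_subset by blast
  qed
qed

section \<open>From inescapable vertices back to the graph condition\<close>

inductive_set sat_closure :: "'v set \<Rightarrow> 'v set" for T where
  base: "t \<in> T \<Longrightarrow> t \<in> sat_closure T"
| sat: "regular v \<Longrightarrow> (\<And>e. e \<in> emits v \<Longrightarrow> rng G e \<in> sat_closure T) \<Longrightarrow> v \<in> sat_closure T"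

text \<open>Saturating \<open>T\<close> never absorbs a vertex of \<open>W\<close>, because a
  regular vertex of \<open>W\<close> keeps an edge inside \<open>W\<close>; yet \<open>v\<close>
  would have to be absorbed. The three applications take for \<open>W\<close> a cycle, an infinite
  emitter and an infinite path.\<close>

lemma dense_closed_trap:
  assumes dc: dense_closed and T: "hereditary T"
    and W: "W \<inter> T = {}" "\<And>w. w \<in> W \<Longrightarrow> \<not> regular w \<or> (\<exists>e\<in>emits w. rng G e \<in> W)"
    and v: "v \<in> W" "inescapable T v"
  shows False
proof -
  let ?H = "sat_closure T"
  have "?H \<subseteq> V"
  proof
    fix u assume "u \<in> ?H" then show "u \<in> V"
      using T by induction (auto simp: hereditary_def regular_def)
  qed
  moreover have "rng G e \<in> ?H" if "e \<in> E" "src G e \<in> ?H" for e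
    using that(2) by cases (use T that(1) sat_closure.base in \<open>auto simp: hereditary_def\<close>)
  ultimately have H: "hereditary ?H" by (simp add: hereditary_def)
  have "saturated ?H" unfolding saturated_def using sat_closure.sat by blast
  moreover have "inescapable ?H v"
    using v(2) sat_closure.base unfolding inescapable_def by blast
  ultimately have "v \<in> ?H" using dc H by (simp add: dense_closed_def)
  moreover have "u \<notin> W" if "u \<in> ?H" for u
    using that
  proof induction
    case (base t) then show ?case using W(1) by blast
  next
    case (sat u) then show ?case using W(2) by blast
  qed
  ultimately show False using v(1) by blast
qed

text \<open>The trap \<open>T\<close> consists of the descendants of the cycle that cannot return.
  It contains the end of the offending path, and every vertex that can return reaches that end
  through the cycle.\<close>

lemma dense_closed_cycle_condition:
  assumes dc: dense_closed
  shows cycle_condition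
  unfolding cycle_condition_def
proof (intro allI impI, rule ccontr)
  fix c assume c: "is_cycle G c" and "\<not> (\<not> has_exit G c \<or> is_extreme G c)"
  then obtain v p where p: "is_path G v p" "v \<in> cycle_verts G c"
    "\<not> (\<exists>q. is_path G (path_end G v p) q \<and> path_end G (path_end G v p) q \<in> cycle_verts G c)"
    unfolding is_extreme_def by blast
  let ?C = "cycle_verts G c" and ?z = "path_end G v p"
  define T where "T = {t. (\<exists>a\<in>?C. reaches G a t) \<and> \<not> (\<exists>a\<in>?C. reaches G t a)}"
  have z: "reaches G v ?z" using p by (auto simp: reaches_def)
  have zT: "?z \<in> T" using p(2,3) z unfolding T_def by (auto simp: reaches_def)
  have CV: "?C \<subseteq> V" using cycle_edges[OF c] by (auto simp: cycle_verts_def)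
  show False
  proof (rule dense_closed_trap[OF dc, of T ?C v])
    show "hereditary T" unfolding hereditary_def T_def
      using reaches_verts(2) reaches_trans reaches_edge by blast
    show "?C \<inter> T = {}" using CV reaches_refl by (auto simp: T_def)
    show "\<not> regular w \<or> (\<exists>e\<in>emits w. rng G e \<in> ?C)" if "w \<in> ?C" for w
      using that cycle_next[OF c] cycle_edges[OF c] unfolding cycle_verts_def[of _ c] by auto
    show "v \<in> ?C" by (rule p(2))
    show "inescapable T v" unfolding inescapable_def
    proof (intro conjI allI impI)
      show "v \<in> V" using p(2) CV by blast
      fix w assume w: "reaches G v w"
      show "\<exists>h\<in>T. reaches G w h"
      proof (cases "\<exists>a\<in>?C. reaches G w a")
        case True
        then obtain a where "a \<in> ?C" "reaches G w a" by blast
        then have "reaches G w ?z" using cycle_reaches[OF c _ p(2)] z reaches_trans by blast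
        then show ?thesis using zT by blast
      next
        case False
        then have "w \<in> T" using w p(2) by (auto simp: T_def)
        then show ?thesis using reaches_refl reaches_verts(2)[OF w] by blast
      qed
    qed
  qed
qed

text \<open>Saturation never adds an infinite emitter. Here \<open>T\<close> collects what its edges
  lead to, and it misses \<open>v\<close> exactly because \<open>v\<close> lies on no cycle.\<close>

lemma dense_closed_infinite_emitter:
  assumes dc: dense_closed and v: "infinite_emitter G v"
  shows "\<exists>c. is_cycle G c \<and> v \<in> cycle_verts G c"
proof (rule ccontr)
  assume nc: "\<not> (\<exists>c. is_cycle G c \<and> v \<in> cycle_verts G c)"
  have vV: "v \<in> V" "infinite (emits v)" using v by (auto simp: infinite_emitter_def)
  define T where "T = {t. \<exists>e\<in>emits v. reaches G (rng G e) t}"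
  show False
  proof (rule dense_closed_trap[OF dc, of T "{v}" v])
    show "hereditary T" unfolding hereditary_def T_def
      using reaches_verts(2) reaches_trans reaches_edge by blast
    show "{v} \<inter> T = {}" using nc closed_path_cycle by (auto simp: T_def)
    show "\<not> regular w \<or> (\<exists>e\<in>emits w. rng G e \<in> {v})" if "w \<in> {v}" for w
      using that vV by (simp add: regular_def)
    show "inescapable T v" unfolding inescapable_def
    proof (intro conjI allI impI vV(1))
      fix w assume w: "reaches G v w"
      then show "\<exists>h\<in>T. reaches G w h"
      proof (cases rule: reaches_cases)
        case 1
        obtain e where "e \<in> emits v" using vV(2) by (metis ex_in_conv finite.emptyI)
        then show ?thesis using 1 reaches_edge[of e] reaches_refl[of "rng G e"]
          by (intro bexI[of _ "rng G e"]) (auto simp: T_def)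
      next
        case (2 e)
        then have "w \<in> T" by (auto simp: T_def)
        then show ?thesis using reaches_refl reaches_verts(2)[OF w] by blast
      qed
    qed
  qed simp
qed

text \<open>If infinitely many edges left the path without return, they would leave from arbitrarily
  late vertices. Then every vertex that reaches the path could still move along it and
  leave.\<close>

lemma dense_closed_inf_path:
  assumes dc: dense_closed and \<alpha>: "inf_path G \<alpha>"
  shows "finite {e \<in> E. src G e \<in> inf_path_verts G \<alpha> \<and> rng G e \<notin> tree_of G (inf_path_verts G \<alpha>)}"
proof (rule ccontr)
  define x where "x = (\<lambda>n. src G (\<alpha> n))"
  let ?A = "range x"
  define S where "S = {e \<in> E. src G e \<in> ?A \<and> rng G e \<notin> tree_of G ?A}"
  assume "infinite {e \<in> E. src G e \<in> inf_path_verts G \<alpha> \<and> rng G e \<notin> tree_of G (inf_path_verts G \<alpha>)}"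
  then have S: "infinite S" by (simp add: S_def inf_path_verts_def x_def)
  have \<alpha>E: "\<alpha> n \<in> E" "src G (\<alpha> n) = x n" "rng G (\<alpha> n) = x (Suc n)" for n
    using \<alpha> by (auto simp: inf_path_def x_def)
  have xV: "x n \<in> V" for n using edge_verts(1)[OF \<alpha>E(1)] \<alpha>E(2) by metis
  have xreach: "reaches G (x i) (x (i + k))" for i k
  proof (induction k)
    case 0 show ?case using xV by (simp add: reaches_refl)
  next
    case (Suc k)
    have "reaches G (x (i + k)) (x (i + Suc k))" using reaches_edge[OF \<alpha>E(1)[of "i + k"]] \<alpha>E by simp
    with Suc show ?case by (rule reaches_trans)
  qed
  \<comment> \<open>By the previous lemmas an infinite emitter lies on a cycle and all its edges
    lead back to it, so none of them belongs to \<open>S\<close>.\<close>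
  have fin: "finite {e \<in> S. src G e = u}" for u
  proof (cases "\<exists>e\<in>S. src G e = u")
    case False
    then have "{e \<in> S. src G e = u} = {}" by blast
    then show ?thesis by (simp only: finite.emptyI)
  next
    case True
    then obtain e where e: "e \<in> S" "src G e = u" by blast
    then have u: "u \<in> ?A" "e \<in> E" "rng G e \<notin> tree_of G ?A" by (auto simp: S_def)
    have "\<not> infinite (emits u)"
    proof
      assume "infinite (emits u)"
      then have "infinite_emitter G u" using u e(2) edge_verts(1)[OF u(2)] by (simp add: infinite_emitter_def)
      from dense_closed_infinite_emitter[OF dc this] obtain c where
        c: "is_cycle G c" "u \<in> cycle_verts G c" by blast
      have "reaches G u (rng G e)" using reaches_edge[OF u(2)] e(2) by simp
      then have "reaches G (rng G e) u"
        by (rule cycle_condition_return[OF dense_closed_cycle_condition[OF dc] c])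
      then have "rng G e \<in> tree_of G ?A" using u(1,2) by (auto simp: tree_of_def)
      then show False using u(3) by blast
    qed
    then show ?thesis using finite_subset[of "{e \<in> S. src G e = u}" "emits u"] by (auto simp: S_def)
  qed
  \<comment> \<open>The first \<open>n\<close> vertices account for finitely many edges of
    \<open>S\<close> only.\<close>
  have late: "\<exists>m\<ge>n. \<exists>e\<in>S. src G e = x m" for n
  proof (rule ccontr)
    assume a: "\<not> (\<exists>m\<ge>n. \<exists>e\<in>S. src G e = x m)"
    have "S \<subseteq> (\<Union>i<n. {e \<in> S. src G e = x i})"
    proof
      fix e assume e: "e \<in> S"
      then obtain i where i: "src G e = x i" by (auto simp: S_def)
      then have "i < n" using a e by (meson not_le)
      then show "e \<in> (\<Union>i<n. {e \<in> S. src G e = x i})" using e i by blast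
    qed
    moreover have "finite (\<Union>i<n. {e \<in> S. src G e = x i})" using fin by blast
    ultimately show False using S finite_subset by blast
  qed
  define T where "T = {t. (\<exists>a\<in>?A. reaches G a t) \<and> \<not> (\<exists>a\<in>?A. reaches G t a)}"
  show False
  proof (rule dense_closed_trap[OF dc, of T ?A "x 0"])
    show "hereditary T" unfolding hereditary_def T_def
      using reaches_verts(2) reaches_trans reaches_edge by blast
    show "?A \<inter> T = {}" using xV reaches_refl by (auto simp: T_def)
    show "\<not> regular w \<or> (\<exists>e\<in>emits w. rng G e \<in> ?A)" if "w \<in> ?A" for w
    proof -
      obtain n where "w = x n" using \<open>w \<in> ?A\<close> by blast
      then have "\<alpha> n \<in> emits w" "rng G (\<alpha> n) \<in> ?A" using \<alpha>E by auto
      then show ?thesis by blast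
    qed
    show "inescapable T (x 0)" unfolding inescapable_def
    proof (intro conjI allI impI xV)
      fix w assume w: "reaches G (x 0) w"
      show "\<exists>h\<in>T. reaches G w h"
      proof (cases "\<exists>a\<in>?A. reaches G w a")
        case False
        then have "w \<in> T" using w by (auto simp: T_def)
        then show ?thesis using reaches_refl reaches_verts(2)[OF w] by blast
      next
        case True
        then obtain n where n: "reaches G w (x n)" by blast
        \<comment> \<open>Continue along the path from \<open>x n\<close> to a later vertex that
          emits an edge of \<open>S\<close>.\<close>
        obtain m e where m: "m \<ge> n" "e \<in> S" "src G e = x m" using late by blast
        have e: "e \<in> E" "rng G e \<notin> tree_of G ?A" using m by (auto simp: S_def)
        have me: "reaches G (x m) (rng G e)" using reaches_edge[OF e(1)] m by simp
        have "reaches G (x n) (x m)" using xreach[of n "m - n"] m(1) by simp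
        then have "reaches G w (rng G e)" using n me reaches_trans by blast
        moreover have "rng G e \<in> T" using me e by (auto simp: T_def tree_of_def)
        ultimately show ?thesis by blast
      qed
    qed
  qed simp
qed

theorem graph_condition_iff_dense_closed: "graph_condition G \<longleftrightarrow> dense_closed"
proof
  assume dc: dense_closed
  show "graph_condition G" unfolding graph_condition_def
    using dense_closed_cycle_condition[OF dc] dense_closed_infinite_emitter[OF dc]
      dense_closed_inf_path[OF dc] by (auto simp: cycle_condition_def)
qed (rule graph_condition_dense_closed)

end

section \<open>Annihilators of graded ideals\<close>

context lpa_graph
begin

definition ann :: "('v,'e,'k) fa set \<Rightarrow> ('v,'e,'k) fa set" where
  "ann P = {a \<in> F. \<forall>x\<in>P. a \<star> x \<in> J \<and> x \<star> a \<in> J}"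

lemma annI: "a \<in> F \<Longrightarrow> (\<And>x z. x \<in> P \<Longrightarrow> z = a \<star> x \<or> z = x \<star> a \<Longrightarrow> z \<in> J) \<Longrightarrow> a \<in> ann P"
  unfolding ann_def by blast

lemma F_assoc: "f \<in> F \<Longrightarrow> g \<in> F \<Longrightarrow> h \<in> F \<Longrightarrow> (f \<star> g) \<star> h = f \<star> (g \<star> h)"
  unfolding fa_set_eq by (rule mult_assoc)

lemma is_ideal_ann:
  assumes P: "is_ideal P"
  shows "is_ideal (ann P)"
  unfolding is_ideal_def
proof (intro conjI ballI)
  note PF = is_idealD(2)[OF P, THEN subsetD]
  show "J \<subseteq> ann P"
  proof
    fix a assume a: "a \<in> J"
    then show "a \<in> ann P"
      using J_F is_idealD(4,5)[OF is_ideal_J _ a] PF by (auto simp: ann_def)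
  qed
  show "ann P \<subseteq> F" by (auto simp: ann_def)
  show "subspace (ann P)"
    unfolding subspace_def ann_def
    by (auto simp: mult_distrib intro: subspaceD[OF subspace_J] subspaceD[OF subspace_F])
  fix b a assume b: "b \<in> F" and a: "a \<in> ann P"
  then have aF: "a \<in> F" and aP: "\<And>x. x \<in> P \<Longrightarrow> a \<star> x \<in> J" "\<And>x. x \<in> P \<Longrightarrow> x \<star> a \<in> J"
    by (auto simp: ann_def)
  have "(b \<star> a) \<star> x \<in> J" "x \<star> (b \<star> a) \<in> J" "(a \<star> b) \<star> x \<in> J" "x \<star> (a \<star> b) \<in> J" if x: "x \<in> P" for x
  proof -
    note xF = PF[OF x]
    show "(b \<star> a) \<star> x \<in> J"
      unfolding F_assoc[OF b aF xF] by (rule is_idealD(4)[OF is_ideal_J b aP(1)[OF x]])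
    show "x \<star> (b \<star> a) \<in> J"
      unfolding F_assoc[OF xF b aF, symmetric] by (rule aP(2)[OF is_idealD(5)[OF P b x]])
    show "(a \<star> b) \<star> x \<in> J"
      unfolding F_assoc[OF aF b xF] by (rule aP(1)[OF is_idealD(4)[OF P b x]])
    show "x \<star> (a \<star> b) \<in> J"
      unfolding F_assoc[OF xF aF b, symmetric] by (rule is_idealD(5)[OF is_ideal_J b aP(2)[OF x]])
  qed
  then show "b \<star> a \<in> ann P" "a \<star> b \<in> ann P"
    using b aF fa_set_mult by (auto simp: ann_def)
qed

lemma ann_ann_superset: "P \<subseteq> F \<Longrightarrow> P \<subseteq> ann (ann P)"
  by (auto simp: ann_def)

lemma ghost_comb_start:
  assumes f: "f \<in> supp_on (ghost_words w)"
  shows "\<langle>[GV w]\<rangle> \<star> f - f \<in> J"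
proof (rule supp_on_linear_mem[OF subspace_J f, where T="\<lambda>f. \<langle>[GV w]\<rangle> \<star> f - f"])
  fix x assume "x \<in> ghost_words w"
  then show "\<langle>[GV w]\<rangle> \<star> \<langle>x\<rangle> - \<langle>x\<rangle> \<in> J"
    using ghost_path_start by (auto simp: mono_mult_mono wcong_def ghost_words_def)
next
  fix c f show "\<langle>[GV w]\<rangle> \<star> c \<cdot> f - c \<cdot> f = c \<cdot> (\<langle>[GV w]\<rangle> \<star> f - f)"
    unfolding mult_distrib smult_simps ..
qed (simp add: mult_distrib)

text \<open>The start vertex of a ghost path is the last letter of its word, so right multiplication
  by \<open>u\<close> keeps the ghost paths starting at \<open>u\<close> and kills the
  others.\<close>

lemma ghost_comb_end:
  assumes f: "f \<in> supp_on (ghost_words w)" and u: "u \<in> V"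
  shows "f \<star> \<langle>[GV u]\<rangle> - restr {ghost_path u q | q. True} f \<in> J"
proof (rule supp_on_linear_mem[OF subspace_J f, where T="\<lambda>f. f \<star> \<langle>[GV u]\<rangle> - restr {ghost_path u q | q. True} f"])
  fix x assume "x \<in> ghost_words w"
  then obtain v q where x: "x = ghost_path v q" "is_path G v q" by (auto simp: ghost_words_def)
  note v = is_path_verts(1)[OF x(2)] and s = set_map_GE(2)[OF x(2)]
  show "\<langle>x\<rangle> \<star> \<langle>[GV u]\<rangle> - restr {ghost_path u q | q. True} \<langle>x\<rangle> \<in> J"
  proof (cases "v = u")
    case True
    then show ?thesis using wcong_pre[OF rel_VV[OF u] s] x
      by (auto simp: restr_simps mono_mult_mono wcong_def ghost_path_def)
  next
    case False
    then have "restr {ghost_path u q | q. True} \<langle>x\<rangle> = (0 :: ('v,'e,'k) fa)"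
      using x by (auto simp: restr_simps)
    then show ?thesis using wnull_pre[OF rel_VV0[OF v u False] s] x
      by (simp add: mono_mult_mono wnull_def ghost_path_def)
  qed
next
  fix c f show "(c \<cdot> f) \<star> \<langle>[GV u]\<rangle> - restr {ghost_path u q | q. True} (c \<cdot> f)
    = c \<cdot> (f \<star> \<langle>[GV u]\<rangle> - restr {ghost_path u q | q. True} f)"
    unfolding mult_distrib smult_simps restr_simps ..
qed (simp add: mult_distrib restr_simps)

text \<open>The vertex \<open>u\<close> acts on \<open>b\<close> as a left identity, so annihilation
  puts \<open>b\<close> into \<open>J\<close>. A nonzero \<open>b\<close> would then put
  \<open>u\<close> into \<open>J\<close>.\<close>

lemma ghost_comb_annihilated:
  assumes b: "b \<in> supp_on (ghost_words u)" "b \<in> ann Q" and u: "u \<in> V" "\<langle>[GV u]\<rangle> \<in> Q"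
  shows "b = 0"
proof (rule ccontr)
  assume "b \<noteq> 0"
  have "\<langle>[GV u]\<rangle> \<star> b \<in> J" using b(2) u(2) by (auto simp: ann_def)
  then have "b \<in> J" using ideal_cong[OF is_ideal_J ghost_comb_start[OF b(1)]] by blast
  then have "\<langle>[GV u]\<rangle> \<in> J" using ghost_comb_in_ideal[OF is_gideal_J _ b(1) \<open>b \<noteq> 0\<close>] by blast
  then show False using vertex_notin_J u by blast
qed

text \<open>Treats a left and a right factor \<open>u\<close> together: either way the reduction
  modulo \<open>J\<close> ends at a vertex reachable from \<open>u\<close>, by the path
  \<open>p\<close> itself or by a ghost path occurring in \<open>g\<close>.\<close>

lemma vertex_reduction:
  assumes x: "x \<in> F" and u: "u \<in> V" and z: "z = \<langle>[GV u]\<rangle> \<star> x \<or> z = x \<star> \<langle>[GV u]\<rangle>" "z \<notin> J"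
  obtains v p g where "is_path G v p" "g \<in> supp_on (ghost_words (path_end G v p))" "g \<notin> J"
    "\<langle>ghost_path v p\<rangle> \<star> z - g \<in> J" "reaches G u (path_end G v p)"
proof -
  have uF: "\<langle>[GV u]\<rangle> \<in> F" using u by (simp add: words_iff)
  have zF: "z \<in> F" using z(1) fa_set_mult[OF uF x] fa_set_mult[OF x uF] by auto
  obtain v p g where g: "is_path G v p" "g \<in> supp_on (ghost_words (path_end G v p))" "g \<notin> J"
    "\<langle>ghost_path v p\<rangle> \<star> z - g \<in> J"
    using ghost_reduction[OF is_gideal_J leak_free_J zF z(2)] by blast
  let ?w = "path_end G v p"
  have "reaches G u ?w"
    using z(1)
  proof
    assume zx: "z = \<langle>[GV u]\<rangle> \<star> x"
    \<comment> \<open>Otherwise the ghost path, whose word ends in \<open>v\<close>, would meet the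
      different vertex \<open>u\<close> and kill \<open>z\<close>.\<close>
    have "v = u"
    proof (rule ccontr)
      assume "v \<noteq> u"
      have "wnull (ghost_path v p @ [GV u])"
        using wnull_pre[OF rel_VV0[OF is_path_verts(1)[OF g(1)] u \<open>v \<noteq> u\<close>] set_map_GE(2)[OF g(1)]]
        by (simp add: ghost_path_def)
      then have "\<langle>ghost_path v p\<rangle> \<star> z \<in> J"
        unfolding zx mono_mono_mult wnull_def by (rule is_idealD(5)[OF is_ideal_J x])
      then show False using ideal_cong[OF is_ideal_J g(4)] g(3) by blast
    qed
    then show ?thesis using g(1) by (auto simp: reaches_def)
  next
    assume zx: "z = x \<star> \<langle>[GV u]\<rangle>"
    define g' where "g' = restr {ghost_path u q | q. True} g"
    have gF: "\<langle>ghost_path v p\<rangle> \<in> F" using set_ghost_path[OF g(1)] by (simp add: words_iff)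
    have "x \<star> \<langle>[GV u, GV u]\<rangle> - x \<star> \<langle>[GV u]\<rangle> \<in> J"
      using is_idealD(4)[OF is_ideal_J x rel_VV[OF u, unfolded wcong_def]] by (simp add: mult_distrib)
    then have "z \<star> \<langle>[GV u]\<rangle> - z \<in> J"
      unfolding zx using x by (simp add: mult_mono_mono fa_set_eq)
    then have 1: "(\<langle>ghost_path v p\<rangle> \<star> z) \<star> \<langle>[GV u]\<rangle> - \<langle>ghost_path v p\<rangle> \<star> z \<in> J"
      using is_idealD(4)[OF is_ideal_J gF] F_assoc[OF gF zF uF] by (fastforce simp: mult_distrib)
    have 2: "(\<langle>ghost_path v p\<rangle> \<star> z) \<star> \<langle>[GV u]\<rangle> - g \<star> \<langle>[GV u]\<rangle> \<in> J"
      using is_idealD(5)[OF is_ideal_J uF g(4)] by (simp add: mult_distrib)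
    have 3: "g \<star> \<langle>[GV u]\<rangle> - g' \<in> J" unfolding g'_def by (rule ghost_comb_end[OF g(2) u])
    \<comment> \<open>Right multiplication by \<open>u\<close> fixes \<open>z\<close> modulo
      \<open>J\<close>, so \<open>g\<close> is congruent to its part \<open>g'\<close>. Hence some
      ghost path starting at \<open>u\<close> occurs.\<close>
    have "g' \<notin> J"
      using ideal_cong[OF is_ideal_J 1] ideal_cong[OF is_ideal_J 2] ideal_cong[OF is_ideal_J 3]
        ideal_cong[OF is_ideal_J g(4)] g(3) by blast
    then have "g' \<noteq> 0" using subspaceD(1)[OF subspace_J] by auto
    then obtain y where "g' y \<noteq> 0" by (auto simp: fun_eq_iff fun_apply)
    moreover have "g' \<in> supp_on (ghost_words ?w \<inter> {ghost_path u q | q. True})"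
      unfolding g'_def by (rule restr_supp_on[OF g(2)])
    ultimately have "y \<in> ghost_words ?w \<inter> {ghost_path u q | q. True}" by (auto simp: supp_on_def)
    then obtain q where "is_path G u q" "path_end G u q = ?w" by (auto simp: ghost_words_def)
    then show ?thesis by (auto simp: reaches_def)
  qed
  then show thesis using that g by blast
qed

section \<open>Vertices in an ideal and double annihilators\<close>

definition vertices_of :: "('v,'e,'k) fa set \<Rightarrow> 'v set" where
  "vertices_of P = {v \<in> V. \<langle>[GV v]\<rangle> \<in> P}"

lemma ideal_wcong: "is_ideal P \<Longrightarrow> wcong u w \<Longrightarrow> \<langle>u\<rangle> \<in> P \<longleftrightarrow> \<langle>w\<rangle> \<in> P"
  unfolding wcong_def by (rule ideal_cong)

lemma hereditary_vertices_of:
  assumes P: "is_ideal P"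
  shows "hereditary (vertices_of P)"
  unfolding hereditary_def
proof (intro conjI ballI impI)
  fix e assume e: "e \<in> E" and s: "src G e \<in> vertices_of P"
  have "\<langle>[GV (src G e)] @ [GE e]\<rangle> \<in> P"
    using ideal_mono_mult(2)[OF P, of "\<langle>[GV (src G e)]\<rangle>" "[GE e]"] s e by (simp add: vertices_of_def mono_mult_mono)
  then have "\<langle>[GE e]\<rangle> \<in> P" using ideal_wcong[OF P rel_VE[OF e]] by simp
  then have "\<langle>[GG e, GE e]\<rangle> \<in> P"
    using ideal_mono_mult(1)[OF P, of "\<langle>[GE e]\<rangle>" "[GG e]"] e by (simp add: mono_mult_mono)
  then show "rng G e \<in> vertices_of P"
    using ideal_wcong[OF P rel_GE[OF e]] e by (simp add: vertices_of_def)
qed (auto simp: vertices_of_def)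

lemma saturated_vertices_of:
  assumes P: "is_ideal P"
  shows "saturated (vertices_of P)"
  unfolding saturated_def
proof (intro allI impI)
  fix v assume v: "regular v" and r: "\<forall>e\<in>emits v. rng G e \<in> vertices_of P"
  have "\<langle>[GE e, GG e]\<rangle> \<in> P" if "e \<in> emits v" for e
  proof -
    have e: "e \<in> E" and p: "\<langle>[GV (rng G e)]\<rangle> \<in> P" using r that by (auto simp: vertices_of_def)
    have "\<langle>[GE e, GV (rng G e), GG e]\<rangle> \<in> P"
      using ideal_mono_mult(2)[OF P ideal_mono_mult(1)[OF P p, of "[GE e]"], of "[GG e]"] e
      by (simp add: mono_mult_mono)
    then show ?thesis using ideal_wcong[OF P wcong_post[OF rel_EV[OF e], of "[GG e]"]] e by simp
  qed
  then have "(\<Sum>e\<in>emits v. \<langle>[GE e, GG e]\<rangle>) \<in> P" by (rule subspace_sum[OF is_idealD(3)[OF P]])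
  moreover have "\<langle>[GV v]\<rangle> - (\<Sum>e\<in>emits v. \<langle>[GE e, GG e]\<rangle>) \<in> J"
    using rel_CK2[of v] v by (simp add: regular_def)
  ultimately show "v \<in> vertices_of P"
    using ideal_cong[OF P] v by (auto simp: vertices_of_def regular_def)
qed

text \<open>A product outside \<open>J\<close> would reduce to a nonzero ghost combination in
  \<open>P\<close>. Its end is reachable from \<open>u\<close> and would belong to
  \<open>P\<close>.\<close>

lemma unreachable_in_ann:
  assumes P: "is_gideal P" and u: "u \<in> V" "\<not> (\<exists>h\<in>vertices_of P. reaches G u h)"
  shows "\<langle>[GV u]\<rangle> \<in> ann P"
proof -
  have Pi: "is_ideal P" using P by (simp add: is_gideal_def)
  have uF: "\<langle>[GV u]\<rangle> \<in> F" using u by (simp add: words_iff)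
  have "z \<in> J" if y: "y \<in> P" and z: "z = \<langle>[GV u]\<rangle> \<star> y \<or> z = y \<star> \<langle>[GV u]\<rangle>" for y z
  proof (rule ccontr)
    assume "z \<notin> J"
    have yF: "y \<in> F" using is_idealD(2)[OF Pi] y by blast
    from vertex_reduction[OF yF u(1) z \<open>z \<notin> J\<close>] obtain v p g where
      g: "is_path G v p" "g \<in> supp_on (ghost_words (path_end G v p))" "g \<notin> J"
      "\<langle>ghost_path v p\<rangle> \<star> z - g \<in> J" "reaches G u (path_end G v p)" .
    have "z \<in> P" using z is_idealD(4,5)[OF Pi uF y] by blast
    then have "\<langle>ghost_path v p\<rangle> \<star> z \<in> P" by (rule ideal_mono_mult(1)[OF Pi _ set_ghost_path[OF g(1)]])
    then have "g \<in> P" using ideal_cong[OF Pi g(4)] by blast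
    moreover have "g \<noteq> 0" using g(3) subspaceD(1)[OF subspace_J] by auto
    ultimately have "\<langle>[GV (path_end G v p)]\<rangle> \<in> P" using ghost_comb_in_ideal[OF P _ g(2)] by blast
    then have "path_end G v p \<in> vertices_of P" using is_path_verts(2)[OF g(1)] by (simp add: vertices_of_def)
    then show False using u(2) g(5) by blast
  qed
  then show ?thesis by (rule annI[OF uF])
qed

text \<open>An element of the double annihilator outside \<open>P\<close> reduces to a ghost
  combination \<open>g\<close> ending outside the vertices of \<open>P\<close>. That end reaches a
  vertex which annihilates \<open>P\<close>, and transporting \<open>g\<close> there makes it
  zero.\<close>

lemma ann_ann_eq:
  assumes gc: "graph_condition G" and P: "is_gideal P"
  shows "ann (ann P) = P"
proof
  have Pi: "is_ideal P" using P by (simp add: is_gideal_def)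
  let ?H = "vertices_of P"
  note H = hereditary_vertices_of[OF Pi] saturated_vertices_of[OF Pi]
  show "P \<subseteq> ann (ann P)" using ann_ann_superset is_idealD(2)[OF Pi] by blast
  have AAi: "is_ideal (ann (ann P))" by (intro is_ideal_ann Pi)
  have lf: "leak_free P"
    unfolding leak_free_def
  proof (intro ballI impI)
    fix v e assume v: "v \<in> V" "infinite (emits v)" "\<langle>[GV v]\<rangle> \<notin> P" and e: "e \<in> emits v"
    have "rng G e \<notin> ?H"
      by (rule graph_condition_no_leak[OF gc H(1) v(2,1) _ e]) (use v in \<open>simp add: vertices_of_def\<close>)
    then show "\<langle>[GV (rng G e)]\<rangle> \<notin> P" using e by (auto simp: vertices_of_def)
  qed
  show "ann (ann P) \<subseteq> P"
  proof (rule subsetI, rule ccontr)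
    fix a assume a: "a \<in> ann (ann P)" "a \<notin> P"
    have aF: "a \<in> F" using a by (simp add: ann_def)
    from ghost_reduction[OF P lf aF a(2)] obtain v p g where
      g: "is_path G v p" "g \<in> supp_on (ghost_words (path_end G v p))" "g \<notin> P"
      "\<langle>ghost_path v p\<rangle> \<star> a - g \<in> J" .
    let ?w = "path_end G v p"
    have wV: "?w \<in> V" using is_path_verts(2)[OF g(1)] .
    have "\<langle>ghost_path v p\<rangle> \<star> a \<in> ann (ann P)"
      by (rule ideal_mono_mult(1)[OF AAi a(1) set_ghost_path[OF g(1)]])
    then have gA: "g \<in> ann (ann P)" using ideal_cong[OF AAi g(4)] by blast
    have "?w \<notin> ?H"
    proof
      assume "?w \<in> ?H"
      moreover have "g \<in> F" using gA by (simp add: ann_def)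
      ultimately have "\<langle>[GV ?w]\<rangle> \<star> g \<in> P" using is_idealD(5)[OF Pi] by (simp add: vertices_of_def)
      then show False using ideal_cong[OF Pi ghost_comb_start[OF g(2)]] g(3) by blast
    qed
    \<comment> \<open>Here the graph condition enters a second time, after its use for
      \<open>leak_free\<close>.\<close>
    then have "\<not> inescapable ?H ?w"
      using graph_condition_dense_closed[OF gc] H by (auto simp: dense_closed_def)
    then obtain u where u: "reaches G ?w u" "\<not> (\<exists>h\<in>?H. reaches G u h)"
      using wV by (auto simp: inescapable_def)
    then obtain s where s: "is_path G ?w s" "path_end G ?w s = u" by (auto simp: reaches_def)
    have uV: "u \<in> V" using u(1) by (rule reaches_verts)
    have "\<langle>rev (map GG s)\<rangle> \<star> g = 0"
    proof (rule ghost_comb_annihilated[OF _ _ uV unreachable_in_ann[OF P uV u(2)]])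
      show "\<langle>rev (map GG s)\<rangle> \<star> g \<in> supp_on (ghost_words u)"
        using GG_ghost_comb[OF g(2) s(1)] s(2) by simp
      show "\<langle>rev (map GG s)\<rangle> \<star> g \<in> ann (ann P)"
        by (rule ideal_mono_mult(1)[OF AAi gA set_map_GE(2)[OF s(1)]])
    qed
    then have "g = 0" by (rule GG_ghost_comb_0)
    then show False using g(3) subspaceD(1)[OF is_idealD(3)[OF Pi]] by simp
  qed
qed

text \<open>The transport argument with exchanged roles: \<open>g\<close> lies in the annihilator,
  and its end reaches a vertex of \<open>H\<close>, which annihilates the transported
  combination.\<close>

lemma inescapable_in_ann_ann:
  assumes H: "H \<subseteq> V" and v: "inescapable H v"
  shows "\<langle>[GV v]\<rangle> \<in> ann (ann (vertex_ideal H))"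
proof -
  let ?P = "vertex_ideal H"
  have Pi: "is_ideal ?P" using is_gideal_vertex_ideal[OF H] by (simp add: is_gideal_def)
  have Ai: "is_ideal (ann ?P)" by (rule is_ideal_ann[OF Pi])
  have vV: "v \<in> V" using v by (simp add: inescapable_def)
  have vF: "\<langle>[GV v]\<rangle> \<in> F" using vV by (simp add: words_iff)
  have "z \<in> J" if x: "x \<in> ann ?P" and z: "z = \<langle>[GV v]\<rangle> \<star> x \<or> z = x \<star> \<langle>[GV v]\<rangle>" for x z
  proof (rule ccontr)
    assume "z \<notin> J"
    have xF: "x \<in> F" using x by (simp add: ann_def)
    from vertex_reduction[OF xF vV z \<open>z \<notin> J\<close>] obtain u p g where
      g: "is_path G u p" "g \<in> supp_on (ghost_words (path_end G u p))" "g \<notin> J"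
      "\<langle>ghost_path u p\<rangle> \<star> z - g \<in> J" "reaches G v (path_end G u p)" .
    let ?w = "path_end G u p"
    obtain h where h: "h \<in> H" "reaches G ?w h" using v g(5) by (auto simp: inescapable_def)
    then obtain s where s: "is_path G ?w s" "path_end G ?w s = h" by (auto simp: reaches_def)
    have "z \<in> ann ?P" using z is_idealD(4,5)[OF Ai vF x] by blast
    then have "\<langle>ghost_path u p\<rangle> \<star> z \<in> ann ?P" by (rule ideal_mono_mult(1)[OF Ai _ set_ghost_path[OF g(1)]])
    then have gA: "g \<in> ann ?P" using ideal_cong[OF Ai g(4)] by blast
    have "\<langle>rev (map GG s)\<rangle> \<star> g = 0"
    proof (rule ghost_comb_annihilated[OF _ _ _ vertex_ideal_vertex[OF h(1)]])
      show "\<langle>rev (map GG s)\<rangle> \<star> g \<in> supp_on (ghost_words h)"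
        using GG_ghost_comb[OF g(2) s(1)] s(2) by simp
      show "\<langle>rev (map GG s)\<rangle> \<star> g \<in> ann ?P"
        by (rule ideal_mono_mult(1)[OF Ai gA set_map_GE(2)[OF s(1)]])
      show "h \<in> V" using h H by blast
    qed
    then have "g = 0" by (rule GG_ghost_comb_0)
    then show False using g(3) subspaceD(1)[OF subspace_J] by simp
  qed
  then show ?thesis by (rule annI[OF vF])
qed

theorem graph_condition_iff_ann_ann:
  "graph_condition G \<longleftrightarrow> (\<forall>P. is_gideal P \<longrightarrow> ann (ann P) = P)"
proof
  assume a: "\<forall>P. is_gideal P \<longrightarrow> ann (ann P) = P"
  have dense_closed
    unfolding dense_closed_def
  proof (intro allI impI)
    fix H v assume H: "hereditary H" "saturated H" and v: "inescapable H v"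
    have HV: "H \<subseteq> V" using H(1) by (simp add: hereditary_def)
    have vV: "v \<in> V" using v by (simp add: inescapable_def)
    have "\<langle>[GV v]\<rangle> \<in> vertex_ideal H"
      using inescapable_in_ann_ann[OF HV v] a is_gideal_vertex_ideal[OF HV] by metis
    then show "v \<in> H" using vertex_ideal_iff[OF H vV] by blast
  qed
  then show "graph_condition G" by (simp add: graph_condition_iff_dense_closed)
qed (use ann_ann_eq in blast)

section \<open>Passage to the quotient algebra\<close>

abbreviation cls :: "('v,'e,'k) fa \<Rightarrow> ('v,'e,'k) fa set" where "cls \<equiv> lpa_cls G"

lemma cls_iff: "y \<in> cls x \<longleftrightarrow> y \<in> F \<and> y - x \<in> J"
  by (simp add: lpa_cls_def fa_diff_eq)

lemma cls_eq:
  assumes "f \<in> F" "g \<in> F"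
  shows "cls f = cls g \<longleftrightarrow> f - g \<in> J"
proof
  assume "cls f = cls g"
  moreover have "f \<in> cls f" using assms subspaceD(1)[OF subspace_J] by (simp add: cls_iff)
  ultimately show "f - g \<in> J" by (simp add: cls_iff)
next
  assume fg: "f - g \<in> J"
  have "y - f \<in> J \<longleftrightarrow> y - g \<in> J" for y
    using subspace_diff_trans[OF subspace_J _ fg] subspace_diff_trans[OF subspace_J _ subspace_diff_sym[OF subspace_J fg]]
    by blast
  then show "cls f = cls g" by (auto simp: cls_iff)
qed

lemma rep_cls:
  assumes "f \<in> F"
  shows "lpa_rep (cls f) \<in> F" "lpa_rep (cls f) - f \<in> J"
proof -
  have "f \<in> cls f" using assms subspaceD(1)[OF subspace_J] by (simp add: cls_iff)
  then have "lpa_rep (cls f) \<in> cls f" unfolding lpa_rep_def by (rule someI[where P="\<lambda>x. x \<in> cls f"])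
  then show "lpa_rep (cls f) \<in> F" "lpa_rep (cls f) - f \<in> J" by (auto simp: cls_iff)
qed

lemma lpa_zero_cls: "lpa_zero G = cls 0"
  by (simp add: lpa_zero_def fa_zero_eq)

lemma lpa_add_cls:
  assumes "f \<in> F" "g \<in> F"
  shows "lpa_add G (cls f) (cls g) = cls (f + g)"
proof -
  let ?f = "lpa_rep (cls f)" and ?g = "lpa_rep (cls g)"
  have "(?f + ?g) - (f + g) = (?f - f) + (?g - g)" by simp
  also have "\<dots> \<in> J" by (intro subspaceD(2)[OF subspace_J] rep_cls assms)
  finally show ?thesis unfolding lpa_add_def fa_add_eq
    using assms rep_cls subspaceD(2)[OF subspace_F] by (subst cls_eq) auto
qed

lemma lpa_neg_cls:
  assumes "f \<in> F"
  shows "lpa_neg G (cls f) = cls ((- 1) \<cdot> f)"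
proof -
  let ?f = "lpa_rep (cls f)"
  have "(- 1) \<cdot> ?f - (- 1) \<cdot> f = (- 1) \<cdot> (?f - f)" by (simp only: smult_simps)
  also have "\<dots> \<in> J" by (intro subspaceD(3)[OF subspace_J] rep_cls assms)
  finally show ?thesis unfolding lpa_neg_def
    using assms rep_cls subspaceD(3)[OF subspace_F] by (subst cls_eq) auto
qed

lemma lpa_mult_cls:
  assumes "f \<in> F" "g \<in> F"
  shows "lpa_mult G (cls f) (cls g) = cls (f \<star> g)"
proof -
  let ?f = "lpa_rep (cls f)" and ?g = "lpa_rep (cls g)"
  have "?f \<star> ?g - f \<star> g = (?f - f) \<star> ?g + f \<star> (?g - g)" by (simp add: mult_distrib)
  also have "\<dots> \<in> J"
    by (intro subspaceD(2)[OF subspace_J] is_idealD(4,5)[OF is_ideal_J] rep_cls assms)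
  finally show ?thesis unfolding lpa_mult_def
    using assms rep_cls(1)[OF assms(1)] rep_cls(1)[OF assms(2)] by (subst cls_eq) (simp_all add: fa_set_mult)
qed

lemma lpa_carrier_eq: "lpa_carrier G = cls ` F"
  by (simp add: lpa_carrier_def)

definition preideal :: "('v,'e,'k) fa set set \<Rightarrow> ('v,'e,'k) fa set" where
  "preideal I = {f \<in> F. cls f \<in> I}"

lemma cls_preideal: "I \<subseteq> lpa_carrier G \<Longrightarrow> cls ` preideal I = I"
  by (auto simp: preideal_def lpa_carrier_eq)

lemma is_ideal_preideal:
  assumes I: "lpa_ideal G I"
  shows "is_ideal (preideal I)"
proof -
  have I0: "cls 0 \<in> I" and Ia: "\<And>X Y. X \<in> I \<Longrightarrow> Y \<in> I \<Longrightarrow> lpa_add G X Y \<in> I"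
    and Im: "\<And>A X. A \<in> lpa_carrier G \<Longrightarrow> X \<in> I \<Longrightarrow> lpa_mult G A X \<in> I"
      "\<And>A X. A \<in> lpa_carrier G \<Longrightarrow> X \<in> I \<Longrightarrow> lpa_mult G X A \<in> I"
    using I by (auto simp: lpa_ideal_def lpa_zero_cls)
  have mult: "a \<star> x \<in> preideal I" "x \<star> a \<in> preideal I" if "a \<in> F" "x \<in> preideal I" for a x
  proof -
    have x: "x \<in> F" "cls x \<in> I" using that(2) by (auto simp: preideal_def)
    show "a \<star> x \<in> preideal I" "x \<star> a \<in> preideal I"
      using Im[of "cls a" "cls x"] that(1) x lpa_mult_cls[OF that(1) x(1)] lpa_mult_cls[OF x(1) that(1)]
      by (auto simp: preideal_def lpa_carrier_eq fa_set_mult)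
  qed
  have J: "f \<in> preideal I \<longleftrightarrow> g \<in> preideal I" if "f \<in> F" "g \<in> F" "f - g \<in> J" for f g
    using that cls_eq[of f g] by (simp add: preideal_def)
  have add: "x + y \<in> preideal I" if "x \<in> preideal I" "y \<in> preideal I" for x y
    using that Ia[of "cls x" "cls y"] lpa_add_cls[of x y] subspaceD(2)[OF subspace_F]
    by (auto simp: preideal_def)
  \<comment> \<open>\<open>lpa_ideal\<close> speaks of sums, negatives and products only. Closure
    under scalars follows by multiplying with \<open>c\<close> times a local unit.\<close>
  have smult: "c \<cdot> x \<in> preideal I" if x: "x \<in> preideal I" for c x
  proof -
    have xF: "x \<in> F" using x by (simp add: preideal_def)
    obtain S where S: "S \<subseteq> V" "(\<Sum>v\<in>S. \<langle>[GV v]\<rangle>) \<star> x - x \<in> J" using local_unit[OF xF] by blast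
    let ?u = "\<Sum>v\<in>S. \<langle>[GV v]\<rangle> :: ('v,'e,'k) fa"
    have uF: "?u \<in> F" by (rule subspace_sum[OF subspace_F]) (use S(1) in \<open>auto simp: words_iff\<close>)
    have cuF: "c \<cdot> ?u \<in> F" by (rule subspaceD(3)[OF subspace_F uF])
    have "(c \<cdot> ?u) \<star> x - c \<cdot> x = c \<cdot> (?u \<star> x - x)" unfolding mult_distrib smult_simps ..
    also have "\<dots> \<in> J" by (rule subspaceD(3)[OF subspace_J S(2)])
    finally have "(c \<cdot> ?u) \<star> x - c \<cdot> x \<in> J" .
    from J[OF fa_set_mult[OF cuF xF] subspaceD(3)[OF subspace_F xF] this] mult(1)[OF cuF x]
    show ?thesis by simp
  qed
  have zero: "0 \<in> preideal I" using I0 by (simp add: preideal_def)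
  show ?thesis
    unfolding is_ideal_def subspace_def
  proof (intro conjI ballI allI)
    show "J \<subseteq> preideal I"
    proof
      fix f assume "f \<in> J"
      then show "f \<in> preideal I" using J[of f 0] zero J_F by auto
    qed
    show "preideal I \<subseteq> F" by (auto simp: preideal_def)
  qed (use zero add smult mult in auto)
qed

lemma lpa_ideal_cls:
  assumes P: "is_ideal P"
  shows "lpa_ideal G (cls ` P)"
proof -
  note PF = is_idealD(2)[OF P, THEN subsetD] and sub = is_idealD(3)[OF P]
  show ?thesis
    unfolding lpa_ideal_def lpa_carrier_eq lpa_zero_cls
  proof (intro conjI ballI)
    show "cls ` P \<subseteq> cls ` F" using is_idealD(2)[OF P] by blast
    show "cls 0 \<in> cls ` P" using subspaceD(1)[OF sub] by blast
    fix X assume "X \<in> cls ` P"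
    then obtain x where x: "X = cls x" "x \<in> P" by blast
    show "lpa_neg G X \<in> cls ` P" unfolding x(1) lpa_neg_cls[OF PF[OF x(2)]]
      using subspaceD(3)[OF sub x(2)] by blast
    show "lpa_add G X Y \<in> cls ` P" if "Y \<in> cls ` P" for Y
    proof -
      obtain y where y: "Y = cls y" "y \<in> P" using \<open>Y \<in> cls ` P\<close> by blast
      show ?thesis unfolding x(1) y(1) lpa_add_cls[OF PF[OF x(2)] PF[OF y(2)]]
        using subspaceD(2)[OF sub x(2) y(2)] by blast
    qed
  next
    fix A X assume "A \<in> cls ` F" "X \<in> cls ` P"
    then obtain a x where x: "A = cls a" "a \<in> F" "X = cls x" "x \<in> P" by blast
    show "lpa_mult G A X \<in> cls ` P" unfolding x lpa_mult_cls[OF x(2) PF[OF x(4)]]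
      using is_idealD(4)[OF P x(2,4)] by blast
    show "lpa_mult G X A \<in> cls ` P" unfolding x lpa_mult_cls[OF PF[OF x(4)] x(2)]
      using is_idealD(5)[OF P x(2,4)] by blast
  qed
qed

lemma cls_image_eq:
  assumes "is_ideal P" "is_ideal Q"
  shows "cls ` P = cls ` Q \<longleftrightarrow> P = Q"
proof
  have *: "P \<subseteq> Q" if P: "is_ideal P" and Q: "is_ideal Q" and PQ: "cls ` P = cls ` Q" for P Q
  proof
    fix x assume x: "x \<in> P"
    then obtain y where y: "y \<in> Q" "cls x = cls y" using PQ by blast
    then have "x - y \<in> J" using cls_eq[of x y] x is_idealD(2)[OF P] is_idealD(2)[OF Q] by blast
    then show "x \<in> Q" using ideal_cong[OF Q] y(1) by blast
  qed
  assume "cls ` P = cls ` Q"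
  then show "P = Q" using *[OF assms] *[OF assms(2,1)] by auto
qed simp

lemma lpa_ann_cls:
  assumes P: "P \<subseteq> F"
  shows "lpa_ann G (cls ` P) = cls ` ann P"
proof -
  have "(\<forall>X\<in>cls ` P. lpa_mult G (cls a) X = lpa_zero G \<and> lpa_mult G X (cls a) = lpa_zero G) \<longleftrightarrow> a \<in> ann P"
    if a: "a \<in> F" for a
  proof -
    have "lpa_mult G (cls a) (cls x) = lpa_zero G \<longleftrightarrow> a \<star> x \<in> J"
      "lpa_mult G (cls x) (cls a) = lpa_zero G \<longleftrightarrow> x \<star> a \<in> J" if "x \<in> P" for x
    proof -
      have x: "x \<in> F" using that P by blast
      show "lpa_mult G (cls a) (cls x) = lpa_zero G \<longleftrightarrow> a \<star> x \<in> J"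
        "lpa_mult G (cls x) (cls a) = lpa_zero G \<longleftrightarrow> x \<star> a \<in> J"
        using cls_eq[of "a \<star> x" 0] cls_eq[of "x \<star> a" 0]
        by (simp_all add: lpa_mult_cls a x lpa_zero_cls fa_set_mult)
    qed
    then show ?thesis using a by (auto simp: ann_def)
  qed
  then show ?thesis unfolding lpa_ann_def lpa_carrier_eq by (auto simp: ann_def)
qed

lemma annihilator_ideal_cls:
  assumes P: "is_ideal P"
  shows "annihilator_ideal G (cls ` P) \<longleftrightarrow> ann (ann P) = P"
proof -
  have "ann P \<subseteq> F" by (auto simp: ann_def)
  then show ?thesis
    unfolding annihilator_ideal_def lpa_ann_cls[OF is_idealD(2)[OF P]] lpa_ann_cls[OF \<open>ann P \<subseteq> F\<close>]
    by (intro cls_image_eq is_ideal_ann P)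
qed

text \<open>The form of the words in \<open>lpa_hgens\<close>, where a vertex is written only for a
  path of length 0.\<close>

definition short_word :: "'v \<Rightarrow> 'e list \<Rightarrow> 'v \<Rightarrow> 'e list \<Rightarrow> ('v,'e) gen list" where
  "short_word v p u q = (if p = [] then [GV v] else map GE p) @ (if q = [] then [GV u] else rev (map GG q))"

lemma lpa_hgens_eq:
  "lpa_hgens G n = {\<langle>short_word v p u q\<rangle> | v p u q.
      is_path G v p \<and> is_path G u q \<and> int (length p) - int (length q) = n}"
  unfolding lpa_hgens_def path_word_def ghost_word_def short_word_def
  by (intro Collect_cong ex_cong1) (auto simp: mono_mult_mono)

lemma basis_word_short:
  assumes "path_pair v p u q"
  shows "wcong (basis_word v p u q) (short_word v p u q)"
proof -
  let ?a = "if p = [] then [GV v] else map GE p :: ('v,'e) gen list"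
  let ?b = "if q = [] then [GV u] else rev (map GG q) :: ('v,'e) gen list"
  have p: "is_path G v p" and q: "is_path G u q" using assms by auto
  have sa: "set ?a \<subseteq> gens G" using set_map_GE(1)[OF p] is_path_verts(1)[OF p] by auto
  have sb: "set (ghost_path u q) \<subseteq> gens G" using set_ghost_path[OF q] .
  have 1: "wcong (GV v # map GE p) ?a"
  proof (cases p)
    case (Cons e p')
    then show ?thesis using p wcong_post[OF rel_VE[of e], of "map GE p'"] set_map_GE(1)[of "rng G e" p'] by auto
  qed simp
  have 2: "wcong (ghost_path u q) ?b"
  proof (cases q)
    case (Cons e q')
    then show ?thesis using q wcong_pre[OF rel_GV[of e], of "rev (map GG q')"] set_map_GE(2)[of "rng G e" q']
      by (auto simp: ghost_path_def)
  qed (simp add: ghost_path_def)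
  have "wcong (basis_word v p u q) (?a @ ghost_path u q)"
    using wcong_post[OF 1 sb] by (simp add: basis_word_def)
  also have "wcong \<dots> (?a @ ?b)" by (rule wcong_pre[OF 2 sa])
  finally show ?thesis by (simp add: short_word_def)
qed

lemma short_word_props:
  assumes "is_path G v p" "is_path G u q"
  shows "short_word v p u q \<in> words G" "word_deg (short_word v p u q) = int (length p) - int (length q)"
  using set_map_GE[OF assms(1)] set_map_GE[OF assms(2)] is_path_verts(1)[OF assms(1)] is_path_verts(1)[OF assms(2)]
  by (auto simp: short_word_def words_iff)

lemma fa_span_subset:
  assumes "H \<subseteq> W" "subspace W"
  shows "fa_span H \<subseteq> W"
proof
  fix f assume "f \<in> fa_span H"
  then show "f \<in> W"
    by induction (use assms subspaceD[OF assms(2)] in \<open>auto simp: fa_eqs\<close>)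
qed

lemma fa_span_hgens: "fa_span (lpa_hgens G n) \<subseteq> supp_on (words G \<inter> {w. word_deg w = n})"
  by (rule fa_span_subset[OF _ subspace_supp_on]) (auto simp: lpa_hgens_eq short_word_props)

text \<open>The normal form of a word keeps its degree, so the components \<open>lpa_comp\<close>
  capture all homogeneous elements.\<close>

lemma homogeneous_span:
  fixes f :: "('v,'e,'k) fa"
  assumes f: "f \<in> supp_on (words G \<inter> {w. word_deg w = n})"
  shows "\<exists>g\<in>fa_span (lpa_hgens G n). f - g \<in> J"
proof -
  define B where "B = {short_word v p u q | v p u q.
      is_path G v p \<and> is_path G u q \<and> int (length p) - int (length q) = n}"
  have "\<exists>g\<in>supp_on B. \<langle>[]\<rangle> \<star> f - g \<in> J"
  proof (rule left_mult_rewrite[OF f])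
    fix w assume "w \<in> words G \<inter> {w. word_deg w = n}"
    then have w: "w \<in> words G" "word_deg w = n" by auto
    from word_normal_form[OF w(1)] show "wnull ([] @ w) \<or> (\<exists>w'\<in>B. wcong ([] @ w) w')"
    proof (elim disjE exE)
      fix v p u q
      assume a: "path_pair v p u q \<and> int (length p) - int (length q) = word_deg w \<and> wcong w (basis_word v p u q)"
      then have "path_pair v p u q" by blast
      from wcong_trans[OF _ basis_word_short[OF this]] a have "wcong w (short_word v p u q)" by blast
      moreover have "short_word v p u q \<in> B" unfolding B_def using a w(2) by blast
      ultimately show ?thesis by auto
    qed simp
  qed
  then obtain g where g: "g \<in> supp_on B" "f - g \<in> J" by auto
  have "g \<in> fa_span (lpa_hgens G n)" using g(1)
  proof (induction rule: supp_on_induct)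
    case zero
    show ?case using fa_span.zero by (simp only: fa_zero_eq)
  next
    case (step c w g)
    have "\<langle>w\<rangle> \<in> lpa_hgens G n" using step(1) unfolding lpa_hgens_eq B_def by blast
    then have "fa_add (c \<cdot> \<langle>w\<rangle>) g \<in> fa_span (lpa_hgens G n)"
      by (intro fa_span.add fa_span.smult fa_span.gen step)
    then show ?case by (simp only: fa_add_eq)
  qed
  with g(2) show ?thesis by blast
qed

lemma lpa_sum_cls:
  assumes "finite N" "\<And>n. n \<in> N \<Longrightarrow> Y n = cls (y n)" "\<And>n. n \<in> N \<Longrightarrow> y n \<in> F"
  shows "lpa_sum G Y N = cls (\<Sum>n\<in>N. y n)"
proof -
  have rep: "lpa_rep (Y n) \<in> F" "lpa_rep (Y n) - y n \<in> J" if "n \<in> N" for n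
    unfolding assms(2)[OF that] by (rule rep_cls[OF assms(3)[OF that]])+
  have "(\<lambda>w. \<Sum>n\<in>N. lpa_rep (Y n) w) = (\<Sum>n\<in>N. lpa_rep (Y n))"
    by (simp add: fun_eq_iff sum_fun_apply)
  moreover have "(\<Sum>n\<in>N. lpa_rep (Y n)) - (\<Sum>n\<in>N. y n) \<in> J"
    unfolding sum_subtractf[symmetric] by (rule subspace_sum[OF subspace_J rep(2)])
  ultimately show ?thesis
    unfolding lpa_sum_def using rep assms(3)
    by (simp add: cls_eq subspace_sum[OF subspace_F])
qed

text \<open>A decomposition of the class of \<open>f\<close> lifts to a congruence modulo
  \<open>J\<close> between \<open>f\<close> and a sum of homogeneous elements. Since
  \<open>J\<close> is graded, the congruence may be projected to degree \<open>m\<close>, where at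
  most one summand survives.\<close>

lemma is_gideal_preideal:
  assumes I: "graded_ideal G I"
  shows "is_gideal (preideal I)"
  unfolding is_gideal_def
proof (intro conjI ballI allI)
  show Pi: "is_ideal (preideal I)"
    using I by (intro is_ideal_preideal) (simp add: graded_ideal_def)
  fix f m assume f: "f \<in> preideal I"
  then have fF: "f \<in> F" and fI: "cls f \<in> I" by (auto simp: preideal_def)
  obtain N Y where N: "finite N" "\<forall>n\<in>N. Y n \<in> I \<inter> lpa_comp G n" "cls f = lpa_sum G Y N"
    using I fI unfolding graded_ideal_def by blast
  have "\<forall>n\<in>N. \<exists>y. y \<in> fa_span (lpa_hgens G n) \<and> Y n = cls y"
    using N(2) by (auto simp: lpa_comp_def)
  from bchoice[OF this] obtain y where "\<forall>n\<in>N. y n \<in> fa_span (lpa_hgens G n) \<and> Y n = cls (y n)"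
    by (elim exE)
  then have y: "y n \<in> supp_on (words G \<inter> {w. word_deg w = n})" "Y n = cls (y n)" if "n \<in> N" for n
    using that fa_span_hgens by blast+
  have yF: "y n \<in> F" if "n \<in> N" for n
    unfolding fa_set_eq by (rule supp_on_subset[OF y(1)[OF that]]) blast
  have yP: "y n \<in> preideal I" if "n \<in> N" for n
    using N(2) y(2)[OF that] yF[OF that] that by (auto simp: preideal_def)
  have "cls f = cls (\<Sum>n\<in>N. y n)" unfolding N(3) by (rule lpa_sum_cls[OF N(1) y(2) yF])
  then have "f - (\<Sum>n\<in>N. y n) \<in> J"
    using cls_eq[OF fF subspace_sum[where F=y and S=N, OF subspace_F yF]] by simp
  then have "hproj m (f - (\<Sum>n\<in>N. y n)) \<in> J" using is_gideal_J by (simp add: is_gideal_def)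
  then have 1: "hproj m f - (\<Sum>n\<in>N. hproj m (y n)) \<in> J" by (simp add: restr_simps restr_sum)
  have "hproj m (y n) \<in> preideal I" if "n \<in> N" for n
  proof (cases "n = m")
    case True
    then have "hproj m (y n) = y n" by (intro restr_id[OF y(1)[OF that]]) auto
    then show ?thesis using yP[OF that] by simp
  next
    case False
    then have "hproj m (y n) = 0" by (intro restr_null[OF y(1)[OF that]]) auto
    then show ?thesis using subspaceD(1)[OF is_idealD(3)[OF Pi]] by simp
  qed
  then have "(\<Sum>n\<in>N. hproj m (y n)) \<in> preideal I" by (rule subspace_sum[OF is_idealD(3)[OF Pi]])
  then show "hproj m f \<in> preideal I" using ideal_cong[OF Pi 1] by blast
qed

lemma graded_ideal_cls:
  assumes P: "is_gideal P"
  shows "graded_ideal G (cls ` P)"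
  unfolding graded_ideal_def
proof (intro conjI ballI)
  have Pi: "is_ideal P" using P by (simp add: is_gideal_def)
  show "lpa_ideal G (cls ` P)" by (rule lpa_ideal_cls[OF Pi])
  fix X assume "X \<in> cls ` P"
  then obtain f where f: "X = cls f" "f \<in> P" by blast
  have fF: "f \<in> F" using is_idealD(2)[OF Pi] f(2) by blast
  have hP: "hproj n f \<in> P" for n using P f(2) by (simp add: is_gideal_def)
  have hF: "hproj n f \<in> F" for n using hP is_idealD(2)[OF Pi] by blast
  \<comment> \<open>The degrees that occur in \<open>f\<close>; the projections to them add up to
    \<open>f\<close>.\<close>
  define N where "N = word_deg ` {w. f w \<noteq> 0}"
  have fin: "finite N" using fF by (simp add: N_def fa_set_def)
  have "f = (\<Sum>n\<in>N. hproj n f)"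
  proof
    fix w
    have "(\<Sum>n\<in>N. hproj n f w) = (\<Sum>n\<in>N. if n = word_deg w then f w else 0)"
      by (rule sum.cong) (auto simp: restr_def)
    also have "\<dots> = f w" using fin by (auto simp: N_def)
    finally show "f w = (\<Sum>n\<in>N. hproj n f) w" by (simp add: sum_fun_apply)
  qed
  moreover have "lpa_sum G (\<lambda>n. cls (hproj n f)) N = cls (\<Sum>n\<in>N. hproj n f)"
    by (rule lpa_sum_cls[OF fin]) (use hF in auto)
  ultimately have "X = lpa_sum G (\<lambda>n. cls (hproj n f)) N" using f(1) by simp
  moreover have "cls (hproj n f) \<in> cls ` P \<inter> lpa_comp G n" for n
  proof -
    have "hproj n f \<in> supp_on (words G \<inter> {w. word_deg w = n})"
      using restr_supp_on[of f "words G"] fF by (simp add: fa_set_eq)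
    from homogeneous_span[OF this] obtain g where g: "g \<in> fa_span (lpa_hgens G n)" "hproj n f - g \<in> J" by blast
    have "g \<in> F" unfolding fa_set_eq
      by (rule supp_on_subset[OF fa_span_hgens[THEN subsetD, OF g(1)]]) blast
    then have "cls (hproj n f) = cls g" using cls_eq[OF hF] g(2) by blast
    then show ?thesis using hP g(1) by (auto simp: lpa_comp_def)
  qed
  ultimately show "\<exists>N Y. finite N \<and> (\<forall>n\<in>N. Y n \<in> cls ` P \<inter> lpa_comp G n) \<and> X = lpa_sum G Y N"
    using fin by (intro exI[of _ N] exI[of _ "\<lambda>n. cls (hproj n f)"]) simp
qed

theorem graded_ideals_annihilator_iff:
  "(\<forall>I :: ('v,'e,'k) fa set set. graded_ideal G I \<longrightarrow> annihilator_ideal G I) \<longleftrightarrow> graph_condition G"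
  unfolding graph_condition_iff_ann_ann
proof (intro iffI allI impI)
  fix P :: "('v,'e,'k) fa set"
  assume a: "\<forall>I :: ('v,'e,'k) fa set set. graded_ideal G I \<longrightarrow> annihilator_ideal G I" and P: "is_gideal P"
  have "annihilator_ideal G (cls ` P)" using a graded_ideal_cls[OF P] by blast
  then show "ann (ann P) = P" using annihilator_ideal_cls[of P] P by (simp add: is_gideal_def)
next
  fix I :: "('v,'e,'k) fa set set"
  assume a: "\<forall>P. is_gideal P \<longrightarrow> ann (ann P) = P" and I: "graded_ideal G I"
  note P = is_gideal_preideal[OF I]
  have "annihilator_ideal G (cls ` preideal I)"
    using annihilator_ideal_cls[of "preideal I"] P a by (simp add: is_gideal_def)
  then show "annihilator_ideal G I"
    using cls_preideal[of I] I by (simp add: graded_ideal_def lpa_ideal_def)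
qed

end

theorem theorem3p14:
  fixes G :: "('v,'e) dgraph"
  assumes "wf_graph G"
  shows "(\<forall>I :: ('v,'e,'k::field) fa set set. graded_ideal G I \<longrightarrow> annihilator_ideal G I)
         \<longleftrightarrow> graph_condition G"
proof -
  interpret lpa_graph G "TYPE('k)"
    by standard (rule assms)
  show ?thesis by (rule graded_ideals_annihilator_iff)
qed

end
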